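(* Let $d \ge 2$ and let $\Omega \subseteq \mathbb{R}^d$ be a bounded connected open set with Lipschitz boundary. There exists a constant $C>0$ depending only on $\Omega$ and $d$ such that for every $f \in L^\infty(\Omega)$ with $\int_\Omega f = 0$ and $f\neq 0$, $$\|f\|_{H^{-1}} \le C \begin{cases} \|f\|_{L^1} \sqrt{ \left| \log \dfrac{\|f\|_{L^1}}{\|f\|_{L^\infty}} \right| + 1 } & \text{if } d = 2, \\[2mm] \|f\|_{L^1}^{\frac 1 2 + \frac 1 d}\, \|f\|_{L^\infty}^{\frac 1 2 - \frac 1 d} & \text{if } d > 2. \end{cases}$$
   Context: All norms are on $\Omega$. The negative Sobolev norm is $\|f\|_{H^{-1}} = \sup\left\{ \int_\Omega f\phi \,:\, \phi\in H^1(\Omega),\ \|\nabla\phi\|_{L^2(\Omega)} \le 1 \right\}$. *)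

theory Defs
  imports "HOL-Analysis.Analysis" "HOL-Probability.Essential_Supremum"
begin

(* Near each boundary point, after a rotation taking e to the last coordinate direction, the
   set is the strict epigraph of a Lipschitz function of the remaining coordinates; the
   hyperplane orthogonal to e plays the role of R^(d-1). *)
definition lipschitz_boundary :: "'a::euclidean_space set \<Rightarrow> bool" where
  "lipschitz_boundary \<Omega> \<longleftrightarrow>
    (\<forall>p\<in>frontier \<Omega>. \<exists>r>0. \<exists>e. \<exists>g :: 'a \<Rightarrow> real. \<exists>L.
        norm e = 1 \<and> L-lipschitz_on {y. y \<bullet> e = 0} g \<and>
        \<Omega> \<inter> ball p r = {x \<in> ball p r. g (x - (x \<bullet> e) *\<^sub>R e) < x \<bullet> e})"

fun C_times :: "nat \<Rightarrow> ('a::euclidean_space \<Rightarrow> real) \<Rightarrow> bool" where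
  "C_times 0 \<psi> \<longleftrightarrow> continuous_on UNIV \<psi>"
| "C_times (Suc k) \<psi> \<longleftrightarrow>
     \<psi> differentiable_on UNIV \<and> (\<forall>i\<in>Basis. C_times k (\<lambda>x. frechet_derivative \<psi> (at x) i))"

(* Smooth functions with compact support in \<Omega>, as functions on the whole space. *)
definition test_function :: "'a::euclidean_space set \<Rightarrow> ('a \<Rightarrow> real) \<Rightarrow> bool" where
  "test_function \<Omega> \<psi> \<longleftrightarrow>
     (\<forall>k. C_times k \<psi>) \<and> compact (closure {x. \<psi> x \<noteq> 0}) \<and> closure {x. \<psi> x \<noteq> 0} \<subseteq> \<Omega>"

(* The elements of these spaces are functions, not classes modulo almost-everywhere equality;
   values outside \<Omega> are irrelevant. *)
definition L2 :: "'a::euclidean_space set \<Rightarrow> ('a \<Rightarrow> 'b::euclidean_space) set" where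
  "L2 \<Omega> = {u \<in> borel_measurable (lebesgue_on \<Omega>).
             integrable (lebesgue_on \<Omega>) (\<lambda>x. (norm (u x))\<^sup>2)}"

definition L2_norm :: "'a::euclidean_space set \<Rightarrow> ('a \<Rightarrow> 'b::euclidean_space) \<Rightarrow> real" where
  "L2_norm \<Omega> u = sqrt (LINT x|lebesgue_on \<Omega>. (norm (u x))\<^sup>2)"

definition L1_norm :: "'a::euclidean_space set \<Rightarrow> ('a \<Rightarrow> real) \<Rightarrow> real" where
  "L1_norm \<Omega> f = (LINT x|lebesgue_on \<Omega>. \<bar>f x\<bar>)"

definition Linf :: "'a::euclidean_space set \<Rightarrow> ('a \<Rightarrow> real) set" where
  "Linf \<Omega> = {f \<in> borel_measurable (lebesgue_on \<Omega>).
               esssup (lebesgue_on \<Omega>) (\<lambda>x. ereal \<bar>f x\<bar>) < \<infinity>}"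

definition Linf_norm :: "'a::euclidean_space set \<Rightarrow> ('a \<Rightarrow> real) \<Rightarrow> real" where
  "Linf_norm \<Omega> f = real_of_ereal (esssup (lebesgue_on \<Omega>) (\<lambda>x. ereal \<bar>f x\<bar>))"

(* Meant for locally integrable \<phi> and G only; below both are square-integrable. *)
definition weak_gradient ::
  "'a::euclidean_space set \<Rightarrow> ('a \<Rightarrow> real) \<Rightarrow> ('a \<Rightarrow> 'a) \<Rightarrow> bool" where
  "weak_gradient \<Omega> \<phi> G \<longleftrightarrow>
     (\<forall>\<psi>. test_function \<Omega> \<psi> \<longrightarrow>
        (\<forall>i\<in>Basis. (LINT x|lebesgue_on \<Omega>. \<phi> x * frechet_derivative \<psi> (at x) i)
                  = - (LINT x|lebesgue_on \<Omega>. (G x \<bullet> i) * \<psi> x)))"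

definition H1 :: "'a::euclidean_space set \<Rightarrow> ('a \<Rightarrow> real) set" where
  "H1 \<Omega> = {\<phi> \<in> L2 \<Omega>. \<exists>G\<in>L2 \<Omega>. weak_gradient \<Omega> \<phi> G}"

(* Weak gradients are unique almost everywhere, so the choice of G does not affect its norm.
   The supremum is taken in ereal: a finite bound on it includes that the set is bounded. *)
definition Hneg1_norm :: "'a::euclidean_space set \<Rightarrow> ('a \<Rightarrow> real) \<Rightarrow> ereal" where
  "Hneg1_norm \<Omega> f =
     (SUP \<phi> \<in> {\<phi> \<in> H1 \<Omega>. \<exists>G\<in>L2 \<Omega>. weak_gradient \<Omega> \<phi> G \<and> L2_norm \<Omega> G \<le> 1}.
        ereal (LINT x|lebesgue_on \<Omega>. f x * \<phi> x))"

end

theory Submission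
  imports Defs
begin

text \<open>
  Let \<open>\<phi>\<close> have weak gradient \<open>G\<close>. Averages of \<open>\<phi>\<close> against a smooth bump on two balls differ by
  an integral of \<open>\<bar>G\<bar>\<close> over the convex hull of the balls, as long as the hull lies in \<open>\<Omega>\<close>.
  The Lipschitz boundary gives a cone condition: from every point \<open>x\<close> a family of balls of radius
  \<open>\<kappa> * t\<close> centred at \<open>x + t *\<^sub>R e x\<close> stays inside \<open>\<Omega>\<close>, and by connectedness all averages at the top
  scale are comparable to one fixed average. Telescoping over \<open>t = t0 / 2 ^ k\<close> bounds \<open>\<phi>\<close> minus a constant,
  weakly, by a dyadic Riesz potential of order one of \<open>\<bar>G\<bar>\<close>; since \<open>f\<close> has mean zero, the constant
  does not contribute to \<open>\<integral> f \<phi>\<close>. In the resulting bilinear form in \<open>\<bar>f\<bar>\<close> and \<open>\<bar>G\<bar>\<close> the scales below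
  \<open>r = (\<parallel>f\<parallel>\<^sub>1 / \<parallel>f\<parallel>\<^sub>\<infinity>) powr (1 / d)\<close> are estimated with the bound on \<open>f\<close> and those above with \<open>\<parallel>f\<parallel>\<^sub>1\<close> only.
\<close>

section \<open>Smooth bump functions\<close>

text \<open>Point values of \<open>\<phi>\<close> carry no information, and a weak gradient is only
  tested against smooth compactly supported functions. Averages against a smooth bump stay within
  that definition, so every comparison of averages comes from integration by parts alone, with
  neither smooth approximation of \<open>\<phi>\<close> nor extension across the boundary: the cone
  keeps all balls inside \<open>\<Omega>\<close>. The price is that telescoping stops at a finite
  level \<open>N\<close>; the error vanishes in the mean, and all other bounds have to be uniform in
  \<open>N\<close>. The scale \<open>r\<close> is where two bounds meet. With \<open>F\<close> and
  \<open>m\<close> the L1 and sup norms of \<open>f\<close>, scales below \<open>r\<close>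
  contribute about \<open>r * sqrt (m * F)\<close>, and scales \<open>\<tau>\<close> above
  \<open>r\<close> about \<open>F\<close> times the root of the sum of
  \<open>\<tau> powr (2 - d)\<close>. For d > 2 the smallest such scale dominates, and
  \<open>r * sqrt (m * F) = F * r powr (1 - d / 2)\<close> determines \<open>r\<close>. For d = 2
  all scales count equally, and their number is the logarithm. The comparison with the fixed average
  costs a multiple of \<open>F\<close>, which the \<open>1\<close> under the roots absorbs.\<close>

text \<open>Derivatives on the whole space are unique, so the chosen
  \<open>frechet_derivative\<close> in \<open>C_times\<close> may be replaced by any explicit
  formula for the derivative.\<close>

lemma C_times_SucI:
  fixes f :: "'a::euclidean_space \<Rightarrow> real"
  assumes "\<And>x. (f has_derivative f' x) (at x)" "\<And>i. i \<in> Basis \<Longrightarrow> C_times k (\<lambda>x. f' x i)"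
  shows "C_times (Suc k) f"
proof -
  have "frechet_derivative f (at x) = f' x" for x
    using frechet_derivative_at[OF assms(1)] by simp
  then show ?thesis
    using assms by (auto simp: differentiable_on_def differentiable_def)
qed

lemma C_times_has_derivative:
  assumes "C_times (Suc k) f"
  shows "(f has_derivative frechet_derivative f (at x)) (at x)"
  using assms by (simp add: differentiable_on_def frechet_derivative_works)

lemma C_times_SucD: "C_times (Suc k) f \<Longrightarrow> C_times k f"
proof (induction k arbitrary: f)
  case 0
  then show ?case by (simp add: differentiable_imp_continuous_on)
next
  case (Suc k)
  then show ?case using C_times.simps(2) by blast
qed

lemma C_times_continuous: "C_times k f \<Longrightarrow> continuous_on UNIV f"
  by (cases k) (auto intro: differentiable_imp_continuous_on)

lemma C_times_const [simp]: "C_times k (\<lambda>x. c)"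
  by (induction k arbitrary: c) (auto intro: C_times_SucI[OF has_derivative_const] simp del: C_times.simps(2))

lemma C_times_inner [simp]: "C_times k (\<lambda>x::'a::euclidean_space. x \<bullet> a)"
proof (cases k)
  case (Suc n)
  show ?thesis unfolding Suc
    by (rule C_times_SucI[where f'="\<lambda>x h. h \<bullet> a"])
       (auto intro: bounded_linear_imp_has_derivative bounded_linear_inner_left)
qed (auto intro!: continuous_intros)

lemma C_times_add:
  "C_times k f \<Longrightarrow> C_times k g \<Longrightarrow> C_times k (\<lambda>x. f x + g x)"
proof (induction k arbitrary: f g)
  case 0
  then show ?case by (auto intro!: continuous_intros)
next
  case (Suc k)
  show ?case
    by (rule C_times_SucI[OF has_derivative_add[OF Suc.prems[THEN C_times_has_derivative]]])
       (use Suc in auto)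
qed

lemma C_times_mult:
  "C_times k f \<Longrightarrow> C_times k g \<Longrightarrow> C_times k (\<lambda>x. f x * g x)"
proof (induction k arbitrary: f g)
  case 0
  then show ?case by (auto intro!: continuous_intros)
next
  case (Suc k)
  show ?case
    by (rule C_times_SucI[OF has_derivative_mult[OF Suc.prems[THEN C_times_has_derivative]]])
       (use Suc Suc.prems[THEN C_times_SucD] in \<open>auto intro!: C_times_add\<close>)
qed

lemma C_times_cmult: "C_times k f \<Longrightarrow> C_times k (\<lambda>x. c * f x)"
  by (intro C_times_mult C_times_const)

lemma C_times_sum: "(\<And>i. i \<in> I \<Longrightarrow> C_times k (f i)) \<Longrightarrow> C_times k (\<lambda>x. \<Sum>i\<in>I. f i x)"
  by (induction I rule: infinite_finite_induct) (auto intro: C_times_add)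

lemma C_times_affine:
  "C_times k f \<Longrightarrow> C_times k (\<lambda>x. f (a *\<^sub>R x + b))"
proof (induction k arbitrary: f)
  case 0
  then show ?case 
    by (auto intro!: continuous_intros continuous_on_compose2[of UNIV f])
next
  case (Suc k)
  have *: "frechet_derivative f (at x) (a *\<^sub>R i) = a * frechet_derivative f (at x) i" for x i
    using linear_frechet_derivative[of f "at x"] C_times_has_derivative[OF Suc.prems, of x]
    by (metis differentiable_def linear_cmul real_scaleR_def)
  have "((\<lambda>x. f (a *\<^sub>R x + b)) has_derivative 
     (\<lambda>h. frechet_derivative f (at (a *\<^sub>R x + b)) (a *\<^sub>R h))) (at x)" for x
    using C_times_has_derivative[OF Suc.prems]
    by (auto intro!: derivative_eq_intros has_derivative_compose[of "\<lambda>x. a *\<^sub>R x + b" _ x UNIV f])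
  then show ?case
    by (rule C_times_SucI) (use Suc * in \<open>auto intro!: C_times_cmult\<close>)
qed

text \<open>The function \<open>exp (- 1 / t)\<close> extended by zero, divided by powers of
  \<open>t\<close>: differentiation maps this family into its own linear combinations, so that
  smoothness can be proved by induction.\<close>

definition flat :: "nat \<Rightarrow> real \<Rightarrow> real" where
  "flat k t = (if t > 0 then exp (- 1 / t) / t ^ k else 0)"

lemma flat_nonneg: "flat k t \<ge> 0"
  by (simp add: flat_def)

lemma tendsto_exp_minus_inverse: "((\<lambda>t::real. exp (- 1 / t) / t ^ k) \<longlongrightarrow> 0) (at_right 0)"
proof -
  have "((\<lambda>x::real. x ^ k / exp x) \<longlongrightarrow> 0) at_top"
    by (rule tendsto_power_div_exp_0)
  then have "((\<lambda>x::real. inverse x ^ k / exp (inverse x)) \<longlongrightarrow> 0) (at_right 0)"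
    by (rule filterlim_compose) (rule filterlim_inverse_at_top_right)
  then show ?thesis
    by (rule filterlim_mono_eventually[OF _ order_refl order_refl])
       (auto simp: field_simps exp_minus inverse_eq_divide)
qed

lemma flat_has_derivative:
  "(flat k has_field_derivative - real k * flat (Suc k) t + flat (k + 2) t) (at t)"
proof (cases t "0::real" rule: linorder_cases)
  case greater
  have "((\<lambda>t. exp (- 1 / t) / t ^ k) has_field_derivative
       - real k * flat (Suc k) t + flat (k + 2) t) (at t)"
    using greater power_minus_mult[of k t]
    by (cases "k = 0") (auto intro!: derivative_eq_intros simp: flat_def field_simps power2_eq_square)
  then show ?thesis
    by (rule has_field_derivative_transform_within_open[where S="{0<..}"])
       (use greater in \<open>auto simp: flat_def\<close>)
next
  case less
  have "((\<lambda>t. 0) has_field_derivative - real k * flat (Suc k) t + flat (k + 2) t) (at t)"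
    using less by (auto simp: flat_def)
  then show ?thesis
    by (rule has_field_derivative_transform_within_open[where S="{..<0}"])
       (use less in \<open>auto simp: flat_def\<close>)
next
  case equal
  \<comment> \<open>For \<open>h > 0\<close> the difference quotient at the origin is
    \<open>exp (- 1 / h) / h ^ Suc k\<close>, again a member of the family.\<close>
  have R: "((\<lambda>h. flat k h / h) \<longlongrightarrow> 0) (at_right 0)"
    by (rule filterlim_mono_eventually[OF tendsto_exp_minus_inverse[of "Suc k"] order_refl order_refl])
       (auto simp: flat_def eventually_at_right_less field_simps
         intro!: eventually_mono[OF eventually_at_right_less])
  have L: "((\<lambda>h. flat k h / h) \<longlongrightarrow> 0) (at_left 0)"
    by (rule filterlim_mono_eventually[OF tendsto_const order_refl order_refl])
       (auto simp: flat_def eventually_at_filter)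
  have "((\<lambda>h. flat k h / h) \<longlongrightarrow> 0) (at 0)"
    using L R by (simp add: filterlim_at_split)
  then show ?thesis
    unfolding has_field_derivative_iff equal by (simp add: flat_def)
qed

lemma continuous_flat: "continuous_on UNIV (flat k)"
  by (meson DERIV_isCont continuous_at_imp_continuous_on flat_has_derivative)

text \<open>The derivative involves \<open>flat (Suc k)\<close> and \<open>flat (k + 2)\<close>, so
  the induction on the order of differentiability keeps \<open>k\<close> arbitrary.\<close>

lemma C_times_flat:
  fixes p :: "'a::euclidean_space \<Rightarrow> real"
  assumes p: "\<And>n. C_times n p"
  shows "C_times n (\<lambda>x. flat k (p x))"
proof (induction n arbitrary: k)
  case 0
  show ?case using p[of 0] continuous_flat
    by (auto intro: continuous_on_compose2)
next
  case (Suc n)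
  have "((\<lambda>x. flat k (p x)) has_derivative
    (\<lambda>h. (- real k * flat (Suc k) (p x) + flat (k + 2) (p x)) * frechet_derivative p (at x) h)) (at x)" for x
    using DERIV_compose_FDERIV[OF flat_has_derivative C_times_has_derivative[OF p], of k x]
    by (simp add: mult.commute)
  then show ?case
    by (rule C_times_SucI)
       (intro C_times_mult C_times_add C_times_cmult Suc p[of "Suc n", THEN C_times.simps(2)[THEN iffD1], THEN conjunct2, rule_format])
qed

text \<open>The standard mollifier profile, supported in the closed unit ball. Using the squared
  norm makes the inner function a polynomial, hence smooth at the origin too.\<close>

definition bump :: "'a::euclidean_space \<Rightarrow> real" where
  "bump x = flat 0 (1 - x \<bullet> x)"

lemma C_times_bump: "C_times n bump"
proof -
  have "C_times n (\<lambda>x::'a. 1 + (\<Sum>i\<in>Basis. - 1 * ((x \<bullet> i) * (x \<bullet> i))))" for n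
    by (intro C_times_add C_times_const C_times_sum C_times_cmult C_times_mult C_times_inner)
  moreover have "(\<lambda>x::'a. 1 + (\<Sum>i\<in>Basis. - 1 * ((x \<bullet> i) * (x \<bullet> i)))) = (\<lambda>x. 1 - x \<bullet> x)"
    by (subst euclidean_inner) (simp add: sum_negf)
  ultimately have "C_times n (\<lambda>x::'a. 1 - x \<bullet> x)" for n by metis
  from C_times_flat[of "\<lambda>x. 1 - x \<bullet> x", OF this] show ?thesis
    by (simp add: bump_def[abs_def])
qed

lemma bump_nonneg: "bump x \<ge> 0"
  by (simp add: bump_def flat_nonneg)

lemma bump_le_1: "bump x \<le> 1"
  by (simp add: bump_def flat_def)

lemma bump_eq_0: "norm x \<ge> 1 \<Longrightarrow> bump x = 0"
  using power_mono[of 1 "norm x" 2] by (auto simp: bump_def flat_def power2_norm_eq_inner)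

lemma bump_pos: "norm x < 1 \<Longrightarrow> bump x > 0"
  using power_strict_mono[of "norm x" 1 2] by (auto simp: bump_def flat_def power2_norm_eq_inner)

section \<open>Normalised kernels with variable centre and radius\<close>

definition bump_mass :: "'a::euclidean_space itself \<Rightarrow> real" where
  "bump_mass _ = (LINT x|lborel. bump (x :: 'a))"

definition kern :: "'a::euclidean_space \<Rightarrow> real \<Rightarrow> 'a \<Rightarrow> real" where
  "kern c r y = bump ((y - c) /\<^sub>R r) / (bump_mass TYPE('a) * r ^ DIM('a))"

lemma continuous_bump [continuous_intros]:
  "continuous_on S g \<Longrightarrow> continuous_on S (\<lambda>x. bump (g x))"
  using continuous_on_compose2[OF C_times_continuous[OF C_times_bump[of 0]]] by blast

lemma borel_measurable_bump [measurable]: "bump \<in> borel_measurable borel"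
  by (intro borel_measurable_continuous_onI continuous_intros)

lemma integrable_bump: "integrable lborel (bump :: 'a::euclidean_space \<Rightarrow> real)"
proof (rule Bochner_Integration.integrable_bound)
  show "integrable lborel (indicat_real (cball (0::'a) 1))"
    by (intro integrable_real_indicator) (auto simp: emeasure_cball)
  show "AE x in lborel. norm (bump x) \<le> norm (indicat_real (cball (0::'a) 1) x)"
    using bump_le_1[where 'a='a] bump_nonneg[where 'a='a] bump_eq_0[where 'a='a]
    by (intro AE_I2) (auto simp: indicator_def)
qed simp

lemma bump_mass_pos: "bump_mass TYPE('a::euclidean_space) > 0"
proof -
  have "bump_mass TYPE('a) \<noteq> 0"
  proof
    assume "bump_mass TYPE('a) = 0"
    then have "AE x in lborel. bump (x::'a) = 0"
      unfolding bump_mass_def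
      using integral_nonneg_eq_0_iff_AE[OF integrable_bump] bump_nonneg by auto
    then have "AE x in lborel. x \<notin> ball (0::'a) 1"
      by eventually_elim (use bump_pos in force)
    then have "emeasure lborel (ball (0::'a) 1) = 0"
      by (subst (asm) AE_iff_measurable[OF _ refl]) (auto simp: ball_def)
    moreover have "emeasure lborel (ball (0::'a) 1) > 0"
      by (simp add: emeasure_ball)
    ultimately show False by simp
  qed
  moreover have "bump_mass TYPE('a) \<ge> 0"
    unfolding bump_mass_def by (simp add: bump_nonneg)
  ultimately show ?thesis by simp
qed

lemma kern_nonneg: "r > 0 \<Longrightarrow> kern c r y \<ge> 0"
  using bump_mass_pos[where 'a='a] by (simp add: kern_def bump_nonneg)

lemma kern_le: "r > 0 \<Longrightarrow> kern (c::'a::euclidean_space) r y \<le> 1 / (bump_mass TYPE('a) * r ^ DIM('a))"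
  using bump_mass_pos[where 'a='a] by (simp add: kern_def bump_le_1 divide_right_mono)

lemma kern_eq_0: "r > 0 \<Longrightarrow> dist c y \<ge> r \<Longrightarrow> kern c r y = 0"
  by (simp add: kern_def bump_eq_0 dist_norm norm_minus_commute le_divide_eq divide_inverse_commute[symmetric])

lemma kern_le_indicator:
  "r > 0 \<Longrightarrow> \<bar>kern (c::'a::euclidean_space) r y\<bar> 
     \<le> 1 / (bump_mass TYPE('a) * r ^ DIM('a)) * indicator (cball c r) y"
  using kern_le[of r c y] kern_nonneg[of r c y] kern_eq_0[of r c y] by (auto simp: indicator_def)

lemma borel_measurable_kern [measurable]:
  assumes [measurable]: "f \<in> borel_measurable M" "g \<in> borel_measurable M"
  shows "(\<lambda>x. kern (f x) r (g x)) \<in> borel_measurable M"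
  unfolding kern_def by measurable

lemma borel_measurable_lebesgue_on_id: "(\<lambda>x. x) \<in> lebesgue_on S \<rightarrow>\<^sub>M borel"
  by (intro measurable_restrict_space1 measurable_completion) simp

lemma integral_kern:
  fixes c :: "'a::euclidean_space"
  assumes "r > 0" "cball c r \<subseteq> S" "S \<in> sets lebesgue"
  shows "(LINT y|lebesgue_on S. kern c r y) = 1"
proof -
  have "(LINT y|lebesgue_on S. kern c r y) = (LINT y|lebesgue. indicator S y *\<^sub>R kern c r y)"
    using assms by (subst integral_restrict_space) auto
  also have "\<dots> = (LINT y|lebesgue. kern c r y)"
    using assms kern_eq_0[of r c]
    by (intro Bochner_Integration.integral_cong) (force simp: indicator_def)+
  also have "\<dots> = (LINT y|lborel. kern c r y)"
    by (rule integral_completion) measurable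
  also have "\<dots> = (LINT y|lborel. bump ((y - c) /\<^sub>R r)) / (bump_mass TYPE('a) * r ^ DIM('a))"
    by (simp add: kern_def)
  also have "(LINT y|lborel. bump ((y - c) /\<^sub>R r)) = r ^ DIM('a) * bump_mass TYPE('a)"
    by (subst lborel_affine[of r c])
       (use assms in \<open>auto simp: integral_density integral_distr bump_mass_def\<close>)
  finally show ?thesis
    using assms bump_mass_pos[where 'a='a] by simp
qed

lemma C_times_kern: "C_times k (kern c r)"
proof -
  have "C_times k (\<lambda>y. inverse (bump_mass TYPE('a) * r ^ DIM('a)) * bump (inverse r *\<^sub>R y + (- c /\<^sub>R r)))"
    by (intro C_times_cmult C_times_affine C_times_bump)
  then show ?thesis by (simp add: kern_def[abs_def] algebra_simps divide_inverse)
qed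

lemma test_function_kern:
  assumes "r > 0" "cball c r \<subseteq> S" "\<And>k. C_times k g"
  shows "test_function S (\<lambda>y. kern c r y * g y)"
proof -
  have "{y. kern c r y * g y \<noteq> 0} \<subseteq> cball c r"
    using kern_eq_0[of r c] assms(1) by (force simp: not_le)
  then have "closure {y. kern c r y * g y \<noteq> 0} \<subseteq> cball c r"
    by (simp add: closure_minimal)
  then show ?thesis
    unfolding test_function_def using assms
    by (auto intro!: C_times_mult C_times_kern compact_closure[THEN iffD2] bounded_subset[OF bounded_cball]
        intro: closure_subset[THEN subsetD])
qed

text \<open>The partial derivatives are continuous on the compact unit ball and vanish outside it;
  expanding \<open>h\<close> in the basis combines them. The bound supplies the domination needed to
  differentiate averages along a moving ball.\<close>

lemma bump_gradient_bounded:
  "\<exists>N. \<forall>(z::'a::euclidean_space) h. \<bar>frechet_derivative bump (at z) h\<bar> \<le> N * norm h"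
proof -
  let ?D = "\<lambda>z::'a. frechet_derivative bump (at z)"
  have out: "?D z i = 0" if "norm z > 1" for z i
  proof -
    have "((\<lambda>x. 0) has_derivative (\<lambda>x. 0)) (at z)" by simp
    then have "(bump has_derivative (\<lambda>x. 0)) (at z)"
      by (rule has_derivative_transform_within_open[where s="- cball 0 1"])
         (use that bump_eq_0[where 'a='a] in \<open>auto simp: not_le\<close>)
    then show ?thesis using frechet_derivative_at by metis
  qed
  have "\<exists>N. \<forall>z. \<bar>?D z i\<bar> \<le> N" if "i \<in> Basis" for i
  proof -
    have "C_times 0 (\<lambda>z. ?D z i)" using C_times_bump[where 'a='a, of "Suc 0"] that by simp
    then have "continuous_on (cball 0 1) (\<lambda>z. ?D z i)" 
      using continuous_on_subset by auto
    then have "bounded ((\<lambda>z. ?D z i) ` cball 0 1)"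
      by (intro compact_imp_bounded compact_continuous_image compact_cball)
    then obtain N where "\<And>z. norm z \<le> 1 \<Longrightarrow> \<bar>?D z i\<bar> \<le> N"
      unfolding bounded_iff by force
    then have "\<bar>?D z i\<bar> \<le> max N 0" for z
      using out[of z i] by (cases "norm z \<le> 1") (force simp: not_le)+
    then show ?thesis by blast
  qed
  then obtain N where N: "\<And>i z. i \<in> Basis \<Longrightarrow> \<bar>?D z i\<bar> \<le> N i" by metis
  have "\<bar>?D z h\<bar> \<le> (\<Sum>i\<in>Basis. N i) * norm h" for z h
  proof -
    have lin: "linear (?D z)"
      using C_times_has_derivative[OF C_times_bump] has_derivative_linear by blast
    have "?D z h = ?D z (\<Sum>i\<in>Basis. (h \<bullet> i) *\<^sub>R i)" by (simp add: euclidean_representation)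
    also have "\<dots> = (\<Sum>i\<in>Basis. (h \<bullet> i) * ?D z i)"
      by (simp add: linear_sum[OF lin] linear_cmul[OF lin])
    also have "\<bar>\<dots>\<bar> \<le> (\<Sum>i\<in>Basis. norm h * N i)"
      using N Basis_le_norm by (intro order_trans[OF sum_abs] sum_mono) (auto simp: abs_mult intro!: mult_mono)
    finally show ?thesis by (simp add: sum_distrib_left mult.commute)
  qed
  then show ?thesis by blast
qed

lemma integrable_bounded_mult:
  fixes f g :: "'a \<Rightarrow> real"
  assumes "f \<in> borel_measurable M" "\<And>x. \<bar>f x\<bar> \<le> B" "integrable M g"
  shows "integrable M (\<lambda>x. f x * g x)"
  by (rule Bochner_Integration.integrable_bound[OF integrable_mult_right[OF assms(3), of B]])
     (use assms order_trans[OF assms(2) abs_ge_self] in \<open>auto simp: abs_mult intro!: mult_right_mono\<close>)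

text \<open>On the convex set \<open>S\<close> the mean value inequality bounds all difference
  quotients by \<open>w\<close>, and dominated convergence applies along every sequence tending to
  \<open>t\<close>. Derivatives within \<open>S\<close> cover the endpoints of an interval.\<close>

lemma has_field_derivative_lebesgue_integral:
  fixes f :: "real \<Rightarrow> 'a \<Rightarrow> real"
  assumes S: "convex S" "t \<in> S"
    and int: "\<And>s. s \<in> S \<Longrightarrow> integrable M (f s)"
    and der: "\<And>s x. s \<in> S \<Longrightarrow> x \<in> space M \<Longrightarrow> ((\<lambda>s. f s x) has_field_derivative f' s x) (at s within S)"
    and bound: "\<And>s x. s \<in> S \<Longrightarrow> x \<in> space M \<Longrightarrow> \<bar>f' s x\<bar> \<le> w x"
    and w: "integrable M w"
    and meas: "f' t \<in> borel_measurable M"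
  shows "((\<lambda>s. LINT x|M. f s x) has_field_derivative (LINT x|M. f' t x)) (at t within S)"
  unfolding has_field_derivative_iff tendsto_at_iff_sequentially
proof (intro allI impI)
  fix X assume X: "\<forall>i. X i \<in> S - {t}" and lim: "X \<longlonglongrightarrow> t"
  have XS: "X i \<in> S" "X i \<noteq> t" for i using X by auto
  have "(\<lambda>i. LINT x|M. (f (X i) x - f t x) / (X i - t)) \<longlonglongrightarrow> (LINT x|M. f' t x)"
  proof (rule integral_dominated_convergence[where w=w])
    show "AE x in M. (\<lambda>i. (f (X i) x - f t x) / (X i - t)) \<longlonglongrightarrow> f' t x"
    proof (rule AE_I2)
      fix x assume x: "x \<in> space M"
      have "((\<lambda>y. (f y x - f t x) / (y - t)) \<longlongrightarrow> f' t x) (at t within S)"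
        using der[OF S(2) x] by (simp add: has_field_derivative_iff)
      then show "(\<lambda>i. (f (X i) x - f t x) / (X i - t)) \<longlonglongrightarrow> f' t x"
        unfolding tendsto_at_iff_sequentially using X lim by (auto simp: comp_def)
    qed
    show "AE x in M. norm ((f (X i) x - f t x) / (X i - t)) \<le> w x" for i
    proof (rule AE_I2)
      fix x assume x: "x \<in> space M"
      have "norm (f (X i) x - f t x) \<le> w x * norm (X i - t)"
        by (rule field_differentiable_bound[OF S(1), of "\<lambda>s. f s x" "\<lambda>s. f' s x"])
           (use der[OF _ x] bound[OF _ x] S XS in auto)
      then show "norm ((f (X i) x - f t x) / (X i - t)) \<le> w x"
        using XS(2)[of i] by (simp add: field_simps)
    qed
    show "(\<lambda>x. (f (X i) x - f t x) / (X i - t)) \<in> borel_measurable M" for i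
      using int[OF XS(1)] int[OF S(2)] by measurable
  qed (use w meas in auto)
  also have "(\<lambda>i. LINT x|M. (f (X i) x - f t x) / (X i - t)) =
     (\<lambda>i. ((LINT x|M. f (X i) x) - (LINT x|M. f t x)) / (X i - t))"
    using int[OF XS(1)] int[OF S(2)] by simp
  finally show "((\<lambda>y. ((LINT x|M. f y x) - (LINT x|M. f t x)) / (y - t)) \<circ> X) \<longlonglongrightarrow> (LINT x|M. f' t x)"
    by (simp add: comp_def)
qed

section \<open>Averages and weak gradients\<close>

definition avg :: "'a::euclidean_space set \<Rightarrow> ('a \<Rightarrow> real) \<Rightarrow> 'a \<Rightarrow> real \<Rightarrow> real" where
  "avg S \<phi> c r = (LINT y|lebesgue_on S. \<phi> y * kern c r y)"

text \<open>
  The vector field \<open>v + a *\<^sub>R (y - c)\<close> has divergence \<open>DIM('a) * a\<close>, so the left-hand side pairs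
  \<open>\<phi>\<close> with the divergence of \<open>kern c r\<close> times the field; each component of that product is a test function.
\<close>

lemma weak_gradient_radial:
  fixes c v :: "'a::euclidean_space" and a :: real
  assumes S: "S \<in> sets lebesgue" and wg: "weak_gradient S \<phi> G"
    and \<phi>: "integrable (lebesgue_on S) \<phi>" and G: "integrable (lebesgue_on S) G"
    and r: "r > 0" "cball c r \<subseteq> S"
  shows "(LINT y|lebesgue_on S. \<phi> y * (frechet_derivative (kern c r) (at y) (v + a *\<^sub>R (y - c)) + DIM('a) * a * kern c r y))
        = - (LINT y|lebesgue_on S. kern c r y * (G y \<bullet> (v + a *\<^sub>R (y - c))))"
proof -
  let ?M = "lebesgue_on S" and ?K = "kern c r"
  define g where "g i y = (v + a *\<^sub>R (y - c)) \<bullet> i" for i y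
  have g: "C_times k (g i)" for i k
  proof -
    have "C_times k (\<lambda>y. (v - a *\<^sub>R c) \<bullet> i + a * (y \<bullet> i))"
      by (intro C_times_add C_times_const C_times_cmult C_times_inner)
    then show ?thesis by (simp add: g_def[abs_def] algebra_simps inner_diff_left inner_add_left)
  qed
  define \<psi> where "\<psi> i y = ?K y * g i y" for i y
  have \<psi>: "test_function S (\<psi> i)" for i
    unfolding \<psi>_def[abs_def] using r g by (intro test_function_kern)
  have dg: "(g i has_derivative (\<lambda>h. a * (h \<bullet> i))) (at y)" for i y
    unfolding g_def[abs_def] by (auto intro!: derivative_eq_intros simp: inner_add_left inner_diff_left)
  have d\<psi>: "frechet_derivative (\<psi> i) (at y) h = ?K y * (a * (h \<bullet> i)) + frechet_derivative ?K (at y) h * g i y" for i y h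
    using has_derivative_mult[OF C_times_has_derivative[OF C_times_kern] dg, of c r i y]
    by (simp add: \<psi>_def[abs_def] frechet_derivative_at[symmetric])
  \<comment> \<open>Every integrand below is an integrable function times a continuous one that
    vanishes off the ball, hence is bounded; this settles all integrability questions.\<close>
  have bnd: "\<exists>B. \<forall>y. \<bar>h y\<bar> \<le> B" if cont: "continuous_on UNIV h" and out: "\<And>y. y \<notin> cball c r \<Longrightarrow> h y = 0" for h :: "'a \<Rightarrow> real"
  proof -
    have "bounded (h ` cball c r)"
      using continuous_on_subset[OF cont] by (intro compact_imp_bounded compact_continuous_image) auto
    then obtain B where B: "\<And>y. y \<in> cball c r \<Longrightarrow> \<bar>h y\<bar> \<le> B"
      unfolding bounded_iff by force
    have "\<bar>h y\<bar> \<le> max B 0" for y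
      using B[of y] out[of y] by (cases "y \<in> cball c r") (force simp del: mem_cball)+
    then show ?thesis by blast
  qed
  have meas: "h \<in> borel_measurable ?M" if "continuous_on UNIV h" for h :: "'a \<Rightarrow> real"
    using measurable_compose[OF borel_measurable_lebesgue_on_id borel_measurable_continuous_onI[OF that]] by simp
  have intb: "integrable ?M (\<lambda>y. f y * h y)" 
    if f: "integrable ?M f" and cont: "continuous_on UNIV h" and out: "\<And>y. y \<notin> cball c r \<Longrightarrow> h y = 0" for f h :: "'a \<Rightarrow> real"
  proof -
    obtain B where B: "\<And>y. \<bar>h y\<bar> \<le> B" using bnd[OF cont out] by blast
    have "integrable ?M (\<lambda>y. h y * f y)"
      by (rule integrable_bounded_mult) (use B meas[OF cont] f in auto) 
    then show ?thesis by (simp add: mult.commute)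
  qed
  have ker0: "?K y = 0" if "y \<notin> cball c r" for y
    using that kern_eq_0[OF r(1), of c y] by auto
  have dker0: "frechet_derivative ?K (at y) h = 0" if "y \<notin> cball c r" for y h
  proof -
    have "(?K has_derivative (\<lambda>x. 0)) (at y)"
      by (rule has_derivative_transform_within_open[where s="- cball c r" and f="\<lambda>x. 0"])
         (use that kern_eq_0[OF r(1), of c] in \<open>auto simp: not_le\<close>)
    then show ?thesis using frechet_derivative_at by metis
  qed
  have d\<psi>0: "frechet_derivative (\<psi> i) (at y) h = 0" if "y \<notin> cball c r" for y h i
    by (simp add: d\<psi> dker0[OF that] ker0[OF that])
  have cont_d\<psi>: "continuous_on UNIV (\<lambda>y. frechet_derivative (\<psi> i) (at y) i)" if "i \<in> Basis" for i
    using \<psi>[of i] that unfolding test_function_def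
    by (metis C_times.simps)
  have cont_\<psi>: "continuous_on UNIV (\<psi> i)" for i
    using \<psi>[of i] C_times_continuous unfolding test_function_def by blast
  have lin: "linear (frechet_derivative ?K (at y))" for y
    using C_times_has_derivative[OF C_times_kern] has_derivative_linear by blast
  \<comment> \<open>By the product rule the term \<open>a * ?K y\<close> appears once for each basis
    direction, which accounts for the factor \<open>DIM('a)\<close>.\<close>
  have div: "frechet_derivative ?K (at y) (v + a *\<^sub>R (y - c)) + DIM('a) * a * ?K y
      = (\<Sum>i\<in>Basis. frechet_derivative (\<psi> i) (at y) i)" for y
  proof -
    have "frechet_derivative ?K (at y) (v + a *\<^sub>R (y - c)) =
      frechet_derivative ?K (at y) (\<Sum>i\<in>Basis. g i y *\<^sub>R i)"
      by (simp add: g_def euclidean_representation)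
    also have "\<dots> = (\<Sum>i\<in>Basis. g i y * frechet_derivative ?K (at y) i)"
      by (simp add: linear_sum[OF lin] linear_cmul[OF lin])
    finally show ?thesis
      by (simp add: d\<psi> sum.distrib mult.commute)
  qed
  have "(LINT y|?M. \<phi> y * (frechet_derivative ?K (at y) (v + a *\<^sub>R (y - c)) + DIM('a) * a * ?K y))
      = (\<Sum>i\<in>Basis. LINT y|?M. \<phi> y * frechet_derivative (\<psi> i) (at y) i)"
    unfolding div sum_distrib_left
    by (intro Bochner_Integration.integral_sum intb \<phi> cont_d\<psi> d\<psi>0)
  also have "\<dots> = (\<Sum>i\<in>Basis. - (LINT y|?M. (G y \<bullet> i) * \<psi> i y))"
    using wg \<psi> unfolding weak_gradient_def by (intro sum.cong) auto
  also have "\<dots> = - (LINT y|?M. (\<Sum>i\<in>Basis. (G y \<bullet> i) * \<psi> i y))"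
    using G by (subst Bochner_Integration.integral_sum)
      (auto simp: sum_negf ker0[unfolded mem_cball] \<psi>_def intro!: intb cont_\<psi>[unfolded \<psi>_def])
  also have "(\<lambda>y. \<Sum>i\<in>Basis. (G y \<bullet> i) * \<psi> i y) = (\<lambda>y. ?K y * (G y \<bullet> (v + a *\<^sub>R (y - c))))"
    by (subst (2) euclidean_inner) (auto simp: \<psi>_def g_def sum_distrib_left mult_ac)
  finally show ?thesis .
qed

lemma frechet_derivative_kern:
  fixes c :: "'a::euclidean_space"
  assumes r: "r > 0"
  shows "frechet_derivative (kern c r) (at y) h
    = frechet_derivative bump (at ((y - c) /\<^sub>R r)) h / (bump_mass TYPE('a) * r ^ Suc DIM('a))"
proof -
  let ?z = "(y - c) /\<^sub>R r" and ?m = "bump_mass TYPE('a)"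
  let ?D = "frechet_derivative bump (at ?z)"
  have D: "(bump has_derivative ?D) (at ?z)"
    by (rule C_times_has_derivative[OF C_times_bump])
  have lin: "linear ?D" using D has_derivative_linear by blast
  have "((\<lambda>y. (y - c) /\<^sub>R r) has_derivative (\<lambda>h. h /\<^sub>R r)) (at y)"
    by (auto intro!: derivative_eq_intros)
  from has_derivative_compose[OF this, of bump ?D] D
  have "((\<lambda>y. bump ((y - c) /\<^sub>R r)) has_derivative (\<lambda>h. ?D (h /\<^sub>R r))) (at y)"
    by blast
  then have "((\<lambda>y. bump ((y - c) /\<^sub>R r) / (?m * r ^ DIM('a))) has_derivative (\<lambda>h. ?D (h /\<^sub>R r) / (?m * r ^ DIM('a)))) (at y)"
    by (auto intro!: derivative_eq_intros simp: divide_inverse)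
  then have "(kern c r has_derivative (\<lambda>h. ?D (h /\<^sub>R r) / (?m * r ^ DIM('a)))) (at y)"
    unfolding kern_def[abs_def] .
  then have "frechet_derivative (kern c r) (at y) h = ?D (h /\<^sub>R r) / (?m * r ^ DIM('a))"
    by (simp only: frechet_derivative_at[symmetric])
  also have "?D (h /\<^sub>R r) = inverse r * ?D h" using linear_cmul[OF lin] by simp
  finally show ?thesis
    by (simp only: divide_inverse power_Suc inverse_mult_distrib mult_ac)
qed

text \<open>The kernel is the density of the normalised bump transported by the affine maps sending
  \<open>z\<close> to \<open>c + t *\<^sub>R v + (r + t * s) *\<^sub>R z\<close>. Their velocity
  field at \<open>y\<close> is
  \<open>v + (s / (r + t * s)) *\<^sub>R (y - (c + t *\<^sub>R v))\<close>, so the derivative has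
  the divergence form of the radial identity with \<open>a = s / (r + t * s)\<close>.\<close>

lemma kern_has_time_derivative:
  fixes c v :: "'a::euclidean_space"
  assumes "r + t * s > 0"
  shows "((\<lambda>t. kern (c + t *\<^sub>R v) (r + t * s) y) has_field_derivative
     - (frechet_derivative (kern (c + t *\<^sub>R v) (r + t * s)) (at y) (v + (s / (r + t * s)) *\<^sub>R (y - (c + t *\<^sub>R v)))
        + DIM('a) * (s / (r + t * s)) * kern (c + t *\<^sub>R v) (r + t * s) y)) (at t within T)"
proof -
  define \<rho> where "\<rho> = r + t * s"
  define z where "z = (y - (c + t *\<^sub>R v)) /\<^sub>R \<rho>"
  define m where "m = bump_mass TYPE('a)"
  have m: "m > 0" using bump_mass_pos m_def by metis
  have \<rho>: "\<rho> > 0" using assms by (simp add: \<rho>_def)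
  let ?D = "frechet_derivative bump (at z)"
  have D: "(bump has_derivative ?D) (at z)"
    by (rule C_times_has_derivative[OF C_times_bump])
  have lin: "linear ?D" using D has_derivative_linear by blast
  have sp: "frechet_derivative (kern (c + t *\<^sub>R v) \<rho>) (at y) h = ?D h / (m * \<rho> ^ Suc DIM('a))" for h
    using frechet_derivative_kern[OF \<rho>] by (simp only: z_def m_def)
  have tz: "((\<lambda>t. (y - (c + t *\<^sub>R v)) /\<^sub>R (r + t * s)) has_derivative
       (\<lambda>h. h *\<^sub>R (- (v + s *\<^sub>R z) /\<^sub>R \<rho>))) (at t within T)"
  proof -
    have "((\<lambda>t. inverse (r + t * s) *\<^sub>R (y - (c + t *\<^sub>R v))) has_derivative
       (\<lambda>h. inverse \<rho> *\<^sub>R - (h *\<^sub>R v) + (- (inverse \<rho> * (h * s) * inverse \<rho>)) *\<^sub>R (y - (c + t *\<^sub>R v)))) (at t within T)"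
      by (rule derivative_eq_intros refl | (use \<rho> in \<open>simp add: \<rho>_def\<close>))+
    moreover have "inverse \<rho> *\<^sub>R - (h *\<^sub>R v) + (- (inverse \<rho> * (h * s) * inverse \<rho>)) *\<^sub>R (y - (c + t *\<^sub>R v))
        = h *\<^sub>R (- (v + s *\<^sub>R z) /\<^sub>R \<rho>)" for h
      by (simp add: z_def scaleR_add_right scaleR_diff_right mult_ac del: minus_diff_eq diff_diff_eq)
    ultimately show ?thesis
      by simp
  qed
  have tb: "((\<lambda>t. bump ((y - (c + t *\<^sub>R v)) /\<^sub>R (r + t * s))) has_derivative
       (\<lambda>h. ?D (h *\<^sub>R (- (v + s *\<^sub>R z) /\<^sub>R \<rho>)))) (at t within T)"
    by (rule has_derivative_compose[OF tz]) (use D in \<open>simp add: z_def \<rho>_def\<close>)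
  have "(\<lambda>h. ?D (h *\<^sub>R (- (v + s *\<^sub>R z) /\<^sub>R \<rho>))) = (*) (- ?D (v + s *\<^sub>R z) / \<rho>)"
    by (auto simp: linear_cmul[OF lin] linear_neg[OF lin] divide_inverse mult_ac simp del: minus_add_distrib scaleR_minus_right intro!: ext)
  with tb have tb': "((\<lambda>t. bump ((y - (c + t *\<^sub>R v)) /\<^sub>R (r + t * s))) has_field_derivative
       - ?D (v + s *\<^sub>R z) / \<rho>) (at t within T)"
    by (simp add: has_field_derivative_def)
  have z: "bump ((y - (c + t *\<^sub>R v)) /\<^sub>R \<rho>) = bump z" by (simp add: z_def)
  \<comment> \<open>In the rescaled variable the velocity field is \<open>v + s *\<^sub>R z\<close>,
    the vector that the chain rule produces.\<close>
  have sz: "v + (s / \<rho>) *\<^sub>R (y - (c + t *\<^sub>R v)) = v + s *\<^sub>R z"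
    by (simp add: z_def divide_inverse)
  have "((\<lambda>t. bump ((y - (c + t *\<^sub>R v)) /\<^sub>R (r + t * s)) / (m * (r + t * s) ^ DIM('a))) has_field_derivative
     - (?D (v + s *\<^sub>R z) / (m * \<rho> ^ Suc DIM('a)) + DIM('a) * (s / \<rho>) * (bump z / (m * \<rho> ^ DIM('a))))) (at t within T)"
  proof -
    have "((\<lambda>t. m * (r + t * s) ^ DIM('a)) has_field_derivative m * (DIM('a) * s * \<rho> ^ (DIM('a) - 1))) (at t within T)"
      by (auto intro!: derivative_eq_intros simp: \<rho>_def)
    moreover have "m * (r + t * s) ^ DIM('a) \<noteq> 0"
      using \<rho> m by (simp add: \<rho>_def[symmetric])
    ultimately show ?thesis
      by (rule DERIV_cong[OF DERIV_divide[OF tb']])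
         (use \<rho> m power_minus_mult[of "DIM('a)" \<rho>] in
             \<open>simp only: \<rho>_def[symmetric] z, auto simp: field_simps\<close>)
  qed
  then show ?thesis
    unfolding \<rho>_def[symmetric] sp sz unfolding kern_def m_def[symmetric] z by (simp only: \<rho>_def)
qed

text \<open>
  The kernels of the balls \<open>cball (cc t) (\<rho> t)\<close> joining the two given ones satisfy a continuity equation
  \<open>\<partial>\<^sub>t k = - div (k w)\<close> with \<open>w\<close> affine, so the weak gradient controls the derivative of the
  average in \<open>t\<close>; \<open>E t\<close> is the divergence \<open>div (k w)\<close>.
\<close>

lemma avg_diff_le:
  fixes c c' :: "'a::euclidean_space" and r r' m :: real
  assumes S: "S \<in> sets lebesgue" and wg: "weak_gradient S \<phi> G"
    and \<phi>: "integrable (lebesgue_on S) \<phi>" and G: "integrable (lebesgue_on S) G"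
    and m: "0 < m" "m \<le> r" "m \<le> r'"
    and U: "U \<in> sets borel" "U \<subseteq> S"
    and hull: "\<And>t. 0 \<le> t \<Longrightarrow> t \<le> 1 \<Longrightarrow> cball (c + t *\<^sub>R (c' - c)) (r + t * (r' - r)) \<subseteq> U"
  shows "\<bar>avg S \<phi> c' r' - avg S \<phi> c r\<bar> \<le> (norm (c' - c) + \<bar>r' - r\<bar>) / (bump_mass TYPE('a) * m ^ DIM('a))
           * (LINT y|lebesgue_on S. norm (G y) * indicator U y)"
proof -
  let ?M = "lebesgue_on S"
  define v s where "v = c' - c" and "s = r' - r"
  define cc \<rho> where "cc t = c + t *\<^sub>R v" and "\<rho> t = r + t * s" for t
  define w where "w t y = v + (s / \<rho> t) *\<^sub>R (y - cc t)" for t y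
  define b where "b = bump_mass TYPE('a)"
  have b: "b > 0" using bump_mass_pos b_def by metis
  \<comment> \<open>Radii interpolate affinely between \<open>r\<close> and \<open>r'\<close>, so a
    lower bound at both ends persists.\<close>
  have \<rho>m: "\<rho> t \<ge> m" if "t \<in> {0..1}" for t
  proof -
    have "(1 - t) * m + t * m \<le> (1 - t) * r + t * r'"
      using that m by (intro add_mono mult_left_mono) auto
    then show ?thesis by (simp add: \<rho>_def s_def algebra_simps)
  qed
  have \<rho>0: "\<rho> t > 0" if "t \<in> {0..1}" for t using \<rho>m[OF that] m by linarith
  have sub: "cball (cc t) (\<rho> t) \<subseteq> U" if "t \<in> {0..1}" for t
    using hull[of t] that by (simp add: cc_def \<rho>_def v_def s_def)
  obtain N where N: "\<And>(z::'a) h. \<bar>frechet_derivative bump (at z) h\<bar> \<le> N * norm h"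
    using bump_gradient_bounded by blast
  have meas: "h \<in> borel_measurable ?M" if "continuous_on UNIV h" for h :: "'a \<Rightarrow> real"
    using measurable_compose[OF borel_measurable_lebesgue_on_id borel_measurable_continuous_onI[OF that]] by simp
  have meas': "h \<in> borel_measurable ?M" if "continuous_on UNIV h" for h :: "'a \<Rightarrow> 'a"
    using measurable_compose[OF borel_measurable_lebesgue_on_id borel_measurable_continuous_onI[OF that]] by simp
  have kmeas[measurable]: "kern x R \<in> borel_measurable ?M" for x R
    using meas[OF C_times_continuous[OF C_times_kern[of 0]]] .
  have kpow: "1 / (b * \<rho> t ^ DIM('a)) \<le> 1 / (b * m ^ DIM('a))" if "t \<in> {0..1}" for t
    using m b \<rho>m[OF that] by (intro divide_left_mono mult_left_mono power_mono mult_pos_pos) auto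
  have kbound: "\<bar>kern (cc t) (\<rho> t) y\<bar> \<le> 1 / (b * m ^ DIM('a)) * indicator U y" if "t \<in> {0..1}" for t y
  proof -
    have "\<bar>kern (cc t) (\<rho> t) y\<bar> \<le> 1 / (b * \<rho> t ^ DIM('a)) * indicator (cball (cc t) (\<rho> t)) y"
      using kern_le_indicator[OF \<rho>0[OF that]] by (simp add: b_def)
    also have "\<dots> \<le> 1 / (b * m ^ DIM('a)) * indicator U y"
      using kpow[OF that] sub[OF that] m b by (intro mult_mono) (auto simp: indicator_def)
    finally show ?thesis .
  qed
  define E where "E t y = frechet_derivative (kern (cc t) (\<rho> t)) (at y) (w t y) + DIM('a) * (s / \<rho> t) * kern (cc t) (\<rho> t) y" for t y
  \<comment> \<open>On the moving ball the expansion part of the field has norm at most the rate of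
    change of the radius; this gives the numerator of the final estimate.\<close>
  have wle: "norm (w t y) \<le> norm v + \<bar>s\<bar>" if "t \<in> {0..1}" "y \<in> cball (cc t) (\<rho> t)" for t y
  proof -
    have "norm (w t y) \<le> norm v + norm ((s / \<rho> t) *\<^sub>R (y - cc t))"
      unfolding w_def by (rule norm_triangle_ineq)
    also have "norm ((s / \<rho> t) *\<^sub>R (y - cc t)) = \<bar>s\<bar> * (norm (y - cc t) / \<rho> t)"
      using \<rho>0[OF that(1)] by simp
    also have "\<dots> \<le> \<bar>s\<bar> * 1"
      using \<rho>0[OF that(1)] that(2) by (intro mult_left_mono) (auto simp: dist_norm norm_minus_commute)
    finally show ?thesis by simp
  qed
  have kder: "((\<lambda>t. kern (cc t) (\<rho> t) y) has_field_derivative - E t y) (at t within T)" if "t \<in> {0..1}" for t y T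
    using kern_has_time_derivative[of r t s c v y T] \<rho>0[OF that]
    by (simp add: cc_def \<rho>_def E_def w_def)
  \<comment> \<open>This bound only serves to dominate the difference quotients; its constant does
    not enter the final estimate.\<close>
  have Ebound: "\<exists>B. \<forall>t\<in>{0..1}. \<forall>y. \<bar>E t y\<bar> \<le> B"
  proof -
    have N0: "N \<ge> 0"
      using N[of 0 "SOME i. i \<in> Basis"] by (metis N SOME_Basis abs_ge_zero norm_Basis mult.right_neutral order_trans)
    have "\<bar>E t y\<bar> \<le> N * ((norm v + \<bar>s\<bar>) / (b * m ^ Suc DIM('a))) + DIM('a) * (\<bar>s\<bar> / m) * (1 / (b * m ^ DIM('a)))"
      if t: "t \<in> {0..1}" for t y
    proof (cases "y \<in> cball (cc t) (\<rho> t)")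
      case True
      let ?z = "(y - cc t) /\<^sub>R \<rho> t"
      have fd: "frechet_derivative (kern (cc t) (\<rho> t)) (at y) h = frechet_derivative bump (at ?z) h / (b * \<rho> t ^ Suc DIM('a))" for h
        using frechet_derivative_kern[OF \<rho>0[OF t]] by (simp only: b_def)
      have "\<bar>frechet_derivative (kern (cc t) (\<rho> t)) (at y) (w t y)\<bar> \<le> N * norm (w t y) / (b * \<rho> t ^ Suc DIM('a))"
        using N[of ?z "w t y"] b \<rho>0[OF t] by (simp add: fd divide_right_mono del: power_Suc)
      also have "\<dots> \<le> N * (norm v + \<bar>s\<bar>) / (b * m ^ Suc DIM('a))"
        using N0 b m wle[OF t True] \<rho>m[OF t] 
        by (intro frac_le mult_left_mono power_mono mult_nonneg_nonneg mult_pos_pos zero_less_power) auto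
      finally have 1: "\<bar>frechet_derivative (kern (cc t) (\<rho> t)) (at y) (w t y)\<bar> \<le> N * ((norm v + \<bar>s\<bar>) / (b * m ^ Suc DIM('a)))" by simp
      have k: "\<bar>kern (cc t) (\<rho> t) y\<bar> \<le> 1 / (b * m ^ DIM('a))"
        using kbound[OF t, of y] b m by (auto simp: indicator_def split: if_splits intro: order_trans)
      have "\<bar>DIM('a) * (s / \<rho> t) * kern (cc t) (\<rho> t) y\<bar> = DIM('a) * (\<bar>s\<bar> / \<rho> t) * \<bar>kern (cc t) (\<rho> t) y\<bar>"
        using \<rho>0[OF t] by (simp add: abs_mult)
      also have "\<dots> \<le> DIM('a) * (\<bar>s\<bar> / m) * (1 / (b * m ^ DIM('a)))"
        using k m \<rho>m[OF t] \<rho>0[OF t] b by (intro mult_mono divide_left_mono) auto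
      finally show ?thesis using 1 unfolding E_def by linarith
    next
      case False
      have "frechet_derivative (kern (cc t) (\<rho> t)) (at y) h = 0" for h
      proof -
        have "(kern (cc t) (\<rho> t) has_derivative (\<lambda>x. 0)) (at y)"
          by (rule has_derivative_transform_within_open[where s="- cball (cc t) (\<rho> t)" and f="\<lambda>x. 0"])
             (use False kern_eq_0[OF \<rho>0[OF t], of "cc t"] in \<open>auto simp: not_le\<close>)
        then show ?thesis using frechet_derivative_at by metis
      qed
      moreover have "kern (cc t) (\<rho> t) y = 0" using False kern_eq_0[OF \<rho>0[OF t], of "cc t" y] by auto
      ultimately have "E t y = 0" by (simp add: E_def)
      then show ?thesis using N0 b m by simp
    qed
    then show ?thesis by blast
  qed
  then obtain B where B: "\<And>t y. t \<in> {0..1} \<Longrightarrow> \<bar>E t y\<bar> \<le> B" by blast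
  have intk: "integrable ?M (\<lambda>y. \<phi> y * kern (cc t) (\<rho> t) y)" if "t \<in> {0..1}" for t
  proof -
    have "\<bar>kern (cc t) (\<rho> t) y\<bar> \<le> 1 / (b * m ^ DIM('a))" for y
      using kbound[OF that, of y] b m by (auto simp: indicator_def split: if_splits intro: order_trans)
    then have "integrable ?M (\<lambda>y. kern (cc t) (\<rho> t) y * \<phi> y)"
      by (intro integrable_bounded_mult \<phi> kmeas) auto
    then show ?thesis by (simp add: mult.commute)
  qed
  have Emeas: "E t \<in> borel_measurable ?M" if t: "t \<in> {0..1}" for t
  proof -
    have "E t = (\<lambda>y. (\<Sum>i\<in>Basis. (w t y \<bullet> i) * frechet_derivative (kern (cc t) (\<rho> t)) (at y) i) + DIM('a) * (s / \<rho> t) * kern (cc t) (\<rho> t) y)"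
    proof
      fix y
      have lin: "linear (frechet_derivative (kern (cc t) (\<rho> t)) (at y))"
        using C_times_has_derivative[OF C_times_kern] has_derivative_linear by blast
      have "frechet_derivative (kern (cc t) (\<rho> t)) (at y) (w t y) = frechet_derivative (kern (cc t) (\<rho> t)) (at y) (\<Sum>i\<in>Basis. (w t y \<bullet> i) *\<^sub>R i)"
        by (simp add: euclidean_representation)
      then show "E t y = (\<lambda>y. (\<Sum>i\<in>Basis. (w t y \<bullet> i) * frechet_derivative (kern (cc t) (\<rho> t)) (at y) i) + DIM('a) * (s / \<rho> t) * kern (cc t) (\<rho> t) y) y"
        by (simp add: linear_sum[OF lin] linear_cmul[OF lin] E_def)
    qed
    also have "\<dots> \<in> borel_measurable ?M"
      unfolding w_def
    proof (rule meas, intro continuous_intros)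
      show "continuous_on UNIV (\<lambda>y. frechet_derivative (kern (cc t) (\<rho> t)) (at y) i)" if "i \<in> Basis" for i
        using C_times_kern[of "Suc 0" "cc t" "\<rho> t"] that by simp
      show "continuous_on UNIV (kern (cc t) (\<rho> t))"
        by (rule C_times_continuous[OF C_times_kern])
    qed
    finally show ?thesis .
  qed
  have wmeas: "w t \<in> borel_measurable ?M" for t
    unfolding w_def[abs_def] by (intro meas' continuous_intros)
  have F: "((\<lambda>t. avg S \<phi> (cc t) (\<rho> t)) has_field_derivative (LINT y|?M. \<phi> y * - E t y)) (at t within {0..1})"
    if t: "t \<in> {0..1}" for t
    unfolding avg_def
  proof (rule has_field_derivative_lebesgue_integral[where w="\<lambda>y. \<bar>\<phi> y\<bar> * B"])
    show "((\<lambda>s. \<phi> y * kern (cc s) (\<rho> s) y) has_field_derivative \<phi> y * - E s y) (at s within {0..1})"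
      if "s \<in> {0..1}" for s y
      using DERIV_cmult[OF kder[OF that]] .
    show "(\<lambda>y. \<phi> y * - E t y) \<in> borel_measurable ?M"
      using Emeas[OF t] \<phi> by measurable
    show "\<bar>\<phi> y * - E s y\<bar> \<le> \<bar>\<phi> y\<bar> * B" if "s \<in> {0..1}" for s y
      using B[OF that] by (simp add: abs_mult mult_left_mono)
  qed (use t intk \<phi> in auto)
  have intGU: "integrable ?M (\<lambda>y. norm (G y) * indicator U y)"
    using G U by (intro integrable_real_mult_indicator) (auto simp: sets_restrict_space_iff S)
  have bound: "norm (LINT y|?M. \<phi> y * - E t y) \<le> (norm v + \<bar>s\<bar>) / (b * m ^ DIM('a)) * (LINT y|?M. norm (G y) * indicator U y)"
    if t: "t \<in> {0..1}" for t
  proof -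
    \<comment> \<open>The radial identity with \<open>a = s / \<rho> t\<close> moves the divergence
      onto \<open>\<phi>\<close>: only the size of the kernel remains, not that of its
      gradient.\<close>
    have "(LINT y|?M. \<phi> y * - E t y) = (LINT y|?M. kern (cc t) (\<rho> t) y * (G y \<bullet> w t y))"
    proof -
      have "(LINT y|?M. \<phi> y * - E t y) = - (LINT y|?M. \<phi> y * E t y)"
        by simp
      also have "(LINT y|?M. \<phi> y * E t y) = - (LINT y|?M. kern (cc t) (\<rho> t) y * (G y \<bullet> w t y))"
        unfolding E_def w_def using sub[OF t] U
        by (intro weak_gradient_radial[OF S wg \<phi> G \<rho>0[OF t]]) auto
      finally show ?thesis by simp
    qed
    also have "norm \<dots> \<le> (LINT y|?M. (norm v + \<bar>s\<bar>) / (b * m ^ DIM('a)) * (norm (G y) * indicator U y))"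
    proof (rule Bochner_Integration.integral_norm_bound_integral)
      show "norm (kern (cc t) (\<rho> t) y * (G y \<bullet> w t y)) \<le> (norm v + \<bar>s\<bar>) / (b * m ^ DIM('a)) * (norm (G y) * indicator U y)" for y
      proof (cases "y \<in> cball (cc t) (\<rho> t)")
        case True
        have "\<bar>kern (cc t) (\<rho> t) y\<bar> * \<bar>G y \<bullet> w t y\<bar> \<le> (1 / (b * m ^ DIM('a)) * indicator U y) * (norm (G y) * (norm v + \<bar>s\<bar>))"
          using kbound[OF t] b m order_trans[OF Cauchy_Schwarz_ineq2 mult_left_mono[OF wle[OF t True] norm_ge_zero]]
          by (intro mult_mono) auto
        then show ?thesis by (simp add: abs_mult mult_ac)
      next
        case False
        then show ?thesis using kern_eq_0[OF \<rho>0[OF t], of "cc t" y] b m by auto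
      qed
      then show "integrable ?M (\<lambda>y. kern (cc t) (\<rho> t) y * (G y \<bullet> w t y))"
        by (intro Bochner_Integration.integrable_bound[OF integrable_mult_right[OF intGU, of "(norm v + \<bar>s\<bar>) / (b * m ^ DIM('a))"]] AE_I2)
           (use G wmeas[of t] in \<open>auto intro: order_trans[OF _ abs_ge_self] simp del: times_divide_eq_left times_divide_eq_right\<close>)
    qed (use intGU in auto)
    finally show ?thesis by simp
  qed
  have "norm (avg S \<phi> (cc 1) (\<rho> 1) - avg S \<phi> (cc 0) (\<rho> 0)) \<le> (norm v + \<bar>s\<bar>) / (b * m ^ DIM('a)) * (LINT y|?M. norm (G y) * indicator U y) * norm (1 - 0 :: real)"
    by (rule field_differentiable_bound[where S="{0..1}" and f="\<lambda>t. avg S \<phi> (cc t) (\<rho> t)"])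
       (use F bound in auto)
  then show ?thesis
    by (simp add: cc_def \<rho>_def v_def s_def b_def)
qed

section \<open>The cone condition and comparison of averages\<close>

text \<open>At a boundary point the graph direction points into the set, and a point above a
  Lipschitz graph stays above it along a cone whose aperture depends on \<open>L\<close>. At an
  interior point the direction \<open>0\<close> turns the cone into concentric balls, which is why
  only \<open>norm e \<le> 1\<close> is promised.\<close>

lemma lipschitz_boundary_local_cone:
  fixes \<Omega> :: "'a::euclidean_space set"
  assumes "open \<Omega>" "lipschitz_boundary \<Omega>" "p \<in> closure \<Omega>"
  obtains s e \<kappa> where "0 < s" "norm e \<le> 1" "0 < \<kappa>" "\<kappa> \<le> 1"
    "\<And>x t. x \<in> \<Omega> \<Longrightarrow> x \<in> ball p s \<Longrightarrow> 0 < t \<Longrightarrow> t \<le> s \<Longrightarrow> cball (x + t *\<^sub>R e) (\<kappa> * t) \<subseteq> \<Omega>"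
proof (cases "p \<in> \<Omega>")
  case True
  then obtain d where d: "d > 0" "ball p d \<subseteq> \<Omega>"
    using assms(1) open_contains_ball by blast
  show ?thesis
  proof (rule that[of "d / 2" 0 1])
    fix x t assume "x \<in> ball p (d / 2)" "t \<le> d / 2"
    then have "dist p z < d" if "dist x z \<le> t" for z
      using dist_triangle[of p z x] that by simp
    then have "cball (x + t *\<^sub>R 0) (1 * t) \<subseteq> ball p d"
      by auto
    then show "cball (x + t *\<^sub>R 0) (1 * t) \<subseteq> \<Omega>" using d by blast
  qed (use d in auto)
next
  case False
  then have "p \<in> frontier \<Omega>"
    using assms by (simp add: frontier_def interior_open)
  then obtain r e g L where r: "r > 0" and e: "norm e = 1" and g: "L-lipschitz_on {y. y \<bullet> e = 0} g"
    and eq: "\<Omega> \<inter> ball p r = {x \<in> ball p r. g (x - (x \<bullet> e) *\<^sub>R e) < x \<bullet> e}"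
    using assms(2) unfolding lipschitz_boundary_def by blast
  have L: "L \<ge> 0" using g lipschitz_on_nonneg by blast
  have ee: "e \<bullet> e = 1" using e by (simp add: norm_eq_1)
  \<comment> \<open>Moving by \<open>t\<close> along \<open>e\<close> gains height \<open>t\<close>.
    A further displacement of norm at most \<open>\<kappa> * t\<close> loses at most
    \<open>\<kappa> * t\<close> of height and raises the graph by at most
    \<open>2 * L * \<kappa> * t\<close>; the \<open>2\<close> comes from bounding the projection by
    the triangle inequality. This \<open>\<kappa>\<close> makes the losses add up to
    \<open>t\<close>.\<close>
  define \<kappa> where "\<kappa> = 1 / (1 + 2 * L)"
  have \<kappa>: "0 < \<kappa>" "\<kappa> \<le> 1" "\<kappa> + 2 * L * \<kappa> = 1" using L by (auto simp: \<kappa>_def field_simps)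
  show ?thesis
  \<comment> \<open>The distances from \<open>p\<close> to \<open>x\<close>, along
    \<open>t *\<^sub>R e\<close>, and within the small ball are each at most \<open>r / 4\<close>,
    so the chart on \<open>ball p r\<close> applies.\<close>
  proof (rule that[of "r / 4" e \<kappa>])
    fix x t assume x: "x \<in> \<Omega>" "x \<in> ball p (r / 4)" and t: "0 < t" "t \<le> r / 4"
    show "cball (x + t *\<^sub>R e) (\<kappa> * t) \<subseteq> \<Omega>"
    proof
      fix z assume z: "z \<in> cball (x + t *\<^sub>R e) (\<kappa> * t)"
      define w where "w = z - (x + t *\<^sub>R e)"
      have w: "norm w \<le> \<kappa> * t" using z by (simp add: w_def dist_norm norm_minus_commute)
      have \<kappa>t: "\<kappa> * t \<le> t" using \<kappa> t by simp
      have zx: "z = x + t *\<^sub>R e + w" by (simp add: w_def)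
      have we: "\<bar>w \<bullet> e\<bar> \<le> norm w" using Cauchy_Schwarz_ineq2[of w e] e by simp
      have "dist p z \<le> dist p x + dist x z" by (rule dist_triangle)
      also have "dist x z = norm (t *\<^sub>R e + w)"
        by (subst dist_commute) (simp add: w_def dist_norm)
      also have "\<dots> \<le> t + norm w"
        using norm_triangle_ineq[of "t *\<^sub>R e" w] e t by simp
      finally have "dist p z \<le> dist p x + (t + norm w)" by simp
      moreover have "dist p x < r / 4" using x(2) by simp
      ultimately have "dist p z < r" using t w \<kappa>t by linarith
      then have zp: "z \<in> ball p r" by simp
      let ?P = "\<lambda>y. y - (y \<bullet> e) *\<^sub>R e"
      have P: "?P y \<in> {y. y \<bullet> e = 0}" for y
        using ee by (simp add: inner_diff_left)
      have "?P z - ?P x = w - (w \<bullet> e) *\<^sub>R e"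
        using ee by (simp add: zx inner_add_left algebra_simps)
      then have "dist (?P z) (?P x) \<le> norm w + \<bar>w \<bullet> e\<bar>"
        using norm_triangle_ineq4[of w "(w \<bullet> e) *\<^sub>R e"] e unfolding dist_norm by simp
      also have "\<dots> \<le> 2 * (\<kappa> * t)" using we w by linarith
      finally have "L * dist (?P z) (?P x) \<le> L * (2 * (\<kappa> * t))"
        using L by (rule mult_left_mono)
      moreover have "dist (g (?P z)) (g (?P x)) \<le> L * dist (?P z) (?P x)"
        by (rule lipschitz_onD[OF g P P])
      then have "g (?P z) \<le> g (?P x) + L * dist (?P z) (?P x)"
        unfolding dist_real_def by linarith
      moreover have "x \<in> ball p r" using x(2) r by auto
      then have "g (?P x) < x \<bullet> e" using eq x(1) by blast
      ultimately have "g (?P z) < x \<bullet> e + L * (2 * (\<kappa> * t))" by linarith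
      also have "\<dots> = x \<bullet> e + t - \<kappa> * t"
        using arg_cong[OF \<kappa>(3), of "\<lambda>u. u * t"] by (simp add: algebra_simps)
      also have "\<dots> \<le> z \<bullet> e" using we w ee by (simp add: zx inner_add_left)
      finally show "z \<in> \<Omega>" using eq zp by blast
    qed
  qed (use r e \<kappa> in auto)
qed

text \<open>Compactness of the closure reduces the local cones to finitely many, with a common
  aperture and height. They are kept as a finite set of data so that a measurable choice of
  direction is possible afterwards.\<close>

lemma lipschitz_boundary_cone:
  fixes \<Omega> :: "'a::euclidean_space set"
  assumes "open \<Omega>" "bounded \<Omega>" "lipschitz_boundary \<Omega>"
  obtains \<kappa> t0 and D :: "('a \<times> real \<times> 'a) set" where "finite D" "0 < \<kappa>" "\<kappa> \<le> 1" "0 < t0"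
    "\<Omega> \<subseteq> (\<Union>(p, s, e)\<in>D. ball p s)"
    "\<And>p s e x t. (p, s, e) \<in> D \<Longrightarrow> x \<in> \<Omega> \<Longrightarrow> x \<in> ball p s \<Longrightarrow> 0 < t \<Longrightarrow> t \<le> t0 \<Longrightarrow>
        norm e \<le> 1 \<and> cball (x + t *\<^sub>R e) (\<kappa> * t) \<subseteq> \<Omega>"
proof -
  have "\<forall>p\<in>closure \<Omega>. \<exists>s e \<kappa>. 0 < s \<and> norm e \<le> 1 \<and> 0 < \<kappa> \<and> \<kappa> \<le> 1 \<and>
    (\<forall>x t. x \<in> \<Omega> \<longrightarrow> x \<in> ball p s \<longrightarrow> 0 < t \<longrightarrow> t \<le> s \<longrightarrow> cball (x + t *\<^sub>R e) (\<kappa> * t) \<subseteq> \<Omega>)"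
    using lipschitz_boundary_local_cone[OF assms(1,3)] by metis
  then obtain s e k where loc: "\<And>p. p \<in> closure \<Omega> \<Longrightarrow> 0 < s p \<and> norm (e p) \<le> 1 \<and> 0 < k p \<and> k p \<le> 1 \<and>
    (\<forall>x t. x \<in> \<Omega> \<longrightarrow> x \<in> ball p (s p) \<longrightarrow> 0 < t \<longrightarrow> t \<le> s p \<longrightarrow> cball (x + t *\<^sub>R e p) (k p * t) \<subseteq> \<Omega>)"
    by metis
  have "compact (closure \<Omega>)" using assms by simp
  moreover have "closure \<Omega> \<subseteq> (\<Union>p\<in>closure \<Omega>. ball p (s p))"
    using loc by (auto intro: UN_I simp del: closure_subset)
  ultimately obtain C where C: "C \<subseteq> closure \<Omega>" "finite C" "closure \<Omega> \<subseteq> (\<Union>p\<in>C. ball p (s p))"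
    using compactE_image[of "closure \<Omega>" "closure \<Omega>" "\<lambda>p. ball p (s p)"] by (metis open_ball)
  \<comment> \<open>The inserted \<open>1\<close> keeps the minima defined when \<open>C\<close> is
    empty; it also forces \<open>\<kappa> \<le> 1\<close>.\<close>
  define \<kappa> t0 where "\<kappa> = Min (insert 1 (k ` C))" and "t0 = Min (insert 1 (s ` C))"
  have \<kappa>: "0 < \<kappa>" "\<kappa> \<le> 1" "0 < t0" and le: "\<And>p. p \<in> C \<Longrightarrow> \<kappa> \<le> k p" "\<And>p. p \<in> C \<Longrightarrow> t0 \<le> s p"
    using C loc by (auto simp: \<kappa>_def t0_def)
  show ?thesis
  proof (rule that[of "(\<lambda>p. (p, s p, e p)) ` C" \<kappa> t0])
    show "\<Omega> \<subseteq> (\<Union>(p, s, e)\<in>(\<lambda>p. (p, s p, e p)) ` C. ball p s)"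
      using C(3) closure_subset by fastforce
    fix p s' e' x t assume "(p, s', e') \<in> (\<lambda>p. (p, s p, e p)) ` C" and x: "x \<in> \<Omega>" "x \<in> ball p s'" and t: "0 < t" "t \<le> t0"
    then have p: "p \<in> C" "s' = s p" "e' = e p" by auto
    have "cball (x + t *\<^sub>R e p) (\<kappa> * t) \<subseteq> cball (x + t *\<^sub>R e p) (k p * t)"
      using le[OF p(1)] t by (intro subset_cball mult_right_mono) auto
    also have "\<dots> \<subseteq> \<Omega>"
      using conjunct2[OF conjunct2[OF conjunct2[OF conjunct2[OF loc[of p]]]]] C(1) p x t le[OF p(1)]
      by (simp add: subset_iff)
    finally show "norm e' \<le> 1 \<and> cball (x + t *\<^sub>R e') (\<kappa> * t) \<subseteq> \<Omega>" using loc[of p] C(1) p by auto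
  qed (use \<kappa> C in auto)
qed

section \<open>Uniform comparison of averages in a connected set\<close>

definition W11 :: "'a::euclidean_space set \<Rightarrow> ('a \<Rightarrow> real) \<Rightarrow> ('a \<Rightarrow> 'a) \<Rightarrow> bool" where
  "W11 S \<phi> G \<longleftrightarrow> integrable (lebesgue_on S) \<phi> \<and> integrable (lebesgue_on S) G \<and> weak_gradient S \<phi> G"

lemma avg_diff_le':
  fixes c c' :: "'a::euclidean_space" and r r' m :: real
  assumes "open S" "W11 S \<phi> G" "0 < m" "m \<le> r" "m \<le> r'"
    and hull: "\<And>t. 0 \<le> t \<Longrightarrow> t \<le> 1 \<Longrightarrow> cball (c + t *\<^sub>R (c' - c)) (r + t * (r' - r)) \<subseteq> S"
  shows "\<bar>avg S \<phi> c' r' - avg S \<phi> c r\<bar> \<le> (norm (c' - c) + \<bar>r' - r\<bar>) / (bump_mass TYPE('a) * m ^ DIM('a))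
           * (LINT y|lebesgue_on S. norm (G y))"
proof -
  have "\<bar>avg S \<phi> c' r' - avg S \<phi> c r\<bar> \<le> (norm (c' - c) + \<bar>r' - r\<bar>) / (bump_mass TYPE('a) * m ^ DIM('a))
           * (LINT y|lebesgue_on S. norm (G y) * indicator S y)"
    using assms by (intro avg_diff_le) (auto simp: W11_def)
  also have "(LINT y|lebesgue_on S. norm (G y) * indicator S y) = (LINT y|lebesgue_on S. norm (G y))"
    by (intro Bochner_Integration.integral_cong) (auto simp: space_restrict_space)
  finally show ?thesis .
qed

text \<open>The constant is chosen before \<open>\<phi>\<close> and \<open>G\<close>; in the reverse
  order the relation would hold for almost trivial reasons.\<close>

definition avg_comparable :: "'a::euclidean_space set \<Rightarrow> 'a \<Rightarrow> real \<Rightarrow> 'a \<Rightarrow> real \<Rightarrow> bool" where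
  "avg_comparable S a r b r' \<longleftrightarrow> (\<exists>C. \<forall>\<phi> G. W11 S \<phi> G \<longrightarrow>
     \<bar>avg S \<phi> a r - avg S \<phi> b r'\<bar> \<le> C * (LINT y|lebesgue_on S. norm (G y)))"

lemma avg_comparable_sym: "avg_comparable S a r b r' \<Longrightarrow> avg_comparable S b r' a r"
  unfolding avg_comparable_def by (subst abs_minus_commute)

lemma avg_comparable_trans:
  assumes "avg_comparable S a r b r'" "avg_comparable S b r' c r''"
  shows "avg_comparable S a r c r''"
proof -
  obtain C C' where C: "\<And>\<phi> G. W11 S \<phi> G \<Longrightarrow> \<bar>avg S \<phi> a r - avg S \<phi> b r'\<bar> \<le> C * (LINT y|lebesgue_on S. norm (G y))"
    "\<And>\<phi> G. W11 S \<phi> G \<Longrightarrow> \<bar>avg S \<phi> b r' - avg S \<phi> c r''\<bar> \<le> C' * (LINT y|lebesgue_on S. norm (G y))"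
    using assms unfolding avg_comparable_def by blast
  then have "\<bar>avg S \<phi> a r - avg S \<phi> c r''\<bar> \<le> (C + C') * (LINT y|lebesgue_on S. norm (G y))" if "W11 S \<phi> G" for \<phi> G
    unfolding distrib_right using C[OF that] by linarith
  then show ?thesis unfolding avg_comparable_def by blast
qed

lemma avg_comparable_hull:
  assumes "open S" "0 < r" "0 < r'"
    and "\<And>t. 0 \<le> t \<Longrightarrow> t \<le> 1 \<Longrightarrow> cball (c + t *\<^sub>R (c' - c)) (r + t * (r' - r)) \<subseteq> S"
  shows "avg_comparable S c' r' c r"
  unfolding avg_comparable_def
  using avg_diff_le'[OF assms(1) _ _ _ _ assms(4), of _ _ "min r r'"] assms(2,3)
  by (intro exI[of _ "(norm (c' - c) + \<bar>r' - r\<bar>) / (bump_mass TYPE('a) * min r r' ^ DIM('a))"]) auto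

lemma avg_comparable_radius:
  assumes "open S" "0 < r" "0 < r'" "cball c r \<subseteq> S" "cball c r' \<subseteq> S"
  shows "avg_comparable S c r c r'"
proof (rule avg_comparable_hull)
  fix t :: real assume t: "0 \<le> t" "t \<le> 1"
  have "(1 - t) * r' + t * r \<le> (1 - t) * max r r' + t * max r r'"
    using t by (intro add_mono mult_left_mono) auto
  then have "r' + t * (r - r') \<le> max r r'" by (simp add: algebra_simps)
  then have "cball c (r' + t * (r - r')) \<subseteq> cball c (max r r')"
    by (rule subset_cball)
  also have "cball c (max r r') \<subseteq> S"
    using assms by (simp add: max_def)
  finally show "cball (c + t *\<^sub>R (c - c)) (r' + t * (r - r')) \<subseteq> S" by simp
qed (use assms in auto)

lemma cball_segment_subset:
  fixes a b :: "'a::real_normed_vector"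
  assumes "0 \<le> t" "t \<le> 1" "dist a b \<le> d"
  shows "cball (a + t *\<^sub>R (b - a)) r \<subseteq> cball a (r + d)"
proof
  fix z assume z: "z \<in> cball (a + t *\<^sub>R (b - a)) r"
  have "dist a z \<le> dist a (a + t *\<^sub>R (b - a)) + dist (a + t *\<^sub>R (b - a)) z" by (rule dist_triangle)
  also have "a - (a + t *\<^sub>R (b - a)) = t *\<^sub>R (a - b)"
    by (simp add: algebra_simps)
  then have "dist a (a + t *\<^sub>R (b - a)) = t * dist a b" using assms by (simp add: dist_norm)
  also have "\<dots> \<le> 1 * d" using assms by (intro mult_mono) auto
  finally show "z \<in> cball a (r + d)" using z by simp
qed

text \<open>Comparability is an equivalence relation, and nearby centres are related through balls
  inside a common larger ball. Its classes are therefore relatively open, and connectedness leaves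
  only one.\<close>

lemma avg_comparable_connected:
  assumes "open S" "connected S" "0 < r" "0 < r'" "cball a r \<subseteq> S" "cball b r' \<subseteq> S"
  shows "avg_comparable S a r b r'"
proof -
  \<comment> \<open>Quantifying over all admissible radii gives a relation between points alone, as
    the connectedness principle requires.\<close>
  define R where "R a b \<longleftrightarrow> (\<forall>r r'. 0 < r \<longrightarrow> 0 < r' \<longrightarrow> cball a r \<subseteq> S \<longrightarrow> cball b r' \<subseteq> S \<longrightarrow> avg_comparable S a r b r')" for a b
  have "R a b"
  proof (rule connected_equivalence_relation[OF assms(2)])
    show "R y x" if "R x y" for x y
      using that avg_comparable_sym unfolding R_def by blast
    show "R x z" if xy: "R x y" and yz: "R y z" and y: "y \<in> S" for x y z
    proof -
      \<comment> \<open>Transitivity needs an actual ball at the middle point, since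
        \<open>R\<close> is vacuous where no radius is admissible; openness provides one.\<close>
      obtain d where d: "d > 0" "cball y d \<subseteq> S" using assms(1) y open_contains_cball by blast
      show ?thesis
        unfolding R_def
      proof (intro allI impI)
        fix r r' :: real assume "0 < r" "0 < r'" "cball x r \<subseteq> S" "cball z r' \<subseteq> S"
        then have "avg_comparable S x r y d" "avg_comparable S y d z r'"
          using xy yz d unfolding R_def by simp_all
        then show "avg_comparable S x r z r'" by (rule avg_comparable_trans)
      qed
    qed
    show "\<exists>T. openin (top_of_set S) T \<and> x \<in> T \<and> (\<forall>y\<in>T. R x y)" if x: "x \<in> S" for x
    proof -
      obtain d where d: "d > 0" "cball x d \<subseteq> S" using assms(1) x open_contains_cball by blast
      have "R x y" if y: "y \<in> ball x (d / 2)" for y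
        unfolding R_def
      proof (intro allI impI)
        fix r r' :: real assume r: "0 < r" "0 < r'" "cball x r \<subseteq> S" "cball y r' \<subseteq> S"
        have 1: "cball x (d / 2) \<subseteq> S" using d by (intro order_trans[OF subset_cball d(2)]) auto
        have hull: "cball (x + t *\<^sub>R (y - x)) (d / 2) \<subseteq> S" if "0 \<le> t" "t \<le> 1" for t
          using cball_segment_subset[OF that, of x y "d/2" "d/2"] y d by auto
        have 2: "cball y (d / 2) \<subseteq> S" using hull[of 1] by simp
        have "avg_comparable S x r x (d / 2)" using r d 1 assms(1) by (intro avg_comparable_radius) auto
        moreover have "avg_comparable S y (d / 2) x (d / 2)"
          using d hull assms(1) by (intro avg_comparable_hull) auto
        moreover have "avg_comparable S y (d / 2) y r'" using r d 2 assms(1) by (intro avg_comparable_radius) auto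
        ultimately show "avg_comparable S x r y r'"
          by (meson avg_comparable_trans avg_comparable_sym)
      qed
      moreover have "ball x (d / 2) \<subseteq> S" using d by (intro order_trans[OF _ d(2)]) auto
      ultimately show ?thesis using d assms(1)
        by (intro exI[of _ "ball x (d / 2)"]) (auto simp: openin_open_eq)
    qed
  qed (use assms in auto)
  then show ?thesis using assms by (simp add: R_def)
qed

text \<open>Connectedness gives a separate constant for each centre. A finite net of centres turns
  these into one constant, and an arbitrary centre is linked to the net through balls of half the
  radius.\<close>

lemma avg_uniformly_comparable:
  fixes S :: "'a::euclidean_space set"
  assumes "open S" "connected S" "bounded S" "0 < r" "0 < r'" "cball a r' \<subseteq> S"
  shows "\<exists>C\<ge>0. \<forall>\<phi> G c. W11 S \<phi> G \<longrightarrow> cball c r \<subseteq> S \<longrightarrow>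
           \<bar>avg S \<phi> c r - avg S \<phi> a r'\<bar> \<le> C * (LINT y|lebesgue_on S. norm (G y))"
proof -
  define K where "K = {c. cball c r \<subseteq> S}"
  have "K \<subseteq> S" using assms(4) by (auto simp: K_def)
  then have "compact (closure K)" using assms(3) bounded_subset by auto
  \<comment> \<open>The net is taken in \<open>K\<close> itself rather than in its closure, so that
    the balls about its points lie in \<open>S\<close>.\<close>
  moreover have "closure K \<subseteq> (\<Union>c\<in>K. ball c (r / 2))"
  proof
    fix x assume "x \<in> closure K"
    then obtain c where "c \<in> K" "dist c x < r / 2"
      using assms(4) unfolding closure_approachable by (meson half_gt_zero)
    then show "x \<in> (\<Union>c\<in>K. ball c (r / 2))" by auto
  qed
  ultimately obtain F where F: "F \<subseteq> K" "finite F" "closure K \<subseteq> (\<Union>c\<in>F. ball c (r / 2))"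
    using compactE_image[of "closure K" K "\<lambda>c. ball c (r / 2)"] by (metis open_ball)
  have half: "cball c (r / 2) \<subseteq> S" if "c \<in> K" for c
    using that assms(4) by (intro order_trans[OF subset_cball, of "r / 2" r]) (auto simp: K_def)
  have "\<exists>C. \<forall>\<phi> G. W11 S \<phi> G \<longrightarrow> \<bar>avg S \<phi> c (r / 2) - avg S \<phi> a r'\<bar> \<le> C * (LINT y|lebesgue_on S. norm (G y))" if "c \<in> F" for c
    using avg_comparable_connected[OF assms(1,2) _ assms(5) half assms(6), of "c"] assms(4) F that
    unfolding avg_comparable_def by auto
  then obtain C where C: "\<And>c \<phi> G. c \<in> F \<Longrightarrow> W11 S \<phi> G \<Longrightarrow> \<bar>avg S \<phi> c (r / 2) - avg S \<phi> a r'\<bar> \<le> C c * (LINT y|lebesgue_on S. norm (G y))"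
    by metis
  define C1 where "C1 = (r / 2) / (bump_mass TYPE('a) * (r / 2) ^ DIM('a))"
  have C1: "C1 \<ge> 0" using bump_mass_pos[where 'a='a] assms(4) by (simp add: C1_def)
  define C2 where "C2 = Max (insert 0 (C ` F))"
  have C2: "C2 \<ge> 0" "\<And>c. c \<in> F \<Longrightarrow> C c \<le> C2" using F by (auto simp: C2_def)
  have "\<bar>avg S \<phi> c r - avg S \<phi> a r'\<bar> \<le> (C1 + C1 + C2) * (LINT y|lebesgue_on S. norm (G y))"
    if W: "W11 S \<phi> G" and c: "cball c r \<subseteq> S" for \<phi> G c
  proof -
    let ?I = "LINT y|lebesgue_on S. norm (G y)"
    have I: "?I \<ge> 0" by simp
    have "c \<in> K" using c by (simp add: K_def)
    then have "c \<in> closure K" using closure_subset by blast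
    then obtain c0 where c0: "c0 \<in> F" "dist c0 c < r / 2" using F(3) by auto
    have "\<bar>avg S \<phi> c r - avg S \<phi> c (r / 2)\<bar> \<le> (norm (c - c) + \<bar>r - r / 2\<bar>) / (bump_mass TYPE('a) * (r / 2) ^ DIM('a)) * ?I"
    proof (rule avg_diff_le'[OF assms(1) W])
      fix t :: real assume "0 \<le> t" "t \<le> 1"
      then have "r / 2 + t * (r - r / 2) \<le> r" using assms(4) by (simp add: field_simps)
      then have "cball c (r / 2 + t * (r - r / 2)) \<subseteq> cball c r" by (rule subset_cball)
      then show "cball (c + t *\<^sub>R (c - c)) (r / 2 + t * (r - r / 2)) \<subseteq> S" using c by auto
    qed (use assms in auto)
    also have "\<dots> = C1 * ?I" using assms(4) by (simp add: C1_def)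
    finally have 1: "\<bar>avg S \<phi> c r - avg S \<phi> c (r / 2)\<bar> \<le> C1 * ?I" .
    \<comment> \<open>The centres are less than \<open>r / 2\<close> apart, so the hull of the two
      half-radius balls lies in \<open>cball c r\<close>.\<close>
    have "\<bar>avg S \<phi> c0 (r / 2) - avg S \<phi> c (r / 2)\<bar> \<le> (norm (c0 - c) + \<bar>r / 2 - r / 2\<bar>) / (bump_mass TYPE('a) * (r / 2) ^ DIM('a)) * ?I"
    proof (rule avg_diff_le'[OF assms(1) W])
      fix t :: real assume "0 \<le> t" "t \<le> 1"
      then have "cball (c + t *\<^sub>R (c0 - c)) (r / 2) \<subseteq> cball c (r / 2 + r / 2)"
        using c0 by (intro cball_segment_subset) (auto simp: dist_commute)
      then show "cball (c + t *\<^sub>R (c0 - c)) (r / 2 + t * (r / 2 - r / 2)) \<subseteq> S" using c by auto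
    qed (use assms in auto)
    also have "\<dots> \<le> C1 * ?I"
      unfolding C1_def using assms(4) c0 bump_mass_pos[where 'a='a]
      by (intro mult_right_mono divide_right_mono I) (auto simp: dist_norm)
    finally have 2: "\<bar>avg S \<phi> c0 (r / 2) - avg S \<phi> c (r / 2)\<bar> \<le> C1 * ?I" .
    have 3: "\<bar>avg S \<phi> c0 (r / 2) - avg S \<phi> a r'\<bar> \<le> C2 * ?I"
      using C[OF c0(1) W] mult_right_mono[OF C2(2)[OF c0(1)] I] by linarith
    show ?thesis unfolding distrib_right using 1 2 3 by linarith
  qed
  then show ?thesis using C1 C2 by (intro exI[of _ "C1 + C1 + C2"]) auto
qed

section \<open>Schur tests and the dyadic Riesz potential\<close>

text \<open>
  Both tests split \<open>g * K\<close> by the AM-GM inequality with a weight \<open>l\<close> that balances the two resulting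
  terms. The second one only needs the square of the kernel to be integrable in \<open>y\<close>: this is what
  produces a square root of the logarithm, instead of the logarithm, in dimension two.
\<close>

lemma schur_test:
  fixes u g :: "'a \<Rightarrow> real" and K :: "'a \<Rightarrow> 'a \<Rightarrow> real"
  assumes "sigma_finite_measure M"
    and [measurable]: "u \<in> borel_measurable M" "g \<in> borel_measurable M"
      "(\<lambda>(x, y). K x y) \<in> borel_measurable (M \<Otimes>\<^sub>M M)"
    and nonneg: "\<And>x. 0 \<le> u x" "\<And>x. 0 \<le> g x" "\<And>x y. 0 \<le> K x y"
    and um: "AE x in M. u x \<le> m" and u: "(\<integral>\<^sup>+x. u x \<partial>M) \<le> ennreal F" and g: "(\<integral>\<^sup>+x. (g x)\<^sup>2 \<partial>M) \<le> 1"
    and Kx: "\<And>y. y \<in> space M \<Longrightarrow> (\<integral>\<^sup>+x. K x y \<partial>M) \<le> ennreal \<kappa>"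
    and Ky: "\<And>x. x \<in> space M \<Longrightarrow> (\<integral>\<^sup>+y. K x y \<partial>M) \<le> ennreal \<kappa>"
    and pos: "0 < m" "0 < F" "0 \<le> \<kappa>"
  shows "(\<integral>\<^sup>+x. \<integral>\<^sup>+y. ennreal (u x * (g y * K x y)) \<partial>M \<partial>M) \<le> ennreal (\<kappa> * sqrt (m * F))"
proof -
  interpret sigma_finite_measure M by fact
  interpret pair_sigma_finite M M ..
  define l where "l = sqrt (m / F)"
  have l: "l > 0" using pos by (simp add: l_def)
  have pt: "u x * (g y * K x y) \<le> l / 2 * (u x * K x y) + 1 / (2 * l) * ((g y)\<^sup>2 * (u x * K x y))" for x y
  proof -
    have "2 * l * g y \<le> l\<^sup>2 + (g y)\<^sup>2" using sum_squares_bound[of l "g y"] by simp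
    then have "g y \<le> l / 2 + 1 / (2 * l) * (g y)\<^sup>2"
      using l by (simp add: field_simps power2_eq_square)
    then have "g y * (u x * K x y) \<le> (l / 2 + 1 / (2 * l) * (g y)\<^sup>2) * (u x * K x y)"
      using nonneg by (intro mult_right_mono) auto
    then show ?thesis by (simp add: algebra_simps)
  qed
  have "(\<integral>\<^sup>+x. \<integral>\<^sup>+y. ennreal (u x * (g y * K x y)) \<partial>M \<partial>M)
     \<le> (\<integral>\<^sup>+x. \<integral>\<^sup>+y. ennreal (l / 2) * (ennreal (u x) * ennreal (K x y)) + ennreal (1 / (2 * l)) * (ennreal ((g y)\<^sup>2) * (ennreal (u x) * ennreal (K x y))) \<partial>M \<partial>M)"
    using nonneg l by (intro nn_integral_mono order_trans[OF ennreal_leI[OF pt]]) (simp add: ennreal_mult del: times_divide_eq_left times_divide_eq_right)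
  also have "\<dots> = (\<integral>\<^sup>+x. ennreal (l / 2) * (ennreal (u x) * (\<integral>\<^sup>+y. K x y \<partial>M)) + ennreal (1 / (2 * l)) * (\<integral>\<^sup>+y. ennreal ((g y)\<^sup>2) * (ennreal (u x) * ennreal (K x y)) \<partial>M) \<partial>M)"
    by (intro nn_integral_cong) (simp add: nn_integral_add nn_integral_cmult)
  also have "\<dots> = ennreal (l / 2) * (\<integral>\<^sup>+x. ennreal (u x) * (\<integral>\<^sup>+y. K x y \<partial>M) \<partial>M) + ennreal (1 / (2 * l)) * (\<integral>\<^sup>+x. \<integral>\<^sup>+y. ennreal ((g y)\<^sup>2) * (ennreal (u x) * ennreal (K x y)) \<partial>M \<partial>M)"
    by (subst nn_integral_add) (auto simp: nn_integral_cmult)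
  \<comment> \<open>The two terms use opposite orders of integration: the one without
    \<open>g\<close> needs the mass of \<open>u\<close> and the integral of \<open>K\<close> in
    \<open>y\<close>, the one with \<open>g\<close> squared needs \<open>u \<le> m\<close> and the
    integral of \<open>K\<close> in \<open>x\<close>.\<close>
  also have "(\<integral>\<^sup>+x. \<integral>\<^sup>+y. ennreal ((g y)\<^sup>2) * (ennreal (u x) * ennreal (K x y)) \<partial>M \<partial>M)
     = (\<integral>\<^sup>+y. \<integral>\<^sup>+x. ennreal ((g y)\<^sup>2) * (ennreal (u x) * ennreal (K x y)) \<partial>M \<partial>M)"
    by (subst Fubini') auto
  also have "\<dots> = (\<integral>\<^sup>+y. ennreal ((g y)\<^sup>2) * (\<integral>\<^sup>+x. ennreal (u x) * ennreal (K x y) \<partial>M) \<partial>M)"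
    by (intro nn_integral_cong) (simp add: nn_integral_cmult)
  also have "\<dots> \<le> (\<integral>\<^sup>+y. ennreal ((g y)\<^sup>2) * ennreal (m * \<kappa>) \<partial>M)"
  proof (intro nn_integral_mono mult_left_mono)
    fix y assume y: "y \<in> space M"
    have "(\<integral>\<^sup>+x. ennreal (u x) * ennreal (K x y) \<partial>M) \<le> (\<integral>\<^sup>+x. ennreal m * ennreal (K x y) \<partial>M)"
      using um by (intro nn_integral_mono_AE) (auto intro!: mult_right_mono ennreal_leI elim!: eventually_mono)
    also have "\<dots> = ennreal m * (\<integral>\<^sup>+x. ennreal (K x y) \<partial>M)"
      using y by (intro nn_integral_cmult) measurable
    also have "\<dots> \<le> ennreal (m * \<kappa>)"
      using Kx[OF y] pos by (simp add: ennreal_mult mult_left_mono)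
    finally show "(\<integral>\<^sup>+x. ennreal (u x) * ennreal (K x y) \<partial>M) \<le> ennreal (m * \<kappa>)" .
  qed auto
  also have "\<dots> \<le> 1 * ennreal (m * \<kappa>)"
    using mult_right_mono[OF g, of "ennreal (m * \<kappa>)"] by (subst nn_integral_multc) auto
  also have "(\<integral>\<^sup>+x. ennreal (u x) * (\<integral>\<^sup>+y. K x y \<partial>M) \<partial>M) \<le> (\<integral>\<^sup>+x. ennreal (u x) * ennreal \<kappa> \<partial>M)"
    using Ky by (intro nn_integral_mono mult_left_mono) auto
  also have "\<dots> \<le> ennreal F * ennreal \<kappa>"
    using mult_right_mono[OF u, of "ennreal \<kappa>"] by (subst nn_integral_multc) auto
  finally have "(\<integral>\<^sup>+x. \<integral>\<^sup>+y. ennreal (u x * (g y * K x y)) \<partial>M \<partial>M)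
    \<le> ennreal (l / 2) * (ennreal F * ennreal \<kappa>) + ennreal (1 / (2 * l)) * (1 * ennreal (m * \<kappa>))"
    by (simp add: add_mono mult_left_mono)
  also have "\<dots> = ennreal (l / 2 * (F * \<kappa>) + 1 / (2 * l) * (m * \<kappa>))"
    using pos l by (simp add: ennreal_mult[symmetric] ennreal_plus[symmetric] del: ennreal_plus)
  also have "l / 2 * (F * \<kappa>) + 1 / (2 * l) * (m * \<kappa>) = \<kappa> * sqrt (m * F)"
  proof -
    have "l * F = sqrt (m * F)" "m / l = sqrt (m * F)"
      using pos by (auto simp: l_def real_sqrt_divide real_sqrt_mult field_simps)
    moreover have "l / 2 * (F * \<kappa>) + 1 / (2 * l) * (m * \<kappa>) = \<kappa> / 2 * (l * F) + \<kappa> / 2 * (m / l)"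
      by (simp add: mult_ac)
    ultimately show ?thesis by simp
  qed
  finally show ?thesis .
qed

lemma schur_test_square:
  fixes u g :: "'a \<Rightarrow> real" and K :: "'a \<Rightarrow> 'a \<Rightarrow> real"
  assumes "sigma_finite_measure M"
    and [measurable]: "u \<in> borel_measurable M" "g \<in> borel_measurable M"
      "(\<lambda>(x, y). K x y) \<in> borel_measurable (M \<Otimes>\<^sub>M M)"
    and nonneg: "\<And>x. 0 \<le> u x" "\<And>x. 0 \<le> g x" "\<And>x y. 0 \<le> K x y"
    and u: "(\<integral>\<^sup>+x. u x \<partial>M) \<le> ennreal F" and g: "(\<integral>\<^sup>+x. (g x)\<^sup>2 \<partial>M) \<le> 1"
    and Ky: "\<And>x. x \<in> space M \<Longrightarrow> (\<integral>\<^sup>+y. (K x y)\<^sup>2 \<partial>M) \<le> ennreal \<kappa>"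
    and pos: "0 \<le> F" "0 < \<kappa>"
  shows "(\<integral>\<^sup>+x. \<integral>\<^sup>+y. ennreal (u x * (g y * K x y)) \<partial>M \<partial>M) \<le> ennreal (F * sqrt \<kappa>)"
proof -
  interpret sigma_finite_measure M by fact
  define l where "l = 1 / sqrt \<kappa>"
  have l: "l > 0" using pos by (simp add: l_def)
  have pt: "u x * (g y * K x y) \<le> u x * (l / 2 * (K x y)\<^sup>2 + 1 / (2 * l) * (g y)\<^sup>2)" for x y
  proof -
    have "2 * (l * K x y) * g y \<le> (l * K x y)\<^sup>2 + (g y)\<^sup>2" using sum_squares_bound by blast
    then have "g y * K x y \<le> l / 2 * (K x y)\<^sup>2 + 1 / (2 * l) * (g y)\<^sup>2"
      using l by (simp add: field_simps power2_eq_square)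
    then show ?thesis using nonneg by (intro mult_left_mono) auto
  qed
  have "(\<integral>\<^sup>+x. \<integral>\<^sup>+y. ennreal (u x * (g y * K x y)) \<partial>M \<partial>M)
     \<le> (\<integral>\<^sup>+x. \<integral>\<^sup>+y. ennreal (u x) * (ennreal (l / 2) * ennreal ((K x y)\<^sup>2) + ennreal (1 / (2 * l)) * ennreal ((g y)\<^sup>2)) \<partial>M \<partial>M)"
    using nonneg l by (intro nn_integral_mono order_trans[OF ennreal_leI[OF pt]]) (simp add: ennreal_mult del: times_divide_eq_left times_divide_eq_right)
  also have "\<dots> = (\<integral>\<^sup>+x. ennreal (u x) * (ennreal (l / 2) * (\<integral>\<^sup>+y. (K x y)\<^sup>2 \<partial>M) + ennreal (1 / (2 * l)) * (\<integral>\<^sup>+y. (g y)\<^sup>2 \<partial>M)) \<partial>M)"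
    by (intro nn_integral_cong) (simp add: nn_integral_add nn_integral_cmult)
  also have "\<dots> \<le> (\<integral>\<^sup>+x. ennreal (u x) * (ennreal (l / 2) * ennreal \<kappa> + ennreal (1 / (2 * l)) * 1) \<partial>M)"
    using Ky g by (intro nn_integral_mono mult_left_mono add_mono) auto
  also have "\<dots> = (\<integral>\<^sup>+x. u x \<partial>M) * (ennreal (l / 2) * ennreal \<kappa> + ennreal (1 / (2 * l)) * 1)"
    by (intro nn_integral_multc) simp
  also have "\<dots> \<le> ennreal F * (ennreal (l / 2) * ennreal \<kappa> + ennreal (1 / (2 * l)) * 1)"
    using u by (intro mult_right_mono) auto
  also have "\<dots> = ennreal (F * (l / 2 * \<kappa> + 1 / (2 * l)))"
    using pos l by (simp add: ennreal_mult[symmetric] ennreal_plus[symmetric] del: ennreal_plus)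
  also have "l / 2 * \<kappa> + 1 / (2 * l) = sqrt \<kappa>"
    using pos by (simp add: l_def field_simps power2_eq_square[symmetric])
  finally show ?thesis .
qed

lemma sum_geometric_le:
  fixes x :: real
  assumes "x \<ge> 2"
  shows "(\<Sum>k<Suc n. x ^ k) \<le> 2 * x ^ n"
proof (induction n)
  case (Suc n)
  have "2 * x ^ n \<le> x * x ^ n" using assms by (intro mult_right_mono) auto
  then show ?case using Suc by simp
qed simp

text \<open>Since \<open>P\<close> holds on an initial segment, the sum is geometric up to its last
  active term and at most twice that term. Squaring therefore costs a factor four and no factor
  depending on the number of scales, which is essential for the root of the logarithm.\<close>

lemma sum_geometric_square_le:
  fixes a x :: real
  assumes x: "x \<ge> 2" and a: "a \<ge> 0" and dec: "\<And>k. P (Suc k) \<Longrightarrow> P k"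
  shows "(\<Sum>k<m. a * x ^ k * of_bool (P k))\<^sup>2 \<le> 4 * (\<Sum>k<m. (a * x ^ k)\<^sup>2 * of_bool (P k))"
proof (induction m)
  case (Suc m)
  show ?case
  proof (cases "P m")
    case True
    have le: "P k" if "k \<le> m" for k
      using that True by (induction rule: inc_induct) (auto intro: dec)
    have "(\<Sum>k<Suc m. a * x ^ k * of_bool (P k)) = a * (\<Sum>k<Suc m. x ^ k)"
      unfolding sum_distrib_left using le by (intro sum.cong) auto
    also have "\<dots> \<le> a * (2 * x ^ m)" using sum_geometric_le[OF x] a by (intro mult_left_mono)
    finally have "(\<Sum>k<Suc m. a * x ^ k * of_bool (P k))\<^sup>2 \<le> (a * (2 * x ^ m))\<^sup>2"
      using a x by (intro power_mono sum_nonneg) auto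
    also have "\<dots> = 4 * ((a * x ^ m)\<^sup>2 * of_bool (P m))" using True by (simp add: power_mult_distrib)
    also have "\<dots> \<le> 4 * (\<Sum>k<Suc m. (a * x ^ k)\<^sup>2 * of_bool (P k))"
      by (simp add: sum_nonneg)
    finally show ?thesis .
  qed (use Suc in simp)
qed simp

section \<open>Continuous approximation and local oscillation of integrable functions\<close>

text \<open>Truncation makes the function bounded at small cost in mean. A measurable function is an
  almost everywhere limit of continuous ones, and on a set of finite measure a constant dominates
  once these are truncated too.\<close>

lemma approximate_integrable_continuous:
  fixes \<phi> :: "'a::euclidean_space \<Rightarrow> real"
  assumes S: "S \<in> lmeasurable" and \<phi>: "integrable (lebesgue_on S) \<phi>" and e: "e > 0"
  obtains h where "continuous_on UNIV h" "integrable (lebesgue_on S) h" "(\<integral>\<^sup>+x. \<bar>\<phi> x - h x\<bar> \<partial>lebesgue_on S) < ennreal e"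
proof -
  let ?M = "lebesgue_on S"
  define clamp :: "real \<Rightarrow> real \<Rightarrow> real" where "clamp B t = max (- B) (min B t)" for B t
  have clamp: "\<bar>clamp B t\<bar> \<le> B" if "B \<ge> 0" for B t using that by (auto simp: clamp_def)
  have clamp_le: "\<bar>clamp B t\<bar> \<le> \<bar>t\<bar>" if "B \<ge> 0" for B t using that by (auto simp: clamp_def)
  have cont_clamp: "continuous_on X (\<lambda>x. clamp B (f x))" if "continuous_on X f" for X B and f :: "'b::topological_space \<Rightarrow> real"
    unfolding clamp_def using that by (intro continuous_intros)
  have [measurable]: "clamp B \<in> borel_measurable borel" for B
    by (intro borel_measurable_continuous_onI cont_clamp continuous_intros)
  have fin: "finite_measure ?M" using S by (rule finite_measure_lebesgue_on)
  have [measurable]: "\<phi> \<in> borel_measurable ?M" using \<phi> by simp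
  have "(\<lambda>n. \<integral>\<^sup>+x. norm (\<phi> x - clamp (real n) (\<phi> x)) \<partial>?M) \<longlonglongrightarrow> 0"
  proof (rule nn_integral_dominated_convergence_norm[where w="\<lambda>x. \<bar>\<phi> x\<bar>"])
    show "(\<integral>\<^sup>+x. \<bar>\<phi> x\<bar> \<partial>?M) < \<infinity>" using \<phi> by (simp add: integrable_iff_bounded)
    show "AE x in ?M. (\<lambda>n. clamp (real n) (\<phi> x)) \<longlonglongrightarrow> \<phi> x"
    proof (rule AE_I2)
      fix x
      have "eventually (\<lambda>n. real n \<ge> \<bar>\<phi> x\<bar>) sequentially"
        using eventually_ge_at_top[of "nat \<lceil>\<bar>\<phi> x\<bar>\<rceil>"] by eventually_elim linarith
      then have "eventually (\<lambda>n. clamp (real n) (\<phi> x) = \<phi> x) sequentially"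
        by eventually_elim (auto simp: clamp_def)
      then show "(\<lambda>n. clamp (real n) (\<phi> x)) \<longlonglongrightarrow> \<phi> x" by (rule tendsto_eventually)
    qed
    show "AE x in ?M. norm (clamp (real n) (\<phi> x)) \<le> \<bar>\<phi> x\<bar>" for n
      using clamp_le by (intro AE_I2) simp
  qed measurable
  from order_tendstoD(2)[OF this, of "ennreal (e / 2)"] e
  have "\<forall>\<^sub>F n in sequentially. (\<integral>\<^sup>+x. norm (\<phi> x - clamp (real n) (\<phi> x)) \<partial>?M) < ennreal (e / 2)"
    by simp
  then obtain B where B: "(\<integral>\<^sup>+x. \<bar>\<phi> x - clamp (real B) (\<phi> x)\<bar> \<partial>?M) < ennreal (e / 2)"
    by (auto simp: eventually_sequentially)
  define \<psi> where "\<psi> x = clamp (real B) (\<phi> x)" for x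
  have \<psi>[measurable]: "\<psi> \<in> borel_measurable ?M" unfolding \<psi>_def[abs_def] by measurable
  have "\<psi> measurable_on S"
    using \<psi> S by (simp add: measurable_on_iff_borel_measurable fmeasurableD)
  then obtain N g where N: "negligible N" and g': "\<forall>n. continuous_on UNIV (g n)"
    and lim: "\<forall>x. x \<notin> N \<longrightarrow> (\<lambda>n. g n x) \<longlonglongrightarrow> (if x \<in> S then \<psi> x else 0)"
    unfolding measurable_on_def by blast
  have g: "continuous_on UNIV (g n)" for n using g' by simp
  \<comment> \<open>Truncating the approximants does not change their limit, because
    \<open>\<psi>\<close> already takes values in the same interval.\<close>
  define h where "h n x = clamp (real B) (g n x)" for n x
  have conth: "continuous_on UNIV (h n)" for n
    unfolding h_def by (intro cont_clamp g)
  have hmeas[measurable]: "h n \<in> borel_measurable ?M" for n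
    using measurable_compose[OF borel_measurable_lebesgue_on_id borel_measurable_continuous_onI[OF conth]] by simp
  have "(\<lambda>n. \<integral>\<^sup>+x. norm (\<psi> x - h n x) \<partial>?M) \<longlonglongrightarrow> 0"
  proof (rule nn_integral_dominated_convergence_norm[where w="\<lambda>x. real B"])
    have "emeasure ?M (space ?M) < \<infinity>"
      using finite_measure.emeasure_finite[OF fin, of "space ?M"] by (metis infinity_ennreal_def top.not_eq_extremum)
    then show "(\<integral>\<^sup>+x. real B \<partial>?M) < \<infinity>"
      by (simp add: ennreal_mult_less_top)
    have "AE x in lebesgue. x \<notin> N"
      using N by (intro AE_not_in) (simp add: negligible_iff_null_sets)
    then have "AE x in lebesgue. x \<in> S \<longrightarrow> x \<notin> N" by (rule eventually_mono) simp
    then have "AE x in ?M. x \<notin> N"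
      using S by (subst AE_restrict_space_iff) (auto simp: fmeasurableD)
    then show "AE x in ?M. (\<lambda>n. h n x) \<longlonglongrightarrow> \<psi> x"
    proof (rule AE_mp, intro AE_I2 impI)
      fix x assume "x \<in> space ?M" "x \<notin> N"
      then have "(\<lambda>n. clamp (real B) (g n x)) \<longlonglongrightarrow> clamp (real B) (\<psi> x)"
        using lim unfolding clamp_def by (intro tendsto_intros) (auto simp: space_restrict_space)
      then show "(\<lambda>n. h n x) \<longlonglongrightarrow> \<psi> x" by (simp add: h_def \<psi>_def clamp_def)
    qed
    show "AE x in ?M. norm (h n x) \<le> real B" for n
      using clamp[of "real B"] by (intro AE_I2) (simp add: h_def)
  qed measurable
  from order_tendstoD(2)[OF this, of "ennreal (e / 2)"] e
  have "\<forall>\<^sub>F n in sequentially. (\<integral>\<^sup>+x. norm (\<psi> x - h n x) \<partial>?M) < ennreal (e / 2)"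
    by simp
  then obtain n where n: "(\<integral>\<^sup>+x. \<bar>\<psi> x - h n x\<bar> \<partial>?M) < ennreal (e / 2)"
    by (auto simp: eventually_sequentially)
  show thesis
  proof (rule that[OF conth[of n]])
    interpret finite_measure ?M by fact
    show "integrable ?M (h n)"
      by (rule integrable_const_bound[where B="real B"]) (use clamp hmeas[of n] in \<open>auto simp: h_def\<close>)
    have "(\<integral>\<^sup>+x. \<bar>\<phi> x - h n x\<bar> \<partial>?M) \<le> (\<integral>\<^sup>+x. ennreal \<bar>\<phi> x - \<psi> x\<bar> + ennreal \<bar>\<psi> x - h n x\<bar> \<partial>?M)"
      by (intro nn_integral_mono) (simp add: ennreal_plus[symmetric] ennreal_leI del: ennreal_plus)
    also have "\<dots> = (\<integral>\<^sup>+x. ennreal \<bar>\<phi> x - \<psi> x\<bar> \<partial>?M) + (\<integral>\<^sup>+x. ennreal \<bar>\<psi> x - h n x\<bar> \<partial>?M)"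
      by (intro nn_integral_add) auto
    also have "\<dots> < ennreal (e / 2) + ennreal (e / 2)"
      using B n unfolding \<psi>_def[symmetric] by (rule add_strict_mono)
    also have "\<dots> = ennreal e" using e by (simp add: ennreal_plus[symmetric] del: ennreal_plus)
    finally show "(\<integral>\<^sup>+x. \<bar>\<phi> x - h n x\<bar> \<partial>?M) < ennreal e" .
  qed
qed

lemma nn_integral_lebesgue_on_ball_le:
  fixes x :: "'a::euclidean_space"
  assumes "S \<in> sets lebesgue" "r \<ge> 0"
  shows "(\<integral>\<^sup>+y. of_bool (dist x y < r) \<partial>lebesgue_on S) \<le> ennreal (unit_ball_vol DIM('a) * r ^ DIM('a))"
proof -
  have "(\<integral>\<^sup>+y. of_bool (dist x y < r) \<partial>lebesgue_on S) = (\<integral>\<^sup>+y. indicator (ball x r) y * indicator S y \<partial>lebesgue)"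
    using assms by (subst nn_integral_restrict_space) (auto simp: indicator_def intro!: nn_integral_cong)
  also have "\<dots> \<le> (\<integral>\<^sup>+y. indicator (ball x r) y \<partial>lebesgue)"
    by (intro nn_integral_mono) (auto simp: indicator_def)
  also have "\<dots> = ennreal (unit_ball_vol DIM('a) * r ^ DIM('a))"
    using assms by (simp add: emeasure_ball)
  finally show ?thesis .
qed

lemma measurable_dist_lebesgue_on [measurable]:
  "(\<lambda>(x, y). dist x y) \<in> borel_measurable (lebesgue_on S \<Otimes>\<^sub>M lebesgue_on S)" for S :: "'a::euclidean_space set"
proof -
  note borel_measurable_lebesgue_on_id[of S, measurable]
  have "(\<lambda>p. dist (fst p) (snd p)) \<in> borel_measurable (lebesgue_on S \<Otimes>\<^sub>M lebesgue_on S)"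
    by (intro borel_measurable_dist measurable_compose[OF measurable_fst] measurable_compose[OF measurable_snd] borel_measurable_lebesgue_on_id)
  then show ?thesis by (simp add: split_beta)
qed

text \<open>An integrated form of the Lebesgue point property. A continuous approximation oscillates
  little by uniform continuity on the closure; its distance to \<open>\<phi>\<close> is weighted by
  the volume of a ball, after exchanging integrals for the term in \<open>y\<close>.\<close>

lemma local_oscillation_tendsto_0:
  fixes \<phi> :: "'a::euclidean_space \<Rightarrow> real"
  assumes S: "open S" "bounded S" and \<phi>: "integrable (lebesgue_on S) \<phi>" and e: "e > 0"
  obtains \<delta> where "\<delta> > 0" "\<And>r. 0 < r \<Longrightarrow> r < \<delta> \<Longrightarrow>
     (\<integral>\<^sup>+x. \<integral>\<^sup>+y. ennreal (\<bar>\<phi> y - \<phi> x\<bar> * of_bool (dist x y < r)) \<partial>lebesgue_on S \<partial>lebesgue_on S) \<le> ennreal (e * r ^ DIM('a))"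
proof -
  let ?M = "lebesgue_on S" and ?\<omega> = "unit_ball_vol (real DIM('a))"
  have Sl: "S \<in> sets lebesgue" "S \<in> lmeasurable" using S by (auto simp: bounded_set_imp_lmeasurable)
  interpret finite_measure ?M using Sl by (intro finite_measure_lebesgue_on)
  interpret pair_sigma_finite ?M ?M ..
  have \<omega>: "?\<omega> > 0" by simp
  \<comment> \<open>Each of the two approximation errors costs
    \<open>e' * ?\<omega> * r ^ DIM('a)\<close>, and the uniform oscillation costs the same times
    the measure of \<open>S\<close>; hence the factor \<open>2 + measure ?M S\<close>.\<close>
  define e' where "e' = e / (?\<omega> * (2 + measure ?M S))"
  have e': "e' > 0" using e \<omega> by (auto simp: e'_def intro!: divide_pos_pos mult_pos_pos add_pos_nonneg)
  obtain h where h: "continuous_on UNIV h" "integrable ?M h" and hd: "(\<integral>\<^sup>+x. \<bar>\<phi> x - h x\<bar> \<partial>?M) < ennreal e'"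
    using approximate_integrable_continuous[OF Sl(2) \<phi> e'] by blast
  have "uniformly_continuous_on (closure S) h"
    using h continuous_on_subset S by (intro compact_uniformly_continuous) (auto simp: compact_closure)
  then obtain \<delta> where \<delta>: "\<delta> > 0" and uc: "\<And>x y. x \<in> S \<Longrightarrow> y \<in> S \<Longrightarrow> dist x y < \<delta> \<Longrightarrow> \<bar>h y - h x\<bar> < e'"
    using e' closure_subset[of S] unfolding uniformly_continuous_on_def dist_real_def by (metis subsetD dist_commute)
  have [measurable]: "\<phi> \<in> borel_measurable ?M" "h \<in> borel_measurable ?M" using \<phi> h by auto
  show thesis
  proof (rule that[OF \<delta>])
    fix r :: real assume r: "0 < r" "r < \<delta>"
    let ?b = "\<lambda>x y. of_bool (dist x y < r) :: ennreal"
    let ?v = "ennreal (?\<omega> * r ^ DIM('a))"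
    have bm[measurable]: "(\<lambda>(x, y). ?b x y) \<in> borel_measurable (?M \<Otimes>\<^sub>M ?M)"
      by measurable
    have ball: "(\<integral>\<^sup>+y. ?b x y \<partial>?M) \<le> ?v" for x
      using nn_integral_lebesgue_on_ball_le[OF Sl(1)] r by simp
    have "(\<integral>\<^sup>+x. \<integral>\<^sup>+y. ennreal (\<bar>\<phi> y - \<phi> x\<bar> * of_bool (dist x y < r)) \<partial>?M \<partial>?M)
      \<le> (\<integral>\<^sup>+x. \<integral>\<^sup>+y. ennreal \<bar>\<phi> y - h y\<bar> * ?b x y + (ennreal e' * ?b x y + ennreal \<bar>\<phi> x - h x\<bar> * ?b x y) \<partial>?M \<partial>?M)"
    proof (intro nn_integral_mono)
      fix x y assume "x \<in> space ?M" "y \<in> space ?M"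
      then have "x \<in> S" "y \<in> S" by (auto simp: space_restrict_space)
      then have "\<bar>h y - h x\<bar> < e'" if "dist x y < r" using uc that r by auto
      then show "ennreal (\<bar>\<phi> y - \<phi> x\<bar> * of_bool (dist x y < r)) \<le> ennreal \<bar>\<phi> y - h y\<bar> * ?b x y + (ennreal e' * ?b x y + ennreal \<bar>\<phi> x - h x\<bar> * ?b x y)"
        using e' by (auto simp: ennreal_plus[symmetric] simp del: ennreal_plus intro!: ennreal_leI)
    qed
    also have "\<dots> = (\<integral>\<^sup>+x. (\<integral>\<^sup>+y. ennreal \<bar>\<phi> y - h y\<bar> * ?b x y \<partial>?M)
        + (ennreal e' * (\<integral>\<^sup>+y. ?b x y \<partial>?M) + ennreal \<bar>\<phi> x - h x\<bar> * (\<integral>\<^sup>+y. ?b x y \<partial>?M)) \<partial>?M)"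
      by (intro nn_integral_cong) (simp add: nn_integral_add nn_integral_cmult)
    also have "\<dots> = (\<integral>\<^sup>+x. \<integral>\<^sup>+y. ennreal \<bar>\<phi> y - h y\<bar> * ?b x y \<partial>?M \<partial>?M)
        + (ennreal e' * (\<integral>\<^sup>+x. \<integral>\<^sup>+y. ?b x y \<partial>?M \<partial>?M) + (\<integral>\<^sup>+x. ennreal \<bar>\<phi> x - h x\<bar> * (\<integral>\<^sup>+y. ?b x y \<partial>?M) \<partial>?M))"
      by (subst nn_integral_add, measurable)+ (simp add: nn_integral_cmult)
    also have "\<dots> \<le> ennreal e' * ?v + (ennreal e' * (?v * ennreal (measure ?M S)) + ennreal e' * ?v)"
    proof (intro add_mono mult_left_mono)
      have *: "(\<integral>\<^sup>+x. ennreal \<bar>\<phi> x - h x\<bar> * (\<integral>\<^sup>+y. ?b x y \<partial>?M) \<partial>?M) \<le> ennreal e' * ?v"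
      proof -
        have "(\<integral>\<^sup>+x. ennreal \<bar>\<phi> x - h x\<bar> * (\<integral>\<^sup>+y. ?b x y \<partial>?M) \<partial>?M) \<le> (\<integral>\<^sup>+x. ennreal \<bar>\<phi> x - h x\<bar> * ?v \<partial>?M)"
          using ball by (intro nn_integral_mono mult_left_mono) auto
        also have "\<dots> = (\<integral>\<^sup>+x. ennreal \<bar>\<phi> x - h x\<bar> \<partial>?M) * ?v"
          by (intro nn_integral_multc) simp
        also have "\<dots> \<le> ennreal e' * ?v" using hd by (intro mult_right_mono) auto
        finally show ?thesis .
      qed
      then show "(\<integral>\<^sup>+x. ennreal \<bar>\<phi> x - h x\<bar> * (\<integral>\<^sup>+y. ?b x y \<partial>?M) \<partial>?M) \<le> ennreal e' * ?v" .
      have "(\<integral>\<^sup>+x. \<integral>\<^sup>+y. ennreal \<bar>\<phi> y - h y\<bar> * ?b x y \<partial>?M \<partial>?M) = (\<integral>\<^sup>+y. \<integral>\<^sup>+x. ennreal \<bar>\<phi> y - h y\<bar> * ?b x y \<partial>?M \<partial>?M)"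
        by (subst Fubini') auto
      also have "\<dots> = (\<integral>\<^sup>+y. ennreal \<bar>\<phi> y - h y\<bar> * (\<integral>\<^sup>+x. ?b y x \<partial>?M) \<partial>?M)"
        by (intro nn_integral_cong) (simp add: nn_integral_cmult dist_commute)
      also note *
      finally show "(\<integral>\<^sup>+x. \<integral>\<^sup>+y. ennreal \<bar>\<phi> y - h y\<bar> * ?b x y \<partial>?M \<partial>?M) \<le> ennreal e' * ?v" .
      have "(\<integral>\<^sup>+x. \<integral>\<^sup>+y. ?b x y \<partial>?M \<partial>?M) \<le> (\<integral>\<^sup>+x. ?v \<partial>?M)"
        using ball by (intro nn_integral_mono) auto
      also have "\<dots> = ?v * ennreal (measure ?M S)"
        by (simp add: emeasure_eq_measure space_restrict_space)
      finally show "(\<integral>\<^sup>+x. \<integral>\<^sup>+y. ?b x y \<partial>?M \<partial>?M) \<le> ?v * ennreal (measure ?M S)" .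
    qed auto
    also have "\<dots> = ennreal (e' * (?\<omega> * (2 + measure ?M S)) * r ^ DIM('a))"
      using e' r \<omega> by (simp add: ennreal_mult[symmetric] ennreal_plus[symmetric] algebra_simps del: ennreal_plus)
    also have "e' * (?\<omega> * (2 + measure ?M S)) = e"
      using less_imp_neq[OF \<omega>] measure_nonneg[of ?M S] by (simp add: e'_def add_nonneg_eq_0_iff)
    finally show "(\<integral>\<^sup>+x. \<integral>\<^sup>+y. ennreal (\<bar>\<phi> y - \<phi> x\<bar> * of_bool (dist x y < r)) \<partial>?M \<partial>?M) \<le> ennreal (e * r ^ DIM('a))" .
  qed
qed

lemma sum_halves_le:
  fixes t :: real
  assumes "t \<ge> 0"
  shows "(\<Sum>k\<in>{n..<N}. t / 2 ^ k) \<le> 2 * (t / 2 ^ n)"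
proof (cases "n \<le> N")
  case True
  then have "(\<Sum>k\<in>{n..<N}. t / 2 ^ k) = 2 * (t / 2 ^ n) - 2 * (t / 2 ^ N)"
    by (induction N rule: dec_induct) simp_all
  then show ?thesis using assms by simp
qed (use assms in simp)

text \<open>
  The sum over scales is a dyadic version of the Riesz kernel \<open>\<bar>x - y\<bar>\<^sup>1\<^sup>-\<^sup>d\<close>, cut at an arbitrary
  scale \<open>t / 2 ^ n\<close>: the smaller scales go into the first Schur test, the larger ones into the second.
\<close>

lemma potential_bound:
  fixes u g :: "'a::euclidean_space \<Rightarrow> real" and S :: "'a set"
  defines "M \<equiv> lebesgue_on S"
  defines "c \<equiv> 1 + 4 * unit_ball_vol (real DIM('a)) * 3 ^ DIM('a)"
  assumes d: "DIM('a) \<ge> 2" and S: "open S" "bounded S"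
    and [measurable]: "u \<in> borel_measurable M" "g \<in> borel_measurable M"
    and nonneg: "\<And>x. 0 \<le> u x" "\<And>x. 0 \<le> g x"
    and um: "AE x in M. u x \<le> m" and u: "(\<integral>\<^sup>+x. u x \<partial>M) \<le> ennreal F" and g: "(\<integral>\<^sup>+x. (g x)\<^sup>2 \<partial>M) \<le> 1"
    and pos: "0 < m" "0 < F" "0 < t"
  shows "(\<integral>\<^sup>+x. \<integral>\<^sup>+y. ennreal (u x * (g y * (\<Sum>k<N. 1 / (t / 2 ^ k) ^ (DIM('a) - 1) * of_bool (dist x y < 3 * (t / 2 ^ k))))) \<partial>M \<partial>M)
    \<le> ennreal (c * (t / 2 ^ n * sqrt (m * F) + F * sqrt (1 + (\<Sum>k<n. 1 / (t / 2 ^ k) ^ (DIM('a) - 2)))))"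
proof -
  define \<omega> where "\<omega> = unit_ball_vol (real DIM('a))"
  have \<omega>: "\<omega> > 0" by (simp add: \<omega>_def)
  define \<tau> where "\<tau> k = t / 2 ^ k" for k :: nat
  have \<tau>: "\<tau> k > 0" for k using pos by (simp add: \<tau>_def)
  define w where "w k = 1 / \<tau> k ^ (DIM('a) - 1)" for k
  have w: "w k > 0" for k using \<tau> by (simp add: w_def)
  define K where "K I x y = (\<Sum>k\<in>I. w k * of_bool (dist x y < 3 * \<tau> k))" for I and x y :: 'a
  have Sl: "S \<in> sets lebesgue" "S \<in> lmeasurable" using S by (auto simp: bounded_set_imp_lmeasurable)
  interpret finite_measure M using Sl unfolding M_def by (intro finite_measure_lebesgue_on)
  have sf: "sigma_finite_measure M" ..
  interpret pair_sigma_finite M M ..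
  have [measurable]: "(\<lambda>(x, y). dist x y) \<in> borel_measurable (M \<Otimes>\<^sub>M M)"
    unfolding M_def by measurable
  have Km[measurable]: "(\<lambda>(x, y). K I x y) \<in> borel_measurable (M \<Otimes>\<^sub>M M)" for I
    unfolding K_def by measurable
  have K0: "0 \<le> K I x y" for I x y unfolding K_def using w by (intro sum_nonneg) (auto simp: less_imp_le)
  have ball: "(\<integral>\<^sup>+y. of_bool (dist x y < 3 * \<tau> k) \<partial>M) \<le> ennreal (\<omega> * (3 * \<tau> k) ^ DIM('a))" for x k
    using nn_integral_lebesgue_on_ball_le[OF Sl(1), of "3 * \<tau> k" x] \<tau>[of k] by (simp add: \<omega>_def M_def)
  have sumball: "(\<integral>\<^sup>+y. ennreal (\<Sum>k\<in>I. v k * of_bool (dist x y < 3 * \<tau> k)) \<partial>M) \<le> ennreal (\<Sum>k\<in>I. v k * (\<omega> * (3 * \<tau> k) ^ DIM('a)))"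
    if v: "\<And>k. v k \<ge> 0" and x: "x \<in> space M" for I v x
  proof -
    have "(\<integral>\<^sup>+y. ennreal (\<Sum>k\<in>I. v k * of_bool (dist x y < 3 * \<tau> k)) \<partial>M) = (\<integral>\<^sup>+y. (\<Sum>k\<in>I. ennreal (v k) * of_bool (dist x y < 3 * \<tau> k)) \<partial>M)"
      using v by (intro nn_integral_cong) (auto simp: sum_ennreal[symmetric] ennreal_mult of_bool_def intro!: sum.cong)
    also have "\<dots> = (\<Sum>k\<in>I. ennreal (v k) * (\<integral>\<^sup>+y. of_bool (dist x y < 3 * \<tau> k) \<partial>M))"
      using x by (subst nn_integral_sum) (auto intro!: sum.cong nn_integral_cmult)
    also have "\<dots> \<le> (\<Sum>k\<in>I. ennreal (v k) * ennreal (\<omega> * (3 * \<tau> k) ^ DIM('a)))"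
      using ball by (intro sum_mono mult_left_mono) auto
    also have "\<dots> = ennreal (\<Sum>k\<in>I. v k * (\<omega> * (3 * \<tau> k) ^ DIM('a)))"
      using v \<omega> less_imp_le[OF \<tau>] by (subst sum_ennreal[symmetric]) (auto simp: ennreal_mult intro!: sum.cong)
    finally show ?thesis .
  qed
  have KI: "(\<integral>\<^sup>+y. ennreal (K {n..<N} x y) \<partial>M) \<le> ennreal (2 * \<omega> * 3 ^ DIM('a) * \<tau> n)" if "x \<in> space M" for x
  proof -
    have "(\<integral>\<^sup>+y. ennreal (K {n..<N} x y) \<partial>M) \<le> ennreal (\<Sum>k\<in>{n..<N}. w k * (\<omega> * (3 * \<tau> k) ^ DIM('a)))"
      unfolding K_def using w that by (intro sumball) (auto simp: less_imp_le)
    \<comment> \<open>The weight times the volume of the ball is proportional to the scale itself,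
      so the sum is comparable to its largest scale, uniformly in \<open>N\<close>.\<close>
    also have "(\<Sum>k\<in>{n..<N}. w k * (\<omega> * (3 * \<tau> k) ^ DIM('a))) = (\<Sum>k\<in>{n..<N}. \<omega> * 3 ^ DIM('a) * \<tau> k)"
    proof (rule sum.cong)
      fix k
      have "\<tau> k ^ DIM('a) = \<tau> k ^ (DIM('a) - 1) * \<tau> k" using power_minus_mult[of "DIM('a)" "\<tau> k"] by simp
      then show "w k * (\<omega> * (3 * \<tau> k) ^ DIM('a)) = \<omega> * 3 ^ DIM('a) * \<tau> k"
        using \<tau>[of k] by (simp add: w_def power_mult_distrib)
    qed simp
    also have "\<dots> = \<omega> * 3 ^ DIM('a) * (\<Sum>k\<in>{n..<N}. \<tau> k)" by (simp add: sum_distrib_left)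
    also have "\<dots> \<le> \<omega> * 3 ^ DIM('a) * (2 * \<tau> n)"
      using \<omega> sum_halves_le[of t n N] pos unfolding \<tau>_def by (intro mult_left_mono) auto
    finally show ?thesis by (simp add: mult_ac ennreal_leI)
  qed
  \<comment> \<open>The kernel depends on the distance only, so one bound serves for integration in
    either variable.\<close>
  have small: "(\<integral>\<^sup>+x. \<integral>\<^sup>+y. ennreal (u x * (g y * K {n..<N} x y)) \<partial>M \<partial>M) \<le> ennreal ((2 * \<omega> * 3 ^ DIM('a) * \<tau> n) * sqrt (m * F))"
  proof (rule schur_test[OF sf _ _ Km nonneg K0 um u g _ KI])
    show "(\<integral>\<^sup>+x. ennreal (K {n..<N} x y) \<partial>M) \<le> ennreal (2 * \<omega> * 3 ^ DIM('a) * \<tau> n)" if "y \<in> space M" for y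
      using KI[OF that] by (simp add: K_def dist_commute)
  qed (use pos \<omega> \<tau>[of n] in auto)
  let ?\<Sigma> = "\<Sum>k<n. 1 / \<tau> k ^ (DIM('a) - 2)"
  have \<Sigma>0: "?\<Sigma> \<ge> 0" using less_imp_le[OF \<tau>] by (intro sum_nonneg) auto
  have K2: "(\<integral>\<^sup>+y. ennreal ((K {..<n} x y)\<^sup>2) \<partial>M) \<le> ennreal (4 * \<omega> * 3 ^ DIM('a) * (1 + ?\<Sigma>))" if "x \<in> space M" for x
  proof -
    have wk: "w k = 1 / t ^ (DIM('a) - 1) * (2 ^ (DIM('a) - 1)) ^ k" for k
      by (simp add: w_def \<tau>_def power_divide power_mult[symmetric] mult.commute)
    \<comment> \<open>The weights grow with ratio \<open>2 ^ (DIM('a) - 1)\<close>, at least two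
      because the dimension is at least two, while the balls shrink; the geometric square estimate
      applies.\<close>
    have "2 ^ 1 \<le> (2::real) ^ (DIM('a) - 1)" using d by (intro power_increasing) auto
    then have "(K {..<n} x y)\<^sup>2 \<le> 4 * (\<Sum>k<n. (w k)\<^sup>2 * of_bool (dist x y < 3 * \<tau> k))" for y
      unfolding K_def wk using pos
      by (intro sum_geometric_square_le) (auto simp: \<tau>_def field_simps)
    then have "(\<integral>\<^sup>+y. ennreal ((K {..<n} x y)\<^sup>2) \<partial>M) \<le> (\<integral>\<^sup>+y. ennreal (\<Sum>k<n. (4 * (w k)\<^sup>2) * of_bool (dist x y < 3 * \<tau> k)) \<partial>M)"
      by (intro nn_integral_mono ennreal_leI) (simp only: sum_distrib_left mult.assoc)
    also have "\<dots> \<le> ennreal (\<Sum>k<n. 4 * (w k)\<^sup>2 * (\<omega> * (3 * \<tau> k) ^ DIM('a)))"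
      using that by (intro sumball) auto
    \<comment> \<open>The squared weight times the volume scales with exponent \<open>2 - d\<close>;
      in dimension two every scale contributes the same amount.\<close>
    also have "(\<Sum>k<n. 4 * (w k)\<^sup>2 * (\<omega> * (3 * \<tau> k) ^ DIM('a))) = (\<Sum>k<n. 4 * \<omega> * 3 ^ DIM('a) * (1 / \<tau> k ^ (DIM('a) - 2)))"
    proof (rule sum.cong)
      fix k
      have "DIM('a) + (DIM('a) - 2) = (DIM('a) - 1) + (DIM('a) - 1)" using d by linarith
      then have "\<tau> k ^ DIM('a) * \<tau> k ^ (DIM('a) - 2) = (\<tau> k ^ (DIM('a) - 1))\<^sup>2"
        unfolding power_add[symmetric] power2_eq_square by simp
      then show "4 * (w k)\<^sup>2 * (\<omega> * (3 * \<tau> k) ^ DIM('a)) = 4 * \<omega> * 3 ^ DIM('a) * (1 / \<tau> k ^ (DIM('a) - 2))"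
        using \<tau>[of k] by (simp add: w_def power_mult_distrib power_divide field_simps)
    qed simp
    also have "\<dots> = 4 * \<omega> * 3 ^ DIM('a) * ?\<Sigma>" by (simp add: sum_distrib_left)
    \<comment> \<open>The added \<open>1\<close> keeps the bound positive even for
      \<open>n = 0\<close>, as the square Schur test requires.\<close>
    also have "\<dots> \<le> 4 * \<omega> * 3 ^ DIM('a) * (1 + ?\<Sigma>)" using \<omega> by (intro mult_left_mono) auto
    finally show ?thesis by (simp add: ennreal_leI)
  qed
  have big: "(\<integral>\<^sup>+x. \<integral>\<^sup>+y. ennreal (u x * (g y * K {..<n} x y)) \<partial>M \<partial>M) \<le> ennreal (F * sqrt (4 * \<omega> * 3 ^ DIM('a) * (1 + ?\<Sigma>)))"
    using pos \<omega> \<Sigma>0 by (intro schur_test_square[OF sf _ _ Km nonneg K0 u g K2]) (auto intro!: mult_pos_pos add_pos_nonneg)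
  have "(\<integral>\<^sup>+x. \<integral>\<^sup>+y. ennreal (u x * (g y * K {..<N} x y)) \<partial>M \<partial>M)
    \<le> (\<integral>\<^sup>+x. \<integral>\<^sup>+y. ennreal (u x * (g y * K {n..<N} x y)) + ennreal (u x * (g y * K {..<n} x y)) \<partial>M \<partial>M)"
  proof (intro nn_integral_mono)
    fix x y
    \<comment> \<open>Only an inequality, since the cutoff \<open>n\<close> may exceed
      \<open>N\<close>.\<close>
    have "K {..<N} x y \<le> K ({n..<N} \<union> {..<n}) x y"
      unfolding K_def using w by (intro sum_mono2) (auto simp: less_imp_le)
    also have "\<dots> = K {n..<N} x y + K {..<n} x y"
      unfolding K_def by (intro sum.union_disjoint) auto
    finally have "u x * (g y * K {..<N} x y) \<le> u x * (g y * (K {n..<N} x y + K {..<n} x y))"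
      using nonneg by (intro mult_left_mono) auto
    then have "ennreal (u x * (g y * K {..<N} x y)) \<le> ennreal (u x * (g y * K {n..<N} x y) + u x * (g y * K {..<n} x y))"
      by (intro ennreal_leI) (simp add: distrib_left)
    also have "\<dots> = ennreal (u x * (g y * K {n..<N} x y)) + ennreal (u x * (g y * K {..<n} x y))"
      using nonneg K0 by (intro ennreal_plus mult_nonneg_nonneg) auto
    finally show "ennreal (u x * (g y * K {..<N} x y)) \<le> ennreal (u x * (g y * K {n..<N} x y)) + ennreal (u x * (g y * K {..<n} x y))" .
  qed
  also have "\<dots> = (\<integral>\<^sup>+x. (\<integral>\<^sup>+y. ennreal (u x * (g y * K {n..<N} x y)) \<partial>M) + (\<integral>\<^sup>+y. ennreal (u x * (g y * K {..<n} x y)) \<partial>M) \<partial>M)"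
    by (intro nn_integral_cong nn_integral_add) measurable
  also have "\<dots> = (\<integral>\<^sup>+x. \<integral>\<^sup>+y. ennreal (u x * (g y * K {n..<N} x y)) \<partial>M \<partial>M) + (\<integral>\<^sup>+x. \<integral>\<^sup>+y. ennreal (u x * (g y * K {..<n} x y)) \<partial>M \<partial>M)"
    by (intro nn_integral_add) measurable
  also have "\<dots> \<le> ennreal ((2 * \<omega> * 3 ^ DIM('a) * \<tau> n) * sqrt (m * F)) + ennreal (F * sqrt (4 * \<omega> * 3 ^ DIM('a) * (1 + ?\<Sigma>)))"
    by (intro add_mono small big)
  also have "\<dots> = ennreal ((2 * \<omega> * 3 ^ DIM('a) * \<tau> n) * sqrt (m * F) + F * sqrt (4 * \<omega> * 3 ^ DIM('a) * (1 + ?\<Sigma>)))"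
    using pos \<omega> \<Sigma>0 \<tau>[of n] by (subst ennreal_plus) auto
  also have "\<dots> \<le> ennreal (c * (\<tau> n * sqrt (m * F)) + c * (F * sqrt (1 + ?\<Sigma>)))"
  proof (intro ennreal_leI add_mono)
    have c: "c = 1 + 4 * \<omega> * 3 ^ DIM('a)" by (simp add: c_def \<omega>_def)
    have "2 * \<omega> * 3 ^ DIM('a) \<le> c" using \<omega> by (simp add: c)
    then show "2 * \<omega> * 3 ^ DIM('a) * \<tau> n * sqrt (m * F) \<le> c * (\<tau> n * sqrt (m * F))"
      using pos \<tau>[of n] mult_right_mono[of "2 * \<omega> * 3 ^ DIM('a)" c "\<tau> n * sqrt (m * F)"] by (simp add: mult.assoc)
    have c1: "c \<ge> 1" using \<omega> by (simp add: c)
    \<comment> \<open>The summand \<open>1\<close> in \<open>c\<close> ensures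
      \<open>c \<le> c\<^sup>2\<close>, so that \<open>c\<close> also dominates the square root of
      the volume constant.\<close>
    have "sqrt (4 * \<omega> * 3 ^ DIM('a)) \<le> sqrt (c\<^sup>2)"
      using \<omega> c1 self_le_power[of c 2] by (intro real_sqrt_le_mono) (simp add: c)
    then have "sqrt (4 * \<omega> * 3 ^ DIM('a)) \<le> c" using c1 by simp
    then have "F * (sqrt (4 * \<omega> * 3 ^ DIM('a)) * sqrt (1 + ?\<Sigma>)) \<le> F * (c * sqrt (1 + ?\<Sigma>))"
      using pos \<Sigma>0 by (intro mult_left_mono mult_right_mono) auto
    then show "F * sqrt (4 * \<omega> * 3 ^ DIM('a) * (1 + ?\<Sigma>)) \<le> c * (F * sqrt (1 + ?\<Sigma>))"
      by (simp add: real_sqrt_mult mult_ac)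
  qed
  finally show ?thesis
    unfolding K_def w_def \<tau>_def by (simp add: distrib_left)
qed

section \<open>Telescoping averages along cones\<close>

text \<open>Averages centred at \<open>x + t *\<^sub>R e x\<close> are integrated in
  \<open>x\<close>, so \<open>e\<close> has to be measurable. A choice by cases over finitely many
  balls is piecewise constant on Borel sets.\<close>

lemma measurable_cone_direction:
  fixes D :: "('a::euclidean_space \<times> real \<times> 'a) set"
  assumes "finite D"
  obtains e where "e \<in> borel_measurable borel"
    "\<And>x. x \<in> (\<Union>(p, s, v)\<in>D. ball p s) \<Longrightarrow> \<exists>p s. (p, s, e x) \<in> D \<and> x \<in> ball p s"
proof -
  have "\<exists>e. e \<in> borel_measurable borel \<and> (\<forall>x\<in>(\<Union>(p, s, v)\<in>D. ball p s). \<exists>p s. (p, s, e x) \<in> D \<and> x \<in> ball p s)"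
    using assms
  proof (induction D)
    case empty
    show ?case by (intro exI[of _ "\<lambda>x. 0"]) auto
  next
    case (insert a D)
    obtain p s v where a: "a = (p, s, v)" by (cases a)
    obtain e where e: "e \<in> borel_measurable borel" "\<forall>x\<in>(\<Union>(p, s, v)\<in>D. ball p s). \<exists>p s. (p, s, e x) \<in> D \<and> x \<in> ball p s"
      using insert.IH by blast
    show ?case
    proof (intro exI[of _ "\<lambda>x. if x \<in> ball p s then v else e x"] conjI ballI)
      show "(\<lambda>x. if x \<in> ball p s then v else e x) \<in> borel_measurable borel"
        using e(1) by (intro measurable_If_set) auto
      fix x assume "x \<in> (\<Union>(p, s, v)\<in>insert a D. ball p s)"
      then show "\<exists>p' s'. (p', s', if x \<in> ball p s then v else e x) \<in> insert a D \<and> x \<in> ball p' s'"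
        using e(2) unfolding a by (cases "x \<in> ball p s") (auto simp del: mem_ball, blast+)
    qed
  qed
  then show thesis using that by blast
qed

lemma lipschitz_boundary_cone_field:
  fixes \<Omega> :: "'a::euclidean_space set"
  assumes "open \<Omega>" "bounded \<Omega>" "lipschitz_boundary \<Omega>"
  obtains \<kappa> t0 e where "0 < \<kappa>" "\<kappa> \<le> 1" "0 < t0" "e \<in> borel_measurable borel"
    "\<And>x. x \<in> \<Omega> \<Longrightarrow> norm (e x) \<le> 1"
    "\<And>x t. x \<in> \<Omega> \<Longrightarrow> 0 < t \<Longrightarrow> t \<le> t0 \<Longrightarrow> cball (x + t *\<^sub>R e x) (\<kappa> * t) \<subseteq> \<Omega>"
proof (rule lipschitz_boundary_cone[OF assms])
  fix \<kappa> t0 and D :: "('a \<times> real \<times> 'a) set"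
  assume D: "finite D" "0 < \<kappa>" "\<kappa> \<le> 1" "0 < t0" "\<Omega> \<subseteq> (\<Union>(p, s, e)\<in>D. ball p s)"
    and cone: "\<And>p s e x t. (p, s, e) \<in> D \<Longrightarrow> x \<in> \<Omega> \<Longrightarrow> x \<in> ball p s \<Longrightarrow> 0 < t \<Longrightarrow> t \<le> t0 \<Longrightarrow>
        norm e \<le> 1 \<and> cball (x + t *\<^sub>R e) (\<kappa> * t) \<subseteq> \<Omega>"
  obtain e where e: "e \<in> borel_measurable borel"
    "\<And>x. x \<in> (\<Union>(p, s, v)\<in>D. ball p s) \<Longrightarrow> \<exists>p s. (p, s, e x) \<in> D \<and> x \<in> ball p s"
    by (rule measurable_cone_direction[OF D(1)]) blast
  have *: "norm (e x) \<le> 1 \<and> cball (x + t *\<^sub>R e x) (\<kappa> * t) \<subseteq> \<Omega>" if x: "x \<in> \<Omega>" and t: "0 < t" "t \<le> t0" for x t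
  proof -
    have "x \<in> (\<Union>(p, s, v)\<in>D. ball p s)" using D(5) x by (rule subsetD)
    then obtain p s where "(p, s, e x) \<in> D" "x \<in> ball p s" using e(2) by blast
    then show ?thesis using cone x t by simp
  qed
  show thesis
  proof (rule that[of \<kappa> t0 e])
    show "norm (e x) \<le> 1" if "x \<in> \<Omega>" for x
      using *[OF that D(4)] by simp
    show "cball (x + t *\<^sub>R e x) (\<kappa> * t) \<subseteq> \<Omega>" if "x \<in> \<Omega>" "0 < t" "t \<le> t0" for x t
      using *[OF that] by simp
  qed (use D(2-4) e(1) in simp_all)
qed

text \<open>Points of the small ball are within \<open>r + \<kappa> * r \<le> 2 * r\<close> of
  \<open>x\<close>; the factor three gives strict inclusion in an open ball.\<close>

lemma cone_ball_subset:
  fixes x e :: "'a::real_normed_vector"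
  assumes "0 < r" "0 < \<kappa>" "\<kappa> \<le> 1" "norm e \<le> 1"
  shows "cball (x + r *\<^sub>R e) (\<kappa> * r) \<subseteq> ball x (3 * r)"
proof
  fix z assume z: "z \<in> cball (x + r *\<^sub>R e) (\<kappa> * r)"
  have "dist x z \<le> dist x (x + r *\<^sub>R e) + dist (x + r *\<^sub>R e) z" by (rule dist_triangle)
  also have "dist x (x + r *\<^sub>R e) = r * norm e" using assms by (simp add: dist_norm)
  also have "r * norm e \<le> r" using mult_left_mono[of "norm e" 1 r] assms by simp
  also have "dist (x + r *\<^sub>R e) z \<le> \<kappa> * r" using z by simp
  also have "\<kappa> * r \<le> r" using assms by simp
  finally show "z \<in> ball x (3 * r)" using assms by simp
qed

lemma integrable_norm_mult_of_bool_dist: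
  fixes G :: "'a::euclidean_space \<Rightarrow> 'b::euclidean_space"
  assumes "integrable (lebesgue_on S) G"
  shows "integrable (lebesgue_on S) (\<lambda>y. norm (G y) * of_bool (dist x y < R))"
proof -
  have dm: "(\<lambda>y. of_bool (dist x y < R) :: real) \<in> borel_measurable (lebesgue_on S)"
    by (intro measurable_compose[OF borel_measurable_lebesgue_on_id, of "\<lambda>y. of_bool (dist x y < R)"]) measurable
  show ?thesis
    using integrable_bounded_mult[OF dm, of 1 "\<lambda>y. norm (G y)"] assms by (simp add: mult.commute)
qed

text \<open>Centre and radius move by at most \<open>t\<close> in total, and the kernel is bounded
  by a multiple of \<open>t\<close> to the power \<open>- d\<close>. The quotient is the Riesz
  weight \<open>1 / t ^ (DIM('a) - 1)\<close> at that scale.\<close>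

lemma avg_halving:
  fixes x e :: "'a::euclidean_space"
  assumes S: "open S" and W: "W11 S \<phi> G" and t: "0 < t" and \<kappa>: "0 < \<kappa>" "\<kappa> \<le> 1" and e: "norm e \<le> 1"
    and cone: "\<And>s. 0 < s \<Longrightarrow> s \<le> t \<Longrightarrow> cball (x + s *\<^sub>R e) (\<kappa> * s) \<subseteq> S"
  shows "\<bar>avg S \<phi> (x + (t / 2) *\<^sub>R e) (\<kappa> * (t / 2)) - avg S \<phi> (x + t *\<^sub>R e) (\<kappa> * t)\<bar>
     \<le> 1 / (bump_mass TYPE('a) * (\<kappa> / 2) ^ DIM('a)) * (1 / t ^ (DIM('a) - 1) * (LINT y|lebesgue_on S. norm (G y) * of_bool (dist x y < 3 * t)))"
proof -
  let ?b = "bump_mass TYPE('a)" and ?U = "S \<inter> ball x (3 * t)"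
  let ?I = "LINT y|lebesgue_on S. norm (G y) * indicator ?U y"
  have b: "?b > 0" by (rule bump_mass_pos)
  have diff: "(x + (t / 2) *\<^sub>R e) - (x + t *\<^sub>R e) = (- (t / 2)) *\<^sub>R e"
    by (simp add: scaleR_left_diff_distrib[symmetric])
  have "\<bar>avg S \<phi> (x + (t / 2) *\<^sub>R e) (\<kappa> * (t / 2)) - avg S \<phi> (x + t *\<^sub>R e) (\<kappa> * t)\<bar>
     \<le> (norm ((x + (t / 2) *\<^sub>R e) - (x + t *\<^sub>R e)) + \<bar>\<kappa> * (t / 2) - \<kappa> * t\<bar>) / (?b * (\<kappa> * (t / 2)) ^ DIM('a)) * ?I"
  proof (rule avg_diff_le)
    fix s :: real assume s: "0 \<le> s" "s \<le> 1"
    \<comment> \<open>The balls interpolating between two cone balls are themselves cone balls, at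
      intermediate height \<open>r\<close>, so the cone condition covers the whole hull.\<close>
    define r where "r = t - s * (t / 2)"
    have "s * (t / 2) \<le> 1 * (t / 2)" using s t by (intro mult_right_mono) auto
    then have r: "0 < r" "r \<le> t" using s t by (auto simp: r_def)
    have eq: "x + t *\<^sub>R e + s *\<^sub>R ((x + (t / 2) *\<^sub>R e) - (x + t *\<^sub>R e)) = x + r *\<^sub>R e"
      unfolding diff by (simp add: r_def scaleR_left_diff_distrib)
    have eq': "\<kappa> * t + s * (\<kappa> * (t / 2) - \<kappa> * t) = \<kappa> * r"
      by (simp add: r_def algebra_simps)
    have "cball (x + r *\<^sub>R e) (\<kappa> * r) \<subseteq> ball x (3 * t)"
      using cone_ball_subset[OF r(1) \<kappa> e, of x] r(2) by auto
    then show "cball (x + t *\<^sub>R e + s *\<^sub>R ((x + (t / 2) *\<^sub>R e) - (x + t *\<^sub>R e))) (\<kappa> * t + s * (\<kappa> * (t / 2) - \<kappa> * t)) \<subseteq> ?U"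
      unfolding eq eq' using cone[OF r] by blast
  qed (use S W t \<kappa> in \<open>auto simp: W11_def borel_open\<close>)
  also have "?I = (LINT y|lebesgue_on S. norm (G y) * of_bool (dist x y < 3 * t))" (is "_ = ?J")
    by (intro Bochner_Integration.integral_cong) (auto simp: space_restrict_space indicator_def)
  also have "(norm ((x + (t / 2) *\<^sub>R e) - (x + t *\<^sub>R e)) + \<bar>\<kappa> * (t / 2) - \<kappa> * t\<bar>) / (?b * (\<kappa> * (t / 2)) ^ DIM('a)) * ?J
    \<le> t / (?b * (\<kappa> * (t / 2)) ^ DIM('a)) * ?J"
  proof (intro mult_right_mono divide_right_mono)
    have "norm ((x + (t / 2) *\<^sub>R e) - (x + t *\<^sub>R e)) = t / 2 * norm e" unfolding diff using t by simp
    moreover have "t / 2 * norm e \<le> t / 2" using mult_left_mono[OF e, of "t / 2"] t by simp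
    moreover have "\<bar>\<kappa> * (t / 2) - \<kappa> * t\<bar> = \<kappa> * (t / 2)" using t \<kappa> by simp
    moreover have "\<kappa> * (t / 2) \<le> 1 * (t / 2)" using t \<kappa> by (intro mult_right_mono) auto
    ultimately show "norm ((x + (t / 2) *\<^sub>R e) - (x + t *\<^sub>R e)) + \<bar>\<kappa> * (t / 2) - \<kappa> * t\<bar> \<le> t" by linarith
  qed (use b t \<kappa> in auto)
  also have "t / (?b * (\<kappa> * (t / 2)) ^ DIM('a)) = 1 / (?b * (\<kappa> / 2) ^ DIM('a)) * (1 / t ^ (DIM('a) - 1))"
  proof -
    have "(\<kappa> * (t / 2)) ^ DIM('a) = (\<kappa> / 2) ^ DIM('a) * (t ^ (DIM('a) - 1) * t)"
      using power_minus_mult[of "DIM('a)" t] by (simp add: power_mult_distrib power_divide)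
    then show ?thesis using t by simp
  qed
  finally show ?thesis by (simp only: mult.assoc)
qed

lemma avg_telescope:
  fixes x e :: "'a::euclidean_space"
  assumes S: "open S" and W: "W11 S \<phi> G" and t: "0 < t" and \<kappa>: "0 < \<kappa>" "\<kappa> \<le> 1" and e: "norm e \<le> 1"
    and cone: "\<And>s. 0 < s \<Longrightarrow> s \<le> t \<Longrightarrow> cball (x + s *\<^sub>R e) (\<kappa> * s) \<subseteq> S"
  shows "\<bar>avg S \<phi> (x + (t / 2 ^ N) *\<^sub>R e) (\<kappa> * (t / 2 ^ N)) - avg S \<phi> (x + t *\<^sub>R e) (\<kappa> * t)\<bar>
     \<le> 1 / (bump_mass TYPE('a) * (\<kappa> / 2) ^ DIM('a)) *
        (\<Sum>k<N. 1 / (t / 2 ^ k) ^ (DIM('a) - 1) * (LINT y|lebesgue_on S. norm (G y) * of_bool (dist x y < 3 * (t / 2 ^ k))))"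
proof (induction N)
  case (Suc N)
  have "t / 2 ^ N \<le> t" using t by (simp add: field_simps)
  then have "\<bar>avg S \<phi> (x + (t / 2 ^ N / 2) *\<^sub>R e) (\<kappa> * (t / 2 ^ N / 2)) - avg S \<phi> (x + (t / 2 ^ N) *\<^sub>R e) (\<kappa> * (t / 2 ^ N))\<bar>
     \<le> 1 / (bump_mass TYPE('a) * (\<kappa> / 2) ^ DIM('a)) * (1 / (t / 2 ^ N) ^ (DIM('a) - 1) * (LINT y|lebesgue_on S. norm (G y) * of_bool (dist x y < 3 * (t / 2 ^ N))))"
    using t cone by (intro avg_halving[OF S W _ \<kappa> e]) auto
  moreover have half: "t / 2 ^ N / 2 = t / 2 ^ Suc N" by simp
  ultimately show ?case
    using Suc.IH unfolding half sum.lessThan_Suc distrib_left by linarith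
qed simp

text \<open>Unit mass of the kernel lets \<open>\<phi> x\<close> be written as an average of a
  constant. The ball of averaging need not contain \<open>x\<close>; it only has to lie in a ball
  about \<open>x\<close>, as the cone balls do.\<close>

lemma avg_minus_le:
  fixes c x :: "'a::euclidean_space"
  assumes S: "open S" and \<phi>: "integrable (lebesgue_on S) \<phi>" and fin: "S \<in> lmeasurable"
    and r: "0 < r" "cball c r \<subseteq> S" "cball c r \<subseteq> ball x R"
  shows "\<bar>avg S \<phi> c r - \<phi> x\<bar> \<le> 1 / (bump_mass TYPE('a) * r ^ DIM('a)) * (LINT y|lebesgue_on S. \<bar>\<phi> y - \<phi> x\<bar> * of_bool (dist x y < R))"
proof -
  let ?M = "lebesgue_on S" and ?b = "bump_mass TYPE('a)"
  have Sl: "S \<in> sets lebesgue" "S \<in> lmeasurable" using fin by (auto simp: fmeasurableD)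
  interpret finite_measure ?M using Sl by (intro finite_measure_lebesgue_on)
  have b: "?b > 0" by (rule bump_mass_pos)
  have km[measurable]: "kern c r \<in> borel_measurable ?M"
    using measurable_compose[OF borel_measurable_lebesgue_on_id borel_measurable_continuous_onI[OF C_times_continuous[OF C_times_kern[of 0 c r]]]] by simp
  have kb: "\<bar>kern c r y\<bar> \<le> 1 / (?b * r ^ DIM('a))" for y
    using kern_le[OF r(1), of c y] kern_nonneg[OF r(1), of c y] by simp
  have ik: "integrable ?M (\<lambda>y. kern c r y * h y)" if "integrable ?M h" for h
    by (rule integrable_bounded_mult[OF km kb that])
  have "avg S \<phi> c r - \<phi> x = (LINT y|?M. \<phi> y * kern c r y) - \<phi> x * (LINT y|?M. kern c r y)"
    using integral_kern[OF r(1,2) Sl(1)] by (simp add: avg_def)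
  also have "\<dots> = (LINT y|?M. (\<phi> y - \<phi> x) * kern c r y)"
    using ik[OF \<phi>] ik[of "\<lambda>_. 1"] unfolding left_diff_distrib
    by (subst Bochner_Integration.integral_diff) (simp_all add: mult.commute)
  also have "\<bar>\<dots>\<bar> \<le> (LINT y|?M. 1 / (?b * r ^ DIM('a)) * (\<bar>\<phi> y - \<phi> x\<bar> * of_bool (dist x y < R)))"
  proof (rule integral_abs_bound_integral)
    show "integrable ?M (\<lambda>y. (\<phi> y - \<phi> x) * kern c r y)"
      using ik[of "\<lambda>y. \<phi> y - \<phi> x"] \<phi> by (simp add: mult.commute)
    show "integrable ?M (\<lambda>y. 1 / (?b * r ^ DIM('a)) * (\<bar>\<phi> y - \<phi> x\<bar> * of_bool (dist x y < R)))"
      using integrable_norm_mult_of_bool_dist[of S "\<lambda>y. \<phi> y - \<phi> x"] \<phi> by simp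
    fix y
    show "\<bar>(\<phi> y - \<phi> x) * kern c r y\<bar> \<le> 1 / (?b * r ^ DIM('a)) * (\<bar>\<phi> y - \<phi> x\<bar> * of_bool (dist x y < R))"
    proof (cases "dist x y < R")
      case True
      then show ?thesis using mult_left_mono[OF kb[of y], of "\<bar>\<phi> y - \<phi> x\<bar>"] by (simp add: abs_mult mult.commute)
    next
      case False
      then have "y \<notin> cball c r" using r(3) by auto
      then show ?thesis using False kern_eq_0[OF r(1), of c y] by simp
    qed
  qed
  finally show ?thesis by simp
qed

lemma borel_measurable_avg:
  fixes \<phi> :: "'a::euclidean_space \<Rightarrow> real"
  assumes fin: "finite_measure (lebesgue_on S)" and \<phi>[measurable]: "\<phi> \<in> borel_measurable (lebesgue_on S)" and c: "c \<in> borel_measurable borel"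
  shows "(\<lambda>x. avg S \<phi> (c x) r) \<in> borel_measurable (lebesgue_on S)"
proof -
  interpret finite_measure "lebesgue_on S" by fact
  have "c \<in> borel_measurable (lebesgue_on S)"
    using measurable_compose[OF borel_measurable_lebesgue_on_id c] .
  then have "(\<lambda>p. c (fst p)) \<in> borel_measurable (lebesgue_on S \<Otimes>\<^sub>M lebesgue_on S)"
    by (rule measurable_compose[OF measurable_fst])
  moreover have "(\<lambda>p. snd p) \<in> borel_measurable (lebesgue_on S \<Otimes>\<^sub>M lebesgue_on S)"
    by (rule measurable_compose[OF measurable_snd borel_measurable_lebesgue_on_id])
  ultimately have k: "(\<lambda>p. kern (c (fst p)) r (snd p)) \<in> borel_measurable (lebesgue_on S \<Otimes>\<^sub>M lebesgue_on S)"
    by (rule borel_measurable_kern)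
  have "(\<lambda>p. \<phi> (snd p)) \<in> borel_measurable (lebesgue_on S \<Otimes>\<^sub>M lebesgue_on S)"
    by measurable
  from borel_measurable_times[OF this k]
  have "(\<lambda>(x, y). \<phi> y * kern (c x) r y) \<in> borel_measurable (lebesgue_on S \<Otimes>\<^sub>M lebesgue_on S)"
    by (simp add: split_beta)
  then show ?thesis unfolding avg_def by (rule borel_measurable_lebesgue_integral)
qed

text \<open>Since \<open>f\<close> is bounded, mean convergence of the averages suffices. Averaging
  off centre over radius \<open>\<kappa> * t\<close> instead of the ball of radius
  \<open>3 * t\<close> about \<open>x\<close> loses only a fixed factor, independent of the
  scale.\<close>

lemma avg_converges:
  fixes \<phi> :: "'a::euclidean_space \<Rightarrow> real"
  assumes S: "open S" "bounded S" and \<phi>: "integrable (lebesgue_on S) \<phi>"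
    and \<kappa>: "0 < \<kappa>" "\<kappa> \<le> 1" and t0: "0 < t0"
    and e: "\<And>x. x \<in> S \<Longrightarrow> norm (e x) \<le> 1"
    and cone: "\<And>x t. x \<in> S \<Longrightarrow> 0 < t \<Longrightarrow> t \<le> t0 \<Longrightarrow> cball (x + t *\<^sub>R e x) (\<kappa> * t) \<subseteq> S"
    and fm: "AE x in lebesgue_on S. \<bar>f x\<bar> \<le> m" and m: "0 < m" and \<epsilon>: "0 < \<epsilon>"
  shows "\<exists>N. (\<integral>\<^sup>+x. ennreal (\<bar>f x\<bar> * \<bar>\<phi> x - avg S \<phi> (x + (t0 / 2 ^ N) *\<^sub>R e x) (\<kappa> * (t0 / 2 ^ N))\<bar>) \<partial>lebesgue_on S) \<le> ennreal \<epsilon>"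
proof -
  let ?M = "lebesgue_on S" and ?b = "bump_mass TYPE('a)"
  have Sl: "S \<in> sets lebesgue" "S \<in> lmeasurable" using S by (auto simp: bounded_set_imp_lmeasurable)
  interpret finite_measure ?M using Sl by (intro finite_measure_lebesgue_on)
  interpret pair_sigma_finite ?M ?M ..
  have b: "?b > 0" by (rule bump_mass_pos)
  \<comment> \<open>Chosen so that \<open>m * B * (\<eta> * (3 * t) ^ DIM('a)) = \<epsilon>\<close>
    with the kernel bound \<open>B\<close> below; the powers of \<open>t\<close> cancel, so
    \<open>\<eta>\<close> can be fixed before \<open>t\<close>.\<close>
  define \<eta> where "\<eta> = \<epsilon> * (?b * \<kappa> ^ DIM('a)) / (m * 3 ^ DIM('a))"
  have \<eta>: "\<eta> > 0" using \<epsilon> b \<kappa> m by (simp add: \<eta>_def)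
  obtain \<delta> where \<delta>: "\<delta> > 0" and osc: "\<And>r. 0 < r \<Longrightarrow> r < \<delta> \<Longrightarrow>
     (\<integral>\<^sup>+x. \<integral>\<^sup>+y. ennreal (\<bar>\<phi> y - \<phi> x\<bar> * of_bool (dist x y < r)) \<partial>?M \<partial>?M) \<le> ennreal (\<eta> * r ^ DIM('a))"
    by (rule local_oscillation_tendsto_0[OF S \<phi> \<eta>]) blast
  obtain N where N: "(1 / 2) ^ N < \<delta> / (3 * t0)"
    using real_arch_pow_inv[of "\<delta> / (3 * t0)" "1 / 2"] \<delta> t0 by auto
  define t where "t = t0 / 2 ^ N"
  have t: "0 < t" "t \<le> t0" using t0 by (auto simp: t_def field_simps)
  have t\<delta>: "3 * t < \<delta>" using N t0 by (simp add: t_def power_divide field_simps)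
  define B where "B = 1 / (?b * (\<kappa> * t) ^ DIM('a))"
  have B: "B > 0" using b \<kappa> t by (simp add: B_def)
  have [measurable]: "\<phi> \<in> borel_measurable ?M" using \<phi> by simp
  have pt: "ennreal (\<bar>f x\<bar> * \<bar>\<phi> x - avg S \<phi> (x + t *\<^sub>R e x) (\<kappa> * t)\<bar>)
      \<le> ennreal (m * B) * (\<integral>\<^sup>+y. ennreal (\<bar>\<phi> y - \<phi> x\<bar> * of_bool (dist x y < 3 * t)) \<partial>?M)"
    if x: "x \<in> S" and f: "\<bar>f x\<bar> \<le> m" for x
  proof -
    let ?I = "LINT y|?M. \<bar>\<phi> y - \<phi> x\<bar> * of_bool (dist x y < 3 * t)"
    have "\<bar>avg S \<phi> (x + t *\<^sub>R e x) (\<kappa> * t) - \<phi> x\<bar> \<le> B * ?I"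
      unfolding B_def using \<kappa> t x
      by (intro avg_minus_le[OF S(1) \<phi> Sl(2)] cone cone_ball_subset e) auto
    then have "\<bar>f x\<bar> * \<bar>\<phi> x - avg S \<phi> (x + t *\<^sub>R e x) (\<kappa> * t)\<bar> \<le> m * (B * ?I)"
      using f m by (intro mult_mono) (auto simp: abs_minus_commute)
    then have "ennreal (\<bar>f x\<bar> * \<bar>\<phi> x - avg S \<phi> (x + t *\<^sub>R e x) (\<kappa> * t)\<bar>) \<le> ennreal (m * B * ?I)"
      by (intro ennreal_leI) (simp add: mult.assoc)
    also have "\<dots> = ennreal (m * B) * ennreal ?I" using m B by (intro ennreal_mult) auto
    also have "ennreal ?I = (\<integral>\<^sup>+y. ennreal (\<bar>\<phi> y - \<phi> x\<bar> * of_bool (dist x y < 3 * t)) \<partial>?M)"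
      using integrable_norm_mult_of_bool_dist[of S "\<lambda>y. \<phi> y - \<phi> x"] \<phi>
      by (intro nn_integral_eq_integral[symmetric]) auto
    finally show ?thesis .
  qed
  have "(\<integral>\<^sup>+x. ennreal (\<bar>f x\<bar> * \<bar>\<phi> x - avg S \<phi> (x + t *\<^sub>R e x) (\<kappa> * t)\<bar>) \<partial>?M)
     \<le> (\<integral>\<^sup>+x. ennreal (m * B) * (\<integral>\<^sup>+y. ennreal (\<bar>\<phi> y - \<phi> x\<bar> * of_bool (dist x y < 3 * t)) \<partial>?M) \<partial>?M)"
  proof (rule nn_integral_mono_AE)
    show "AE x in ?M. ennreal (\<bar>f x\<bar> * \<bar>\<phi> x - avg S \<phi> (x + t *\<^sub>R e x) (\<kappa> * t)\<bar>)
      \<le> ennreal (m * B) * (\<integral>\<^sup>+y. ennreal (\<bar>\<phi> y - \<phi> x\<bar> * of_bool (dist x y < 3 * t)) \<partial>?M)"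
      using fm AE_space by eventually_elim (rule pt, auto simp: space_restrict_space)
  qed
  also have "\<dots> = ennreal (m * B) * (\<integral>\<^sup>+x. \<integral>\<^sup>+y. ennreal (\<bar>\<phi> y - \<phi> x\<bar> * of_bool (dist x y < 3 * t)) \<partial>?M \<partial>?M)"
    by (intro nn_integral_cmult) measurable
  also have "\<dots> \<le> ennreal (m * B) * ennreal (\<eta> * (3 * t) ^ DIM('a))"
    using osc[of "3 * t"] t t\<delta> by (intro mult_left_mono) auto
  also have "\<dots> = ennreal (m * B * (\<eta> * (3 * t) ^ DIM('a)))"
    using m B \<eta> t by (intro ennreal_mult[symmetric]) auto
  also have "m * B * (\<eta> * (3 * t) ^ DIM('a)) = \<epsilon>"
    using m b \<kappa> t by (simp add: B_def \<eta>_def power_mult_distrib)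
  finally show ?thesis unfolding t_def by blast
qed

section \<open>The duality estimate\<close>

text \<open>The constant and the top scale \<open>t\<close> precede \<open>f\<close>,
  \<open>\<phi>\<close> and \<open>G\<close>, so they depend on the domain only. The cutoff
  \<open>n\<close> stays free, which lets one estimate serve both dimension regimes.\<close>

lemma dual_pairing_estimate:
  fixes \<Omega> :: "'a::euclidean_space set"
  assumes d: "DIM('a) \<ge> 2" and \<Omega>: "open \<Omega>" "bounded \<Omega>" "connected \<Omega>" "lipschitz_boundary \<Omega>" "\<Omega> \<noteq> {}"
  shows "\<exists>C>0. \<exists>t>0. \<forall>f \<phi> G m n. f \<in> borel_measurable (lebesgue_on \<Omega>) \<longrightarrow> (AE x in lebesgue_on \<Omega>. \<bar>f x\<bar> \<le> m) \<longrightarrow>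
     (LINT x|lebesgue_on \<Omega>. f x) = 0 \<longrightarrow> 0 < m \<longrightarrow> 0 < L1_norm \<Omega> f \<longrightarrow> W11 \<Omega> \<phi> G \<longrightarrow>
     (\<integral>\<^sup>+x. (norm (G x))\<^sup>2 \<partial>lebesgue_on \<Omega>) \<le> 1 \<longrightarrow>
     (LINT x|lebesgue_on \<Omega>. f x * \<phi> x) \<le> C * (t / 2 ^ n * sqrt (m * L1_norm \<Omega> f)
        + L1_norm \<Omega> f * sqrt (1 + (\<Sum>k<n. 1 / (t / 2 ^ k) ^ (DIM('a) - 2))))"
proof (rule lipschitz_boundary_cone_field[OF \<Omega>(1,2,4)])
  fix \<kappa> t0 :: real and e :: "'a \<Rightarrow> 'a"
  assume \<kappa>: "0 < \<kappa>" "\<kappa> \<le> 1" and t0: "0 < t0" and e_meas: "e \<in> borel_measurable borel"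
    and e: "\<And>x. x \<in> \<Omega> \<Longrightarrow> norm (e x) \<le> 1"
    and cone: "\<And>x t. x \<in> \<Omega> \<Longrightarrow> 0 < t \<Longrightarrow> t \<le> t0 \<Longrightarrow> cball (x + t *\<^sub>R e x) (\<kappa> * t) \<subseteq> \<Omega>"
  let ?M = "lebesgue_on \<Omega>"
  have \<Omega>l: "\<Omega> \<in> sets lebesgue" "\<Omega> \<in> lmeasurable" using \<Omega> by (auto simp: bounded_set_imp_lmeasurable)
  interpret finite_measure ?M using \<Omega>l by (intro finite_measure_lebesgue_on)
  obtain a where "a \<in> \<Omega>" using \<Omega>(5) by blast
  then obtain r' where r': "0 < r'" "cball a r' \<subseteq> \<Omega>"
    using \<Omega>(1) open_contains_cball by blast
  have "0 < \<kappa> * t0" using \<kappa> t0 by simp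
  then obtain Cu where Cu: "Cu \<ge> 0" and unif: "\<And>\<phi> G c. W11 \<Omega> \<phi> G \<Longrightarrow> cball c (\<kappa> * t0) \<subseteq> \<Omega> \<Longrightarrow>
           \<bar>avg \<Omega> \<phi> c (\<kappa> * t0) - avg \<Omega> \<phi> a r'\<bar> \<le> Cu * (LINT y|?M. norm (G y))"
    using avg_uniformly_comparable[OF \<Omega>(1,3,2) _ r'] by blast
  define Ct where "Ct = 1 / (bump_mass TYPE('a) * (\<kappa> / 2) ^ DIM('a))"
  have Ct: "Ct > 0" using bump_mass_pos[where 'a='a] \<kappa> by (simp add: Ct_def)
  define c where "c = 1 + 4 * unit_ball_vol (real DIM('a)) * 3 ^ DIM('a)"
  have c: "c \<ge> 1" by (simp add: c_def)
  \<comment> \<open>From \<open>norm (G y) \<le> 1 / 2 + (norm (G y))\<^sup>2 / 2\<close> and the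
    normalisation of \<open>G\<close>, the integral of its norm is at most half of one plus the
    measure of the domain.\<close>
  define Cg where "Cg = Cu * ((measure ?M (space ?M) + 1) / 2)"
  have Cg: "Cg \<ge> 0" using Cu by (simp add: Cg_def)
  have main: "(LINT x|?M. f x * \<phi> x) \<le> (Ct * c + Cg) * (t0 / 2 ^ n * sqrt (m * L1_norm \<Omega> f)
        + L1_norm \<Omega> f * sqrt (1 + (\<Sum>k<n. 1 / (t0 / 2 ^ k) ^ (DIM('a) - 2))))"
    if f[measurable]: "f \<in> borel_measurable ?M" and fm: "AE x in ?M. \<bar>f x\<bar> \<le> m" and mean: "(LINT x|?M. f x) = 0"
      and m: "0 < m" and F: "0 < L1_norm \<Omega> f" and W: "W11 \<Omega> \<phi> G" and G1: "(\<integral>\<^sup>+x. (norm (G x))\<^sup>2 \<partial>?M) \<le> 1"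
    for f \<phi> G m n
  proof -
    let ?F = "L1_norm \<Omega> f"
    have \<phi>: "integrable ?M \<phi>" and G: "integrable ?M G" using W by (auto simp: W11_def)
    have [measurable]: "\<phi> \<in> borel_measurable ?M" "G \<in> borel_measurable ?M" using \<phi> G by auto
    define A where "A N x = avg \<Omega> \<phi> (x + (t0 / 2 ^ N) *\<^sub>R e x) (\<kappa> * (t0 / 2 ^ N))" for N x
    define A' where "A' = avg \<Omega> \<phi> a r'"
    have [measurable]: "A N \<in> borel_measurable ?M" for N
      unfolding A_def[abs_def] using e_meas by (intro borel_measurable_avg finite_measure_axioms) measurable
    have fi: "integrable ?M f"
      by (rule integrable_const_bound[OF fm[folded real_norm_def] f])
    have Fe: "(\<integral>\<^sup>+x. ennreal \<bar>f x\<bar> \<partial>?M) = ennreal ?F"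
      unfolding L1_norm_def using fi by (intro nn_integral_eq_integral) auto
    have f\<phi>: "integrable ?M (\<lambda>x. f x * \<phi> x)"
    proof (rule Bochner_Integration.integrable_bound[OF integrable_mult_right[OF \<phi>, of m]])
      show "AE x in ?M. norm (f x * \<phi> x) \<le> norm (m * \<phi> x)"
        using fm by eventually_elim (use m in \<open>simp add: abs_mult mult_right_mono\<close>)
    qed measurable
    define X where "X = t0 / 2 ^ n * sqrt (m * ?F)"
    define Y where "Y = ?F * sqrt (1 + (\<Sum>k<n. 1 / (t0 / 2 ^ k) ^ (DIM('a) - 2)))"
    have X0: "X \<ge> 0" using t0 m F by (simp add: X_def)
    have "sqrt 1 \<le> sqrt (1 + (\<Sum>k<n. 1 / (t0 / 2 ^ k) ^ (DIM('a) - 2)))"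
      using t0 by (intro real_sqrt_le_mono) (auto intro!: sum_nonneg)
    \<comment> \<open>The \<open>1\<close> under the root makes \<open>Y\<close> at least the L1
      norm, so the contribution of the top scale is absorbed into \<open>Y\<close>.\<close>
    then have YF: "?F \<le> Y" using mult_left_mono[of 1 _ ?F] F by (simp add: Y_def)
    have top: "(\<integral>\<^sup>+x. ennreal (\<bar>f x\<bar> * \<bar>A 0 x - A'\<bar>) \<partial>?M) \<le> ennreal (Cg * ?F)"
    proof -
      let ?G = "LINT y|?M. norm (G y)"
      have "ennreal ?G = (\<integral>\<^sup>+y. ennreal (norm (G y)) \<partial>?M)"
        using G by (intro nn_integral_eq_integral[symmetric]) auto
      also have "\<dots> \<le> (\<integral>\<^sup>+y. ennreal (1 / 2) + ennreal (1 / 2) * ennreal ((norm (G y))\<^sup>2) \<partial>?M)"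
      proof (rule nn_integral_mono)
        fix y
        have "norm (G y) \<le> 1 / 2 + 1 / 2 * (norm (G y))\<^sup>2"
          using sum_squares_bound[of 1 "norm (G y)"] by simp
        then have "ennreal (norm (G y)) \<le> ennreal (1 / 2 + 1 / 2 * (norm (G y))\<^sup>2)" by (rule ennreal_leI)
        also have "\<dots> = ennreal (1 / 2) + ennreal (1 / 2 * (norm (G y))\<^sup>2)"
          by (intro ennreal_plus) auto
        also have "ennreal (1 / 2 * (norm (G y))\<^sup>2) = ennreal (1 / 2) * ennreal ((norm (G y))\<^sup>2)"
          by (intro ennreal_mult) auto
        finally show "ennreal (norm (G y)) \<le> ennreal (1 / 2) + ennreal (1 / 2) * ennreal ((norm (G y))\<^sup>2)" .
      qed
      also have "\<dots> = ennreal (1 / 2) * emeasure ?M (space ?M) + ennreal (1 / 2) * (\<integral>\<^sup>+y. (norm (G y))\<^sup>2 \<partial>?M)"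
        by (simp add: nn_integral_add nn_integral_cmult)
      also have "\<dots> \<le> ennreal (1 / 2) * ennreal (measure ?M (space ?M)) + ennreal (1 / 2) * 1"
        using G1 by (intro add_mono mult_left_mono) (auto simp: emeasure_eq_measure)
      also have "\<dots> = ennreal (1 / 2 * measure ?M (space ?M)) + ennreal (1 / 2)"
        by (subst ennreal_mult) simp_all
      also have "\<dots> = ennreal (1 / 2 * measure ?M (space ?M) + 1 / 2)"
        by (intro ennreal_plus[symmetric]) auto
      finally have "?G \<le> 1 / 2 * measure ?M (space ?M) + 1 / 2"
        by (subst (asm) ennreal_le_iff) auto
      then have CG: "Cu * ?G \<le> Cg" unfolding Cg_def using Cu by (intro mult_left_mono) auto
      have "(\<integral>\<^sup>+x. ennreal (\<bar>f x\<bar> * \<bar>A 0 x - A'\<bar>) \<partial>?M) \<le> (\<integral>\<^sup>+x. ennreal \<bar>f x\<bar> * ennreal Cg \<partial>?M)"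
      proof (rule nn_integral_mono)
        fix x assume "x \<in> space ?M"
        then have x: "x \<in> \<Omega>" by (simp add: space_restrict_space)
        have "\<bar>A 0 x - A'\<bar> \<le> Cu * ?G"
          using unif[OF W cone[OF x t0 order_refl]] by (simp add: A_def A'_def)
        then have "\<bar>f x\<bar> * \<bar>A 0 x - A'\<bar> \<le> \<bar>f x\<bar> * Cg" using CG by (intro mult_left_mono) auto
        then show "ennreal (\<bar>f x\<bar> * \<bar>A 0 x - A'\<bar>) \<le> ennreal \<bar>f x\<bar> * ennreal Cg"
          using Cg by (simp add: ennreal_mult[symmetric] ennreal_leI)
      qed
      also have "\<dots> = ennreal ?F * ennreal Cg"
        by (subst nn_integral_multc) (auto simp: Fe)
      also have "\<dots> = ennreal (Cg * ?F)" using Cg F by (simp add: ennreal_mult mult.commute)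
      finally show ?thesis .
    qed
    have chain: "(\<integral>\<^sup>+x. ennreal (\<bar>f x\<bar> * \<bar>A N x - A 0 x\<bar>) \<partial>?M) \<le> ennreal (Ct * (c * (X + Y)))" for N
    proof -
      define w where "w k = 1 / (t0 / 2 ^ k) ^ (DIM('a) - 1)" for k
      have w: "w k \<ge> 0" for k using t0 by (simp add: w_def)
      define K where "K x y = (\<Sum>k<N. w k * of_bool (dist x y < 3 * (t0 / 2 ^ k)))" for x y :: 'a
      have K0: "K x y \<ge> 0" for x y unfolding K_def using w by (intro sum_nonneg) auto
      have K_int: "integrable ?M (\<lambda>y. norm (G y) * K x y)" and
        K_eq: "(LINT y|?M. norm (G y) * K x y) = (\<Sum>k<N. w k * (LINT y|?M. norm (G y) * of_bool (dist x y < 3 * (t0 / 2 ^ k))))" for x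
      proof -
        have eq: "norm (G y) * K x y = (\<Sum>k<N. w k * (norm (G y) * of_bool (dist x y < 3 * (t0 / 2 ^ k))))" for y
          unfolding K_def sum_distrib_left by (intro sum.cong) auto
        have i: "integrable ?M (\<lambda>y. w k * (norm (G y) * of_bool (dist x y < 3 * (t0 / 2 ^ k))))" for k
          using integrable_norm_mult_of_bool_dist[OF G] by (rule integrable_mult_right)
        show "integrable ?M (\<lambda>y. norm (G y) * K x y)"
          unfolding eq by (intro Bochner_Integration.integrable_sum i)
        show "(LINT y|?M. norm (G y) * K x y) = (\<Sum>k<N. w k * (LINT y|?M. norm (G y) * of_bool (dist x y < 3 * (t0 / 2 ^ k))))"
          unfolding eq by (subst Bochner_Integration.integral_sum[OF i]) (simp only: integral_mult_right_zero)
      qed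
      have Km[measurable]: "(\<lambda>(x, y). K x y) \<in> borel_measurable (?M \<Otimes>\<^sub>M ?M)"
        unfolding K_def by measurable
      have "(\<integral>\<^sup>+x. ennreal (\<bar>f x\<bar> * \<bar>A N x - A 0 x\<bar>) \<partial>?M)
        \<le> (\<integral>\<^sup>+x. ennreal Ct * (\<integral>\<^sup>+y. ennreal (\<bar>f x\<bar> * (norm (G y) * K x y)) \<partial>?M) \<partial>?M)"
      proof (rule nn_integral_mono)
        fix x assume "x \<in> space ?M"
        then have x: "x \<in> \<Omega>" by (simp add: space_restrict_space)
        have "\<bar>A N x - A 0 x\<bar> \<le> Ct * (LINT y|?M. norm (G y) * K x y)"
          using avg_telescope[OF \<Omega>(1) W t0 \<kappa> e[OF x] cone[OF x], of N]
          by (simp add: A_def Ct_def K_eq w_def)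
        then have "\<bar>f x\<bar> * \<bar>A N x - A 0 x\<bar> \<le> \<bar>f x\<bar> * (Ct * (LINT y|?M. norm (G y) * K x y))"
          by (intro mult_left_mono) auto
        also have "\<dots> = Ct * (LINT y|?M. \<bar>f x\<bar> * (norm (G y) * K x y))"
          by simp
        finally have "ennreal (\<bar>f x\<bar> * \<bar>A N x - A 0 x\<bar>) \<le> ennreal (Ct * (LINT y|?M. \<bar>f x\<bar> * (norm (G y) * K x y)))"
          by (rule ennreal_leI)
        also have "\<dots> = ennreal Ct * ennreal (LINT y|?M. \<bar>f x\<bar> * (norm (G y) * K x y))"
          using Ct K0 by (intro ennreal_mult integral_nonneg_AE) auto
        also have "ennreal (LINT y|?M. \<bar>f x\<bar> * (norm (G y) * K x y)) = (\<integral>\<^sup>+y. ennreal (\<bar>f x\<bar> * (norm (G y) * K x y)) \<partial>?M)"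
          using K0 by (intro nn_integral_eq_integral[symmetric] integrable_mult_right K_int) auto
        finally show "ennreal (\<bar>f x\<bar> * \<bar>A N x - A 0 x\<bar>) \<le> ennreal Ct * (\<integral>\<^sup>+y. ennreal (\<bar>f x\<bar> * (norm (G y) * K x y)) \<partial>?M)" .
      qed
      also have "\<dots> = ennreal Ct * (\<integral>\<^sup>+x. \<integral>\<^sup>+y. ennreal (\<bar>f x\<bar> * (norm (G y) * K x y)) \<partial>?M \<partial>?M)"
        by (intro nn_integral_cmult) measurable
      also have "\<dots> \<le> ennreal Ct * ennreal (c * (X + Y))"
        unfolding K_def w_def X_def Y_def c_def
        by (intro mult_left_mono potential_bound[OF d \<Omega>(1,2)])
           (use fm m F t0 G1 in \<open>auto simp: Fe\<close>)
      also have "\<dots> = ennreal (Ct * (c * (X + Y)))"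
        using Ct c X0 YF F by (intro ennreal_mult[symmetric]) auto
      finally show ?thesis .
    qed
    \<comment> \<open>The level \<open>N\<close> depends on \<open>\<epsilon>\<close>, but the
      telescoping bound is the same for all \<open>N\<close>, so \<open>\<epsilon>\<close> may
      afterwards tend to zero.\<close>
    have "(LINT x|?M. f x * \<phi> x) \<le> (Ct * c + Cg) * (X + Y) + \<epsilon>" if \<epsilon>: "\<epsilon> > 0" for \<epsilon>
    proof -
      obtain N where N: "(\<integral>\<^sup>+x. ennreal (\<bar>f x\<bar> * \<bar>\<phi> x - A N x\<bar>) \<partial>?M) \<le> ennreal \<epsilon>"
        using avg_converges[OF \<Omega>(1,2) \<phi> \<kappa> t0 e cone fm m \<epsilon>] unfolding A_def by blast
      have "(LINT x|?M. f x * \<phi> x) = (LINT x|?M. f x * (\<phi> x - A'))"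
        using f\<phi> fi mean by (simp add: right_diff_distrib)
      then have "ennreal (LINT x|?M. f x * \<phi> x) \<le> ennreal (norm (LINT x|?M. f x * (\<phi> x - A')))"
        by (intro ennreal_leI) simp
      also have "\<dots> \<le> (\<integral>\<^sup>+x. ennreal (norm (f x * (\<phi> x - A'))) \<partial>?M)"
        using f\<phi> fi by (intro integral_norm_bound_ennreal) (simp add: right_diff_distrib)
      also have "\<dots> \<le> (\<integral>\<^sup>+x. ennreal (\<bar>f x\<bar> * \<bar>\<phi> x - A N x\<bar>) + (ennreal (\<bar>f x\<bar> * \<bar>A N x - A 0 x\<bar>) + ennreal (\<bar>f x\<bar> * \<bar>A 0 x - A'\<bar>)) \<partial>?M)"
      proof (rule nn_integral_mono)
        fix x
        have "\<bar>\<phi> x - A'\<bar> \<le> \<bar>\<phi> x - A N x\<bar> + (\<bar>A N x - A 0 x\<bar> + \<bar>A 0 x - A'\<bar>)" by linarith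
        then have "\<bar>f x\<bar> * \<bar>\<phi> x - A'\<bar> \<le> \<bar>f x\<bar> * (\<bar>\<phi> x - A N x\<bar> + (\<bar>A N x - A 0 x\<bar> + \<bar>A 0 x - A'\<bar>))"
          by (intro mult_left_mono) auto
        then have "ennreal (norm (f x * (\<phi> x - A'))) \<le> ennreal (\<bar>f x\<bar> * \<bar>\<phi> x - A N x\<bar> + (\<bar>f x\<bar> * \<bar>A N x - A 0 x\<bar> + \<bar>f x\<bar> * \<bar>A 0 x - A'\<bar>))"
          by (intro ennreal_leI) (simp add: abs_mult distrib_left)
        then show "ennreal (norm (f x * (\<phi> x - A'))) \<le> ennreal (\<bar>f x\<bar> * \<bar>\<phi> x - A N x\<bar>) + (ennreal (\<bar>f x\<bar> * \<bar>A N x - A 0 x\<bar>) + ennreal (\<bar>f x\<bar> * \<bar>A 0 x - A'\<bar>))"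
          by simp
      qed
      also have "\<dots> = (\<integral>\<^sup>+x. ennreal (\<bar>f x\<bar> * \<bar>\<phi> x - A N x\<bar>) \<partial>?M) + ((\<integral>\<^sup>+x. ennreal (\<bar>f x\<bar> * \<bar>A N x - A 0 x\<bar>) \<partial>?M) + (\<integral>\<^sup>+x. ennreal (\<bar>f x\<bar> * \<bar>A 0 x - A'\<bar>) \<partial>?M))"
        by (simp add: nn_integral_add)
      also have "\<dots> \<le> ennreal \<epsilon> + (ennreal (Ct * (c * (X + Y))) + ennreal (Cg * ?F))"
        by (intro add_mono N chain top)
      also have "\<dots> = ennreal (\<epsilon> + (Ct * (c * (X + Y)) + Cg * ?F))"
        using \<epsilon> Ct c X0 YF F Cg by (simp add: ennreal_plus)
      finally have "(LINT x|?M. f x * \<phi> x) \<le> \<epsilon> + (Ct * (c * (X + Y)) + Cg * ?F)"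
        using \<epsilon> Ct c X0 YF F Cg by (subst (asm) ennreal_le_iff) auto
      also have "Cg * ?F \<le> Cg * (X + Y)" using Cg X0 YF by (intro mult_left_mono) auto
      finally show ?thesis by (simp add: algebra_simps)
    qed
    then have "(LINT x|?M. f x * \<phi> x) \<le> (Ct * c + Cg) * (X + Y)"
      by (rule field_le_epsilon)
    then show ?thesis by (simp add: X_def Y_def)
  qed
  have "Ct * c + Cg > 0" using Ct c Cg by (intro add_pos_nonneg mult_pos_pos) auto
  then show ?thesis using t0 main by (intro exI[of _ "Ct * c + Cg"] exI[of _ t0] conjI) blast+
qed

section \<open>Choice of the cutoff scale\<close>

text \<open>The least admissible \<open>n\<close> controls both sides: the fine scales start at or
  below \<open>r\<close>, and every coarse scale exceeds \<open>r\<close>. If already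
  \<open>t \<le> r\<close>, then \<open>n = 0\<close> and there are no coarse scales.\<close>

lemma dyadic_cutoff:
  fixes t r :: real
  assumes "0 < t" "0 < r"
  obtains n where "t / 2 ^ n \<le> r" "\<And>k. k < n \<Longrightarrow> r < t / 2 ^ k"
proof -
  obtain n where "(1 / 2) ^ n < r / t"
    using real_arch_pow_inv[of "r / t" "1 / 2"] assms by auto
  then have ex: "t / 2 ^ n \<le> r" using assms by (simp add: power_divide field_simps)
  define n0 where "n0 = (LEAST n. t / 2 ^ n \<le> r)"
  show thesis
  proof (rule that[of n0])
    show "t / 2 ^ n0 \<le> r" unfolding n0_def using ex by (rule LeastI)
    show "r < t / 2 ^ k" if "k < n0" for k
      using not_less_Least[OF that[unfolded n0_def]] by simp
  qed
qed

text \<open>The number of dyadic scales between \<open>r\<close> and \<open>t\<close> is logarithmic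
  in \<open>t / r\<close>. The fixed \<open>t\<close> goes into the constant, and the
  \<open>1\<close> next to the logarithm keeps the bound valid when \<open>F / m\<close> is close to
  one.\<close>

lemma dyadic_optimize_log:
  fixes t :: real
  assumes t: "0 < t"
  shows "\<exists>C>0. \<forall>F m. 0 < F \<longrightarrow> 0 < m \<longrightarrow>
    (\<exists>n. t / 2 ^ n * sqrt (m * F) + F * sqrt (1 + real n) \<le> C * (F * sqrt (\<bar>ln (F / m)\<bar> + 1)))"
proof (intro exI[of _ "1 + sqrt (2 + 2 * \<bar>ln t\<bar>)"] conjI allI impI)
  show "0 < 1 + sqrt (2 + 2 * \<bar>ln t\<bar>)" by (intro add_pos_nonneg) auto
  fix F m :: real assume F: "0 < F" and m: "0 < m"
  define L where "L = ln (F / m)"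
  \<comment> \<open>With this choice \<open>r * sqrt (m * F) = F\<close>, so the fine scales cost no
    more than the coarse ones.\<close>
  define r where "r = sqrt (F / m)"
  have r: "r > 0" using F m by (simp add: r_def)
  obtain n where n: "t / 2 ^ n \<le> r" "\<And>k. k < n \<Longrightarrow> r < t / 2 ^ k"
    using dyadic_cutoff[OF t r] by blast
  have "real n \<le> 1 + 2 * \<bar>ln t\<bar> + \<bar>L\<bar>"
  proof (cases n)
    case (Suc j)
    then have "r < t / 2 ^ j" using n(2)[of j] by simp
    then have "2 ^ j < t / r" using r by (simp add: field_simps)
    then have "ln (2 ^ j) < ln (t / r)" using t r by (subst ln_less_cancel_iff) auto
    then have "real j * ln 2 < ln t - ln r" using t r by (simp add: ln_realpow ln_div)
    also have "ln r = L / 2" using F m by (simp add: r_def L_def ln_sqrt)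
    also have "ln t - L / 2 \<le> \<bar>ln t\<bar> + \<bar>L\<bar> / 2" by linarith
    finally have 1: "real j * ln 2 < \<bar>ln t\<bar> + \<bar>L\<bar> / 2" .
    \<comment> \<open>This crude bound is the source of the factor two in front of
      \<open>\<bar>ln t\<bar>\<close> in the constant.\<close>
    have "ln 2 \<ge> (1 / 2 :: real)" using ln2_ge_two_thirds by simp
    then have "real j * (1 / 2) \<le> real j * ln 2" by (intro mult_left_mono) auto
    then show ?thesis using 1 Suc by simp
  qed simp
  then have "1 + real n \<le> (2 + 2 * \<bar>ln t\<bar>) + \<bar>L\<bar>" by linarith
  also have "\<dots> \<le> (2 + 2 * \<bar>ln t\<bar>) * (\<bar>L\<bar> + 1)" by (simp add: algebra_simps)
  finally have "sqrt (1 + real n) \<le> sqrt (2 + 2 * \<bar>ln t\<bar>) * sqrt (\<bar>L\<bar> + 1)"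
    by (simp add: real_sqrt_mult[symmetric])
  then have 2: "F * sqrt (1 + real n) \<le> F * (sqrt (2 + 2 * \<bar>ln t\<bar>) * sqrt (\<bar>L\<bar> + 1))"
    using F by (intro mult_left_mono) auto
  have "t / 2 ^ n * sqrt (m * F) \<le> r * sqrt (m * F)"
    using n(1) F m by (intro mult_right_mono) auto
  also have "\<dots> = F" using F m by (simp add: r_def real_sqrt_mult[symmetric])
  also have "\<dots> \<le> F * sqrt (\<bar>L\<bar> + 1)" using F by simp
  finally have "t / 2 ^ n * sqrt (m * F) + F * sqrt (1 + real n) \<le> (1 + sqrt (2 + 2 * \<bar>ln t\<bar>)) * (F * sqrt (\<bar>L\<bar> + 1))"
    using 2 by (simp add: algebra_simps)
  then show "\<exists>n. t / 2 ^ n * sqrt (m * F) + F * sqrt (1 + real n) \<le> (1 + sqrt (2 + 2 * \<bar>ln t\<bar>)) * (F * sqrt (\<bar>ln (F / m)\<bar> + 1))"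
    unfolding L_def by blast
qed

text \<open>The sum over coarse scales is geometric and dominated by its finest term, of order
  \<open>r\<close> to the power \<open>2 - d\<close>. The assumption \<open>F \<le> m * V\<close>
  bounds \<open>r\<close> from above, so that the constant \<open>1\<close> under the root is of
  that order as well.\<close>

lemma dyadic_optimize_powr:
  fixes t V :: real and d :: nat
  assumes t: "0 < t" and d: "d > 2" and V: "0 < V"
  shows "\<exists>C>0. \<forall>F m. 0 < F \<longrightarrow> 0 < m \<longrightarrow> F \<le> m * V \<longrightarrow>
    (\<exists>n. t / 2 ^ n * sqrt (m * F) + F * sqrt (1 + (\<Sum>k<n. 1 / (t / 2 ^ k) ^ (d - 2)))
       \<le> C * (F powr (1 / 2 + 1 / d) * m powr (1 / 2 - 1 / d)))"
proof (intro exI[of _ "1 + sqrt ((V powr (1 / d)) ^ (d - 2) + 2)"] conjI allI impI)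
  let ?V = "(V powr (1 / d)) ^ (d - 2)" and ?p = "d - 2"
  show "0 < 1 + sqrt (?V + 2)" by (intro add_pos_nonneg) auto
  fix F m :: real assume F: "0 < F" and m: "0 < m" and FV: "F \<le> m * V"
  define r where "r = (F / m) powr (1 / d)"
  have r: "r > 0" using F m by (simp add: r_def)
  obtain n where n: "t / 2 ^ n \<le> r" "\<And>k. k < n \<Longrightarrow> r < t / 2 ^ k"
    using dyadic_cutoff[OF t r] by blast
  \<comment> \<open>The last coarse scale is \<open>t / 2 ^ (n - 1)\<close>, still larger than
    \<open>r\<close> by minimality of the cutoff; for \<open>n = 0\<close> the sum is empty.\<close>
  have \<Sigma>: "(\<Sum>k<n. 1 / (t / 2 ^ k) ^ ?p) \<le> 2 / r ^ ?p"
  proof (cases n)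
    case (Suc j)
    have "2 ^ 1 \<le> (2::real) ^ ?p" using d by (intro power_increasing) auto
    then have "(\<Sum>k<Suc j. ((2::real) ^ ?p) ^ k) \<le> 2 * (2 ^ ?p) ^ j" by (intro sum_geometric_le) simp
    then have "1 / t ^ ?p * (\<Sum>k<Suc j. ((2::real) ^ ?p) ^ k) \<le> 1 / t ^ ?p * (2 * (2 ^ ?p) ^ j)"
      using t by (intro mult_left_mono) auto
    moreover have "1 / (t / 2 ^ k) ^ ?p = 1 / t ^ ?p * (2 ^ ?p) ^ k" for k
      by (simp add: power_divide power_mult[symmetric] mult.commute)
    ultimately have "(\<Sum>k<n. 1 / (t / 2 ^ k) ^ ?p) \<le> 2 / (t / 2 ^ j) ^ ?p"
      unfolding Suc by (simp only: sum_distrib_left) (simp add: power_divide power_mult[symmetric] mult.commute)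
    also have "\<dots> \<le> 2 / r ^ ?p"
      using n(2)[of j] Suc r t by (intro divide_left_mono power_mono mult_pos_pos zero_less_power) auto
    finally show ?thesis .
  qed (use r in simp)
  have "r \<le> V powr (1 / d)"
    unfolding r_def using F m FV by (intro powr_mono2) (auto simp: field_simps)
  then have "r ^ ?p \<le> ?V" using r by (intro power_mono) auto
  then have "1 \<le> ?V / r ^ ?p" using r by simp
  then have "1 + (\<Sum>k<n. 1 / (t / 2 ^ k) ^ ?p) \<le> (?V + 2) / r ^ ?p"
    using \<Sigma> by (simp add: add_divide_distrib)
  then have "sqrt (1 + (\<Sum>k<n. 1 / (t / 2 ^ k) ^ ?p)) \<le> sqrt (?V + 2) / sqrt (r ^ ?p)"
    by (simp add: real_sqrt_divide[symmetric])
  then have "F * sqrt (1 + (\<Sum>k<n. 1 / (t / 2 ^ k) ^ ?p)) \<le> F * (sqrt (?V + 2) / sqrt (r ^ ?p))"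
    using F by (intro mult_left_mono) auto
  also have "\<dots> = sqrt (?V + 2) * (F / sqrt (r ^ ?p))" by simp
  also have "F / sqrt (r ^ ?p) = F powr (1 / 2 + 1 / d) * m powr (1 / 2 - 1 / d)"
  proof -
    have "r ^ ?p = r powr real ?p" using r by (simp add: powr_realpow)
    then have "sqrt (r ^ ?p) = (F / m) powr (1 / d * real ?p * (1 / 2))"
      by (simp add: powr_half_sqrt[symmetric] r_def powr_powr)
    also have "1 / d * real ?p * (1 / 2) = 1 / 2 - 1 / d"
      using d by (simp add: of_nat_diff field_simps)
    finally have "F / sqrt (r ^ ?p) = F powr 1 / (F powr (1 / 2 - 1 / d) / m powr (1 / 2 - 1 / d))"
      using F m by (simp add: powr_divide)
    also have "\<dots> = F powr 1 / F powr (1 / 2 - 1 / d) * m powr (1 / 2 - 1 / d)" by simp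
    also have "F powr 1 / F powr (1 / 2 - 1 / d) = F powr (1 - (1 / 2 - 1 / d))"
      by (rule powr_diff[symmetric])
    also have "1 - (1 / 2 - 1 / real d) = 1 / 2 + 1 / d" by simp
    finally show ?thesis .
  qed
  finally have 2: "F * sqrt (1 + (\<Sum>k<n. 1 / (t / 2 ^ k) ^ ?p)) \<le> sqrt (?V + 2) * (F powr (1 / 2 + 1 / d) * m powr (1 / 2 - 1 / d))" .
  have "t / 2 ^ n * sqrt (m * F) \<le> r * sqrt (m * F)"
    using n(1) F m by (intro mult_right_mono) auto
  also have "\<dots> = F powr (1 / d) / m powr (1 / d) * (m powr (1 / 2) * F powr (1 / 2))"
    using F m by (simp add: r_def powr_divide powr_half_sqrt real_sqrt_mult)
  also have "\<dots> = (F powr (1 / 2) * F powr (1 / d)) * (m powr (1 / 2) / m powr (1 / d))" by simp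
  also have "\<dots> = F powr (1 / 2 + 1 / d) * m powr (1 / 2 - 1 / d)"
    by (simp only: powr_add powr_diff)
  finally show "\<exists>n. t / 2 ^ n * sqrt (m * F) + F * sqrt (1 + (\<Sum>k<n. 1 / (t / 2 ^ k) ^ ?p))
       \<le> (1 + sqrt (?V + 2)) * (F powr (1 / 2 + 1 / d) * m powr (1 / 2 - 1 / d))"
    using 2 by (intro exI[of _ n]) (simp add: distrib_right)
qed

section \<open>From the norms in the definitions to the estimate\<close>

lemma L2_imp_integrable:
  fixes u :: "'a::euclidean_space \<Rightarrow> 'b::euclidean_space"
  assumes "finite_measure (lebesgue_on S)" "u \<in> L2 S"
  shows "integrable (lebesgue_on S) u"
proof -
  interpret finite_measure "lebesgue_on S" by fact
  have u: "u \<in> borel_measurable (lebesgue_on S)" "integrable (lebesgue_on S) (\<lambda>x. (norm (u x))\<^sup>2)"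
    using assms(2) by (auto simp: L2_def)
  show ?thesis
  proof (rule Bochner_Integration.integrable_bound)
    show "integrable (lebesgue_on S) (\<lambda>x. 1 + (norm (u x))\<^sup>2)" using u by simp
    have "norm (u x) \<le> 1 + (norm (u x))\<^sup>2" for x
      using sum_squares_bound[of 1 "norm (u x)"] norm_ge_zero[of "u x"] unfolding power_one by linarith
    then show "AE x in lebesgue_on S. norm (u x) \<le> norm (1 + (norm (u x))\<^sup>2)" by simp
  qed (use u in simp)
qed

text \<open>A nonpositive essential supremum would force \<open>f\<close> to vanish almost
  everywhere. It is therefore positive and finite, and converting it to a real number loses nothing.
  The last inequality bounds the ratio of the norms by the volume, as the choice of cutoff for
  \<open>d > 2\<close> requires.\<close>

lemma Linf_norm_bounds:
  assumes f: "f \<in> Linf S" and fin: "finite_measure (lebesgue_on S)" and nz: "\<not> (AE x in lebesgue_on S. f x = 0)"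
  shows "0 < Linf_norm S f" "AE x in lebesgue_on S. \<bar>f x\<bar> \<le> Linf_norm S f"
    "0 < L1_norm S f" "L1_norm S f \<le> Linf_norm S f * measure (lebesgue_on S) (space (lebesgue_on S))"
proof -
  let ?M = "lebesgue_on S"
  interpret finite_measure ?M by fact
  define E where "E = esssup ?M (\<lambda>x. ereal \<bar>f x\<bar>)"
  have fm: "f \<in> borel_measurable ?M" and E: "E < \<infinity>" using f by (auto simp: Linf_def E_def)
  have ae: "AE x in ?M. ereal \<bar>f x\<bar> \<le> E" unfolding E_def by (rule esssup_AE)
  have "0 < E"
  proof (rule ccontr)
    assume "\<not> 0 < E"
    then have le: "E \<le> 0" by simp
    have "AE x in ?M. f x = 0"
      using ae
    proof eventually_elim
      case (elim x)
      then have "ereal \<bar>f x\<bar> \<le> 0" using le by (rule order_trans)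
      then show ?case by simp
    qed
    then show False using nz by simp
  qed
  then have Em: "E = ereal (Linf_norm S f)" and m: "0 < Linf_norm S f"
    using E by (cases E; simp add: Linf_norm_def E_def[symmetric])+
  show "0 < Linf_norm S f" by (rule m)
  show b: "AE x in ?M. \<bar>f x\<bar> \<le> Linf_norm S f" using ae by (simp add: Em)
  have fi: "integrable ?M f" by (rule integrable_const_bound[OF b[folded real_norm_def] fm])
  have "L1_norm S f \<noteq> 0"
    using nz integral_nonneg_eq_0_iff_AE[of ?M "\<lambda>x. \<bar>f x\<bar>"] fi by (simp add: L1_norm_def)
  then show "0 < L1_norm S f" unfolding L1_norm_def by (simp add: less_le)
  have "L1_norm S f \<le> (LINT x|?M. Linf_norm S f)"
    unfolding L1_norm_def using fi b by (intro integral_mono_AE) auto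
  then show "L1_norm S f \<le> Linf_norm S f * measure ?M (space ?M)" by (simp add: mult.commute)
qed

lemma Hneg1_norm_leI:
  assumes fin: "finite_measure (lebesgue_on S)"
    and B: "\<And>\<phi> G. W11 S \<phi> G \<Longrightarrow> (\<integral>\<^sup>+x. (norm (G x))\<^sup>2 \<partial>lebesgue_on S) \<le> 1 \<Longrightarrow> (LINT x|lebesgue_on S. f x * \<phi> x) \<le> B"
  shows "Hneg1_norm S f \<le> ereal B"
  unfolding Hneg1_norm_def
proof (rule SUP_least)
  fix \<phi> assume "\<phi> \<in> {\<phi> \<in> H1 S. \<exists>G\<in>L2 S. weak_gradient S \<phi> G \<and> L2_norm S G \<le> 1}"
  then obtain G where \<phi>: "\<phi> \<in> L2 S" and G: "G \<in> L2 S" and wg: "weak_gradient S \<phi> G" and le: "L2_norm S G \<le> 1"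
    by (auto simp: H1_def)
  have "W11 S \<phi> G" using L2_imp_integrable[OF fin \<phi>] L2_imp_integrable[OF fin G] wg by (simp add: W11_def)
  moreover have "(\<integral>\<^sup>+x. (norm (G x))\<^sup>2 \<partial>lebesgue_on S) \<le> 1"
  proof -
    \<comment> \<open>Square integrability of \<open>G\<close> matters here: without it the Bochner
      integral in \<open>L2_norm\<close> would be the default \<open>0\<close> and would not bound
      the nonnegative integral.\<close>
    have "(\<integral>\<^sup>+x. (norm (G x))\<^sup>2 \<partial>lebesgue_on S) = ennreal (LINT x|lebesgue_on S. (norm (G x))\<^sup>2)"
      using G by (intro nn_integral_eq_integral) (auto simp: L2_def)
    also have "\<dots> \<le> ennreal 1"
      using le by (intro ennreal_leI) (simp add: L2_norm_def)
    finally show ?thesis by simp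
  qed
  ultimately show "ereal (LINT x|lebesgue_on S. f x * \<phi> x) \<le> ereal B" using B by simp
qed

theorem lemma2p1:
  fixes \<Omega> :: "(real ^ 'n) set"
  assumes "CARD('n) \<ge> 2"
    and "open \<Omega>" "bounded \<Omega>" "connected \<Omega>" "lipschitz_boundary \<Omega>"
  shows "\<exists>C>0. \<forall>f \<in> Linf \<Omega>.
           (LINT x|lebesgue_on \<Omega>. f x) = 0 \<longrightarrow> \<not> (AE x in lebesgue_on \<Omega>. f x = 0) \<longrightarrow>
           Hneg1_norm \<Omega> f \<le> ereal (C *
             (if CARD('n) = 2
              then L1_norm \<Omega> f * sqrt (\<bar>ln (L1_norm \<Omega> f / Linf_norm \<Omega> f)\<bar> + 1)
              else L1_norm \<Omega> f powr (1 / 2 + 1 / real CARD('n))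
                   * Linf_norm \<Omega> f powr (1 / 2 - 1 / real CARD('n))))"
proof (cases "\<Omega> = {}")
  case True
  \<comment> \<open>On the empty set every function vanishes almost everywhere, so no
    \<open>f\<close> satisfies the nonvanishing hypothesis.\<close>
  then have "AE x in lebesgue_on \<Omega>. f x = 0" for f :: "real ^ 'n \<Rightarrow> real"
    by (intro AE_I2) (simp add: space_restrict_space)
  then show ?thesis by (intro exI[of _ 1]) auto
next
  case False
  let ?M = "lebesgue_on \<Omega>" and ?d = "CARD('n)"
  have fin: "finite_measure ?M"
    using assms by (intro finite_measure_lebesgue_on) (simp add: bounded_set_imp_lmeasurable)
  obtain C t where C: "C > 0" and t: "t > 0" and est: "\<And>f \<phi> G m n. f \<in> borel_measurable ?M \<Longrightarrow> (AE x in ?M. \<bar>f x\<bar> \<le> m) \<Longrightarrow>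
     (LINT x|?M. f x) = 0 \<Longrightarrow> 0 < m \<Longrightarrow> 0 < L1_norm \<Omega> f \<Longrightarrow> W11 \<Omega> \<phi> G \<Longrightarrow>
     (\<integral>\<^sup>+x. (norm (G x))\<^sup>2 \<partial>?M) \<le> 1 \<Longrightarrow>
     (LINT x|?M. f x * \<phi> x) \<le> C * (t / 2 ^ n * sqrt (m * L1_norm \<Omega> f)
        + L1_norm \<Omega> f * sqrt (1 + (\<Sum>k<n. 1 / (t / 2 ^ k) ^ (?d - 2))))"
    using dual_pairing_estimate[OF _ assms(2-5) False] assms(1) by auto
  define R where "R F m = (if ?d = 2 then F * sqrt (\<bar>ln (F / m)\<bar> + 1)
       else F powr (1 / 2 + 1 / real ?d) * m powr (1 / 2 - 1 / real ?d))" for F m :: real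
  \<comment> \<open>The volume bounds the ratio of the norms; adding one makes it positive at
    once.\<close>
  let ?V = "measure ?M (space ?M) + 1"
  have V: "?V > 0" by (simp add: add_nonneg_pos)
  have "\<exists>C'>0. \<forall>F m. 0 < F \<longrightarrow> 0 < m \<longrightarrow> F \<le> m * ?V \<longrightarrow>
    (\<exists>n. t / 2 ^ n * sqrt (m * F) + F * sqrt (1 + (\<Sum>k<n. 1 / (t / 2 ^ k) ^ (?d - 2))) \<le> C' * R F m)"
  proof (cases "?d = 2")
    case True
    \<comment> \<open>In dimension two the exponent \<open>?d - 2\<close> is zero, each summand is
      \<open>1\<close>, and the sum equals \<open>n\<close>.\<close>
    then show ?thesis using dyadic_optimize_log[OF t] unfolding R_def by simp blast
  next
    case False
    then have "?d > 2" using assms(1) by simp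
    from dyadic_optimize_powr[OF t this V] show ?thesis unfolding R_def using False by simp
  qed
  then obtain C' where C': "C' > 0" and opt: "\<And>F m. 0 < F \<Longrightarrow> 0 < m \<Longrightarrow> F \<le> m * ?V \<Longrightarrow>
    \<exists>n. t / 2 ^ n * sqrt (m * F) + F * sqrt (1 + (\<Sum>k<n. 1 / (t / 2 ^ k) ^ (?d - 2))) \<le> C' * R F m"
    by blast
  have "Hneg1_norm \<Omega> f \<le> ereal (C * C' * R (L1_norm \<Omega> f) (Linf_norm \<Omega> f))"
    if f: "f \<in> Linf \<Omega>" and mean: "(LINT x|?M. f x) = 0" and nz: "\<not> (AE x in ?M. f x = 0)" for f
  proof (rule Hneg1_norm_leI[OF fin])
    fix \<phi> G assume W: "W11 \<Omega> \<phi> G" "(\<integral>\<^sup>+x. (norm (G x))\<^sup>2 \<partial>?M) \<le> 1"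
    note bounds = Linf_norm_bounds[OF f fin nz]
    have "L1_norm \<Omega> f \<le> Linf_norm \<Omega> f * ?V"
      using bounds(1,4) by (simp add: distrib_left)
    then obtain n where "t / 2 ^ n * sqrt (Linf_norm \<Omega> f * L1_norm \<Omega> f)
        + L1_norm \<Omega> f * sqrt (1 + (\<Sum>k<n. 1 / (t / 2 ^ k) ^ (?d - 2))) \<le> C' * R (L1_norm \<Omega> f) (Linf_norm \<Omega> f)"
      using opt[OF bounds(3,1)] by blast
    then have "C * (t / 2 ^ n * sqrt (Linf_norm \<Omega> f * L1_norm \<Omega> f)
        + L1_norm \<Omega> f * sqrt (1 + (\<Sum>k<n. 1 / (t / 2 ^ k) ^ (?d - 2)))) \<le> C * (C' * R (L1_norm \<Omega> f) (Linf_norm \<Omega> f))"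
      using C by (intro mult_left_mono) auto
    moreover have "f \<in> borel_measurable ?M" using f by (simp add: Linf_def)
    note est[OF this bounds(2) mean bounds(1,3) W, of n]
    ultimately show "(LINT x|?M. f x * \<phi> x) \<le> C * C' * R (L1_norm \<Omega> f) (Linf_norm \<Omega> f)"
      by (simp only: mult.assoc)
  qed
  then show ?thesis using C C' unfolding R_def by (intro exI[of _ "C * C'"]) simp
qed

end
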